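(* Let $\mathcal F$ be a saturated fusion system on a finite $p$-group $S$, and suppose that $\mathcal H,\mathcal K$ are saturated fusion subsystems of $\mathcal F$ on subgroups $R,T\le S$ respectively. Then $\mathcal F=\mathcal H\mathcal K$ (i.e. $\mathcal F$ is the composition product of $\mathcal H$ and $\mathcal K$ in the revised sense) if and only if the characteristic idempotents satisfy $$[R,\mathrm{id}]_S^R\circ\omega_{\mathcal F}\circ[T,\mathrm{id}]_T^S=\omega_{\mathcal H}\circ[R\cap T,\mathrm{id}]_T^R\circ\omega_{\mathcal K}.$$
   Context: Here $p$ is a prime and $p$-groups are finite. A fusion system $\mathcal F$ on a $p$-group $S$ is a category whose objects are the subgroups of $S$, whose morphism sets $\mathcal F(P,Q)=\mathrm{Hom}_{\mathcal F}(P,Q)$ consist of injective group homomorphisms $P\to Q$ (composed as homomorphisms) and contain all homomorphisms $P\to Q$ induced by conjugation by elements of $S$, and such that for each $\varphi\in\mathcal F(P,Q)$ the isomorphism $\varphi\colon P\to\varphi P$ and its inverse are morphisms of $\mathcal F$. Write $\mathrm{Aut}_{\mathcal F}(P)=\mathcal F(P,P)$. Subgroups $P,Q$ are $\mathcal F$-conjugate if they are isomorphic in $\mathcal F$; $[P]_{\mathcal F}$ is the set of $\mathcal F$-conjugates of $P$. $P$ is fully $\mathcal F$-normalized (resp. fully $\mathcal F$-centralized) if $|N_SP|\ge|N_SQ|$ (resp. $|C_SP|\ge|C_SQ|$) for all $Q\in[P]_{\mathcal F}$. $\mathcal F$ is saturated if for all $P\le S$: (1) if $P$ is fully $\mathcal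 F$-normalized, then $P$ is fully $\mathcal F$-centralized and $\mathrm{Aut}_S(P)$ is a Sylow $p$-subgroup of $\mathrm{Aut}_{\mathcal F}(P)$; (2) every $\varphi\in\mathcal F(P,S)$ with $\varphi(P)$ fully $\mathcal F$-centralized extends to a morphism in $\mathcal F(N_\varphi,S)$, where $N_\varphi=\{x\in N_S(P)\mid \exists y\in S:\varphi\circ c_x=c_y\circ\varphi\}$. A fusion subsystem of $\mathcal F$ on $R\le S$ is a subcategory of $\mathcal F$ that is a fusion system on $R$. $\mathcal H\cap\mathcal K$ is the fusion system on $R\cap T$ with $\mathrm{Hom}_{\mathcal H\cap\mathcal K}(P,Q)=\mathcal H(P,Q)\cap\mathcal K(P,Q)$. Composition product (revised definition): $\mathcal F=\mathcal H\mathcal K$ means that (1) $S=RT$; (2) for all $P\le T$, every $\varphi\in\mathcal F(P,R)$ can be written as $\varphi=\psi\rho$ with $\psi$ a morphism of $\mathcal H$ and $\rho$ a morphism of $\mathcal K$; (3) for all $Q\le R\cap T$, $|\mathcal F(Q,S)|=\dfrac{|\mathcal H(Q,R)|\cdot|\mathcal K(Q,T)|}{|\mathrm{Hom}_{\mathcal H\cap\mathcal K}(Q,R\cap T)|}$. Bisets: for finite groups $G,H$, a $(G,H)$-biset is a finite set with commuting right $G$-action and left $H$-action, regarded as a left $(H\times G)$-set via $(h,g).x=hxg^{-1}$. $A(G,H)$ is the Grothendieck group of isomorphism classes of $(G,H)$-bisets under disjoint union. Composition $\circ\colon A(H,K)\times A(G,H)\to A(G,K)$ is induced by $Y\circ X=Y\times_HX$.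 For $U\le G$ and a homomorphism $\varphi\colon U\to H$, $\Delta(U,\varphi)=\{(\varphi(u),u)\mid u\in U\}\le H\times G$ and $[U,\varphi]_G^H=[(H\times G)/\Delta(U,\varphi)]\in A(G,H)$. The subscript $(p)$ denotes tensoring with $\mathbb Z_{(p)}$. The displayed equation takes place in $A(T,R)_{(p)}$. Characteristic idempotent: for a fusion system $\mathcal F$ on $S$, $X\in A(S,S)_{(p)}$ is $\mathcal F$-generated if it is a $\mathbb Z_{(p)}$-linear combination of elements $[P,\varphi]_S^S$ with $P\le S$, $\varphi\in\mathcal F(P,S)$. It is right $\mathcal F$-stable if $X\circ[P,\varphi]_P^S=X\circ[P,\mathrm{id}]_P^S$, and left $\mathcal F$-stable if $[\varphi P,\varphi^{-1}]_S^P\circ X=[P,\mathrm{id}]_S^P\circ X$, for all $P\le S$, $\varphi\in\mathcal F(P,S)$. It is $\mathcal F$-characteristic if it is $\mathcal F$-generated, left and right $\mathcal F$-stable, and $\varepsilon(X)$ is invertible in $\mathbb Z_{(p)}$, where $\varepsilon$ is the $\mathbb Z_{(p)}$-linear extension of $X\mapsto|X|/|S|$ to the span of left-free bisets. For each saturated $\mathcal F$ there is exactly one idempotent (with respect to $\circ$) in $A(S,S)_{(p)}$ that is $\mathcal F$-characteristic; it is the characteristic idempotent $\omega_{\mathcal F}$. Thus $\omega_{\mathcal H}\in A(R,R)_{(p)}$ and $\omega_{\mathcal K}\in A(T,T)_{(p)}$. *)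

theory Defs
  imports
    "HOL-Algebra.Group_Action"
    "HOL-Algebra.Left_Coset"
    "HOL-Library.Poly_Mapping"
    "HOL-Library.Countable_Set"
    "HOL-Computational_Algebra.Primes"
begin

section \<open>Finite p-groups\<close>

definition p_group :: "nat \<Rightarrow> ('a, 'b) monoid_scheme \<Rightarrow> bool" where
  "p_group p G \<longleftrightarrow> group G \<and> finite (carrier G) \<and> (\<exists>n. order G = p ^ n)"

definition sylow_subgroup :: "nat \<Rightarrow> 'a set \<Rightarrow> ('a, 'b) monoid_scheme \<Rightarrow> bool" where
  "sylow_subgroup p P G \<longleftrightarrow> subgroup P G \<and> card P = p ^ multiplicity p (order G)"

definition centralizer :: "('a, 'b) monoid_scheme \<Rightarrow> 'a set \<Rightarrow> 'a set" where
  "centralizer G P = {x \<in> carrier G. \<forall>u\<in>P. x \<otimes>\<^bsub>G\<^esub> u = u \<otimes>\<^bsub>G\<^esub> x}"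

section \<open>Fusion systems\<close>

text \<open>
  A category whose objects are the subgroups of a group is given by its morphism sets. A morphism
  with domain \<open>P\<close> is a function that is extensional on \<open>P\<close>, so that morphisms are equal as
  functions iff they agree on \<open>P\<close>. The values at arguments that are not subgroups of the
  underlying group play no role. A fusion system on a subgroup \<open>R\<close> of \<open>S\<close> is a fusion
  system on the group \<open>S\<lparr>carrier := R\<rparr>\<close>.
\<close>

type_synonym 'a homs = "'a set \<Rightarrow> 'a set \<Rightarrow> ('a \<Rightarrow> 'a) set"

definition conj_map :: "('a, 'b) monoid_scheme \<Rightarrow> 'a \<Rightarrow> 'a set \<Rightarrow> 'a \<Rightarrow> 'a" where
  "conj_map S x P = (\<lambda>u\<in>P. x \<otimes>\<^bsub>S\<^esub> u \<otimes>\<^bsub>S\<^esub> inv\<^bsub>S\<^esub> x)"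

definition fusion_system :: "('a, 'b) monoid_scheme \<Rightarrow> 'a homs \<Rightarrow> bool" where
  "fusion_system S F \<longleftrightarrow>
     (\<forall>P Q. subgroup P S \<longrightarrow> subgroup Q S \<longrightarrow>
        F P Q \<subseteq> {\<phi> \<in> hom (S\<lparr>carrier := P\<rparr>) (S\<lparr>carrier := Q\<rparr>). inj_on \<phi> P \<and> \<phi> \<in> extensional P}) \<and>
     (\<forall>P Q W. subgroup P S \<longrightarrow> subgroup Q S \<longrightarrow> subgroup W S \<longrightarrow>
        (\<forall>\<phi>\<in>F P Q. \<forall>\<psi>\<in>F Q W. compose P \<psi> \<phi> \<in> F P W)) \<and>
     (\<forall>P Q. subgroup P S \<longrightarrow> subgroup Q S \<longrightarrow>
        (\<forall>x\<in>carrier S. conj_map S x P ` P \<subseteq> Q \<longrightarrow> conj_map S x P \<in> F P Q)) \<and>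
     (\<forall>P Q. subgroup P S \<longrightarrow> subgroup Q S \<longrightarrow>
        (\<forall>\<phi>\<in>F P Q. \<phi> \<in> F P (\<phi> ` P) \<and> (\<lambda>y\<in>\<phi> ` P. inv_into P \<phi> y) \<in> F (\<phi> ` P) P))"

definition fusion_conj :: "('a, 'b) monoid_scheme \<Rightarrow> 'a homs \<Rightarrow> 'a set \<Rightarrow> 'a set \<Rightarrow> bool" where
  "fusion_conj S F P Q \<longleftrightarrow> subgroup P S \<and> subgroup Q S \<and>
     (\<exists>\<phi>\<in>F P Q. \<exists>\<psi>\<in>F Q P. compose P \<psi> \<phi> = (\<lambda>x\<in>P. x) \<and> compose Q \<phi> \<psi> = (\<lambda>x\<in>Q. x))"

definition fully_normalized :: "('a, 'b) monoid_scheme \<Rightarrow> 'a homs \<Rightarrow> 'a set \<Rightarrow> bool" where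
  "fully_normalized S F P \<longleftrightarrow>
     (\<forall>Q. fusion_conj S F P Q \<longrightarrow> card (normalizer S P) \<ge> card (normalizer S Q))"

definition fully_centralized :: "('a, 'b) monoid_scheme \<Rightarrow> 'a homs \<Rightarrow> 'a set \<Rightarrow> bool" where
  "fully_centralized S F P \<longleftrightarrow>
     (\<forall>Q. fusion_conj S F P Q \<longrightarrow> card (centralizer S P) \<ge> card (centralizer S Q))"

definition fusion_aut :: "'a homs \<Rightarrow> 'a set \<Rightarrow> ('a \<Rightarrow> 'a) monoid" where
  "fusion_aut F P = BijGroup P \<lparr>carrier := F P P\<rparr>"

definition inner_aut :: "('a, 'b) monoid_scheme \<Rightarrow> 'a set \<Rightarrow> ('a \<Rightarrow> 'a) set" where
  "inner_aut S P = (\<lambda>x. conj_map S x P) ` normalizer S P"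

definition extender :: "('a, 'b) monoid_scheme \<Rightarrow> 'a set \<Rightarrow> ('a \<Rightarrow> 'a) \<Rightarrow> 'a set" where
  "extender S P \<phi> = {x \<in> normalizer S P. \<exists>y\<in>carrier S. \<forall>u\<in>P.
     \<phi> (x \<otimes>\<^bsub>S\<^esub> u \<otimes>\<^bsub>S\<^esub> inv\<^bsub>S\<^esub> x) = y \<otimes>\<^bsub>S\<^esub> \<phi> u \<otimes>\<^bsub>S\<^esub> inv\<^bsub>S\<^esub> y}"

definition saturated_fusion_system :: "nat \<Rightarrow> ('a, 'b) monoid_scheme \<Rightarrow> 'a homs \<Rightarrow> bool" where
  "saturated_fusion_system p S F \<longleftrightarrow> fusion_system S F \<and>
     (\<forall>P. subgroup P S \<longrightarrow>
        (fully_normalized S F P \<longrightarrow>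
           fully_centralized S F P \<and> sylow_subgroup p (inner_aut S P) (fusion_aut F P)) \<and>
        (\<forall>\<phi>\<in>F P (carrier S). fully_centralized S F (\<phi> ` P) \<longrightarrow>
           (\<exists>\<psi>\<in>F (extender S P \<phi>) (carrier S). \<forall>u\<in>P. \<psi> u = \<phi> u)))"

definition fusion_subsystem ::
    "('a, 'b) monoid_scheme \<Rightarrow> 'a homs \<Rightarrow> 'a set \<Rightarrow> 'a homs \<Rightarrow> bool" where
  "fusion_subsystem S F R H \<longleftrightarrow> subgroup R S \<and> fusion_system (S\<lparr>carrier := R\<rparr>) H \<and>
     (\<forall>P Q. subgroup P (S\<lparr>carrier := R\<rparr>) \<longrightarrow> subgroup Q (S\<lparr>carrier := R\<rparr>) \<longrightarrow> H P Q \<subseteq> F P Q)"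

definition fusion_inter :: "'a homs \<Rightarrow> 'a homs \<Rightarrow> 'a homs" where
  "fusion_inter H K P Q = H P Q \<inter> K P Q"

text \<open>
  In the second clause, the intermediate object \<open>Q\<close> must be an object of both subsystems for
  the composite to make sense.
\<close>

definition composition_product ::
    "('a, 'b) monoid_scheme \<Rightarrow> 'a homs \<Rightarrow> 'a set \<Rightarrow> 'a homs \<Rightarrow> 'a set \<Rightarrow> 'a homs \<Rightarrow> bool" where
  "composition_product S F R H T K \<longleftrightarrow>
     carrier S = R <#>\<^bsub>S\<^esub> T \<and>
     (\<forall>P. subgroup P (S\<lparr>carrier := T\<rparr>) \<longrightarrow> (\<forall>\<phi>\<in>F P R.
        \<exists>Q. subgroup Q (S\<lparr>carrier := R \<inter> T\<rparr>) \<and> (\<exists>\<rho>\<in>K P Q. \<exists>\<psi>\<in>H Q R. \<phi> = compose P \<psi> \<rho>))) \<and>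
     (\<forall>Q. subgroup Q (S\<lparr>carrier := R \<inter> T\<rparr>) \<longrightarrow>
        rat_of_nat (card (F Q (carrier S))) =
          rat_of_nat (card (H Q R)) * rat_of_nat (card (K Q T)) /
          rat_of_nat (card (fusion_inter H K Q (R \<inter> T))))"

section \<open>Bisets\<close>

text \<open>
  A \<open>(G, H)\<close>-biset is represented as a finite left \<open>(H \<times> G)\<close>-set, where \<open>(h, g)\<close> acts as
  \<open>x \<mapsto> h x g\<inverse>\<close>. Thus \<open>h x = action X (h, \<one>) x\<close> and \<open>x g\<inverse> = action X (\<one>, g) x\<close>.
\<close>

record ('h, 'g, 'x) biset =
  points :: "'x set"
  action :: "'h \<times> 'g \<Rightarrow> 'x \<Rightarrow> 'x"

definition biset ::
    "('g, 'm) monoid_scheme \<Rightarrow> ('h, 'n) monoid_scheme \<Rightarrow> ('h, 'g, 'x) biset \<Rightarrow> bool" where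
  "biset G H X \<longleftrightarrow> finite (points X) \<and> group_action (H \<times>\<times> G) (points X) (action X)"

definition biset_iso ::
    "('g, 'm) monoid_scheme \<Rightarrow> ('h, 'n) monoid_scheme \<Rightarrow>
     ('h, 'g, 'x) biset \<Rightarrow> ('h, 'g, 'y) biset \<Rightarrow> bool" where
  "biset_iso G H X Y \<longleftrightarrow> (\<exists>f. bij_betw f (points X) (points Y) \<and>
     (\<forall>a\<in>carrier (H \<times>\<times> G). \<forall>x\<in>points X. f (action X a x) = action Y a (f x)))"

definition biset_union ::
    "('h, 'g, 'x) biset \<Rightarrow> ('h, 'g, 'y) biset \<Rightarrow> ('h, 'g, 'x + 'y) biset" where
  "biset_union X Y = \<lparr>points = points X <+> points Y,
     action = (\<lambda>a. \<lambda>z\<in>points X <+> points Y. map_sum (action X a) (action Y a) z)\<rparr>"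

text \<open>
  For an \<open>(H, K)\<close>-biset \<open>Y\<close> and a \<open>(G, H)\<close>-biset \<open>X\<close>, the points of \<open>Y \<times>\<^sub>H X\<close> are the orbits
  of \<open>H\<close> on \<open>Y \<times> X\<close> under \<open>(y, x) \<mapsto> (y h\<inverse>, h x)\<close>, i.e. the classes for
  \<open>(y h, x) \<sim> (y, h x)\<close>.
\<close>

definition tensor_points ::
    "('g, 'm) monoid_scheme \<Rightarrow> ('h, 'n) monoid_scheme \<Rightarrow> ('k, 'o) monoid_scheme \<Rightarrow>
     ('k, 'h, 'y) biset \<Rightarrow> ('h, 'g, 'x) biset \<Rightarrow> ('y \<times> 'x) set set" where
  "tensor_points G H K Y X = orbits H (points Y \<times> points X)
     (\<lambda>h (y, x). (action Y (\<one>\<^bsub>K\<^esub>, h) y, action X (h, \<one>\<^bsub>G\<^esub>) x))"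

definition biset_tensor ::
    "('g, 'm) monoid_scheme \<Rightarrow> ('h, 'n) monoid_scheme \<Rightarrow> ('k, 'o) monoid_scheme \<Rightarrow>
     ('k, 'h, 'y) biset \<Rightarrow> ('h, 'g, 'x) biset \<Rightarrow> ('k, 'g, ('y \<times> 'x) set) biset" where
  "biset_tensor G H K Y X = \<lparr>points = tensor_points G H K Y X,
     action = (\<lambda>(k, g). \<lambda>C\<in>tensor_points G H K Y X.
       (\<lambda>(y, x). (action Y (k, \<one>\<^bsub>H\<^esub>) y, action X (\<one>\<^bsub>H\<^esub>, g) x)) ` C)\<rparr>"

definition twisted_diagonal :: "'g set \<Rightarrow> ('g \<Rightarrow> 'h) \<Rightarrow> ('h \<times> 'g) set" where
  "twisted_diagonal U \<phi> = {(\<phi> u, u) | u. u \<in> U}"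

definition coset_biset ::
    "('g, 'm) monoid_scheme \<Rightarrow> ('h, 'n) monoid_scheme \<Rightarrow> 'g set \<Rightarrow> ('g \<Rightarrow> 'h) \<Rightarrow>
     ('h, 'g, ('h \<times> 'g) set) biset" where
  "coset_biset G H U \<phi> = \<lparr>points = lcosets\<^bsub>H \<times>\<times> G\<^esub> (twisted_diagonal U \<phi>),
     action = (\<lambda>a. \<lambda>C\<in>lcosets\<^bsub>H \<times>\<times> G\<^esub> (twisted_diagonal U \<phi>). a <#\<^bsub>H \<times>\<times> G\<^esub> C)\<rparr>"

definition left_free ::
    "('g, 'm) monoid_scheme \<Rightarrow> ('h, 'n) monoid_scheme \<Rightarrow> ('h, 'g, 'x) biset \<Rightarrow> bool" where
  "left_free G H X \<longleftrightarrow>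
     (\<forall>h\<in>carrier H. \<forall>x\<in>points X. action X (h, \<one>\<^bsub>G\<^esub>) x = x \<longrightarrow> h = \<one>\<^bsub>H\<^esub>)"

text \<open>
  Every finite biset has an isomorphic copy whose points are natural numbers; this makes it
  possible to collect representatives of all isomorphism classes in a single type.
\<close>

type_synonym ('h, 'g) nbiset = "('h, 'g, nat) biset"

definition nat_copy :: "('h, 'g, 'x) biset \<Rightarrow> ('h, 'g) nbiset" where
  "nat_copy X = (let f = to_nat_on (points X); N = f ` points X in
     \<lparr>points = N, action = (\<lambda>a. \<lambda>n\<in>N. f (action X a (from_nat_into (points X) n)))\<rparr>)"

section \<open>The p-localized Grothendieck group of bisets\<close>

definition Z_loc :: "nat \<Rightarrow> rat set" where
  "Z_loc p = {of_int a / of_int b | a b. \<not> int p dvd b}"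

text \<open>
  The Grothendieck group \<open>A(G, H)\<close> of the isomorphism classes of \<open>(G, H)\<close>-bisets is generated
  by symbols \<open>[X]\<close> subject to \<open>[X] = [Y]\<close> for isomorphic \<open>X\<close> and \<open>Y\<close> and
  \<open>[X \<squnion> Y] = [X] + [Y]\<close>. Hence \<open>A(G, H)\<^sub>(\<^sub>p\<^sub>)\<close>, its tensor product with \<open>\<int>\<^sub>(\<^sub>p\<^sub>)\<close>, is the
  \<open>\<int>\<^sub>(\<^sub>p\<^sub>)\<close>-module given by the same generators and relations. The free \<open>\<int>\<^sub>(\<^sub>p\<^sub>)\<close>-module on
  the symbols consists of the finitely supported functions below, and \<open>biset_rels\<close> is its
  submodule spanned by the relations.
\<close>

type_synonym ('h, 'g) biset_comb = "('h, 'g) nbiset \<Rightarrow>\<^sub>0 rat"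

definition biset_combs ::
    "nat \<Rightarrow> ('g, 'm) monoid_scheme \<Rightarrow> ('h, 'n) monoid_scheme \<Rightarrow> ('h, 'g) biset_comb set" where
  "biset_combs p G H =
     {x. (\<forall>B\<in>Poly_Mapping.keys x. biset G H B) \<and> (\<forall>B. Poly_Mapping.lookup x B \<in> Z_loc p)}"

inductive_set biset_rels ::
    "nat \<Rightarrow> ('g, 'm) monoid_scheme \<Rightarrow> ('h, 'n) monoid_scheme \<Rightarrow> ('h, 'g) biset_comb set"
  for p G H where
  zero: "0 \<in> biset_rels p G H"
| iso: "\<lbrakk>biset G H X; biset G H Y; biset_iso G H X Y; c \<in> Z_loc p; r \<in> biset_rels p G H\<rbrakk> \<Longrightarrow>
    Poly_Mapping.single X c - Poly_Mapping.single Y c + r \<in> biset_rels p G H"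
| union: "\<lbrakk>biset G H X; biset G H Y; c \<in> Z_loc p; r \<in> biset_rels p G H\<rbrakk> \<Longrightarrow>
    Poly_Mapping.single (nat_copy (biset_union X Y)) c
      - Poly_Mapping.single X c - Poly_Mapping.single Y c + r \<in> biset_rels p G H"

definition biset_cong ::
    "nat \<Rightarrow> ('g, 'm) monoid_scheme \<Rightarrow> ('h, 'n) monoid_scheme \<Rightarrow>
     (('h, 'g) biset_comb \<times> ('h, 'g) biset_comb) set" where
  "biset_cong p G H =
     {(x, y). x \<in> biset_combs p G H \<and> y \<in> biset_combs p G H \<and> x - y \<in> biset_rels p G H}"

definition biset_module ::
    "nat \<Rightarrow> ('g, 'm) monoid_scheme \<Rightarrow> ('h, 'n) monoid_scheme \<Rightarrow> ('h, 'g) biset_comb set set" where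
  "biset_module p G H = biset_combs p G H // biset_cong p G H"

definition biset_class ::
    "nat \<Rightarrow> ('g, 'm) monoid_scheme \<Rightarrow> ('h, 'n) monoid_scheme \<Rightarrow> ('h, 'g, 'x) biset \<Rightarrow>
     ('h, 'g) biset_comb set" where
  "biset_class p G H X = biset_cong p G H `` {Poly_Mapping.single (nat_copy X) 1}"

abbreviation transitive_class ::
    "nat \<Rightarrow> ('g, 'm) monoid_scheme \<Rightarrow> ('h, 'n) monoid_scheme \<Rightarrow> 'g set \<Rightarrow> ('g \<Rightarrow> 'h) \<Rightarrow>
     ('h, 'g) biset_comb set" where
  "transitive_class p G H U \<phi> \<equiv> biset_class p G H (coset_biset G H U \<phi>)"

definition comb_comp ::
    "('g, 'm) monoid_scheme \<Rightarrow> ('h, 'n) monoid_scheme \<Rightarrow> ('k, 'o) monoid_scheme \<Rightarrow>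
     ('k, 'h) biset_comb \<Rightarrow> ('h, 'g) biset_comb \<Rightarrow> ('k, 'g) biset_comb" where
  "comb_comp G H K y x = (\<Sum>B\<in>Poly_Mapping.keys y. \<Sum>C\<in>Poly_Mapping.keys x.
     Poly_Mapping.single (nat_copy (biset_tensor G H K B C))
       (Poly_Mapping.lookup y B * Poly_Mapping.lookup x C))"

definition biset_comp ::
    "nat \<Rightarrow> ('g, 'm) monoid_scheme \<Rightarrow> ('h, 'n) monoid_scheme \<Rightarrow> ('k, 'o) monoid_scheme \<Rightarrow>
     ('k, 'h) biset_comb set \<Rightarrow> ('h, 'g) biset_comb set \<Rightarrow> ('k, 'g) biset_comb set" where
  "biset_comp p G H K Y X = (\<Union>y\<in>Y. \<Union>x\<in>X. biset_cong p G K `` {comb_comp G H K y x})"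

section \<open>Characteristic idempotents\<close>

text \<open>
  An element of \<open>A(S, S)\<^sub>(\<^sub>p\<^sub>)\<close> is a \<open>\<int>\<^sub>(\<^sub>p\<^sub>)\<close>-linear combination of the classes of certain bisets
  iff it has a representative that is supported on (copies of) these bisets. This is used for
  \<open>fusion_generated\<close> and for the span of the left-free bisets in \<open>augmentation\<close>.
\<close>

definition fusion_generated ::
    "('a, 'b) monoid_scheme \<Rightarrow> 'a homs \<Rightarrow> ('a, 'a) biset_comb set \<Rightarrow> bool" where
  "fusion_generated S F X \<longleftrightarrow> (\<exists>x\<in>X. Poly_Mapping.keys x \<subseteq>
     {nat_copy (coset_biset S S P \<phi>) | P \<phi>. subgroup P S \<and> \<phi> \<in> F P (carrier S)})"

definition right_stable ::
    "nat \<Rightarrow> ('a, 'b) monoid_scheme \<Rightarrow> 'a homs \<Rightarrow> ('a, 'a) biset_comb set \<Rightarrow> bool" where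
  "right_stable p S F X \<longleftrightarrow> (\<forall>P. subgroup P S \<longrightarrow> (\<forall>\<phi>\<in>F P (carrier S).
     biset_comp p (S\<lparr>carrier := P\<rparr>) S S X (transitive_class p (S\<lparr>carrier := P\<rparr>) S P \<phi>) =
     biset_comp p (S\<lparr>carrier := P\<rparr>) S S X (transitive_class p (S\<lparr>carrier := P\<rparr>) S P id)))"

definition left_stable ::
    "nat \<Rightarrow> ('a, 'b) monoid_scheme \<Rightarrow> 'a homs \<Rightarrow> ('a, 'a) biset_comb set \<Rightarrow> bool" where
  "left_stable p S F X \<longleftrightarrow> (\<forall>P. subgroup P S \<longrightarrow> (\<forall>\<phi>\<in>F P (carrier S).
     biset_comp p S S (S\<lparr>carrier := P\<rparr>)
       (transitive_class p S (S\<lparr>carrier := P\<rparr>) (\<phi> ` P) (inv_into P \<phi>)) X =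
     biset_comp p S S (S\<lparr>carrier := P\<rparr>)
       (transitive_class p S (S\<lparr>carrier := P\<rparr>) P id) X))"

definition comb_augmentation :: "('a, 'b) monoid_scheme \<Rightarrow> ('a, 'a) biset_comb \<Rightarrow> rat" where
  "comb_augmentation S x = (\<Sum>B\<in>Poly_Mapping.keys x.
     Poly_Mapping.lookup x B * (of_nat (card (points B)) / of_nat (order S)))"

definition augmentation :: "('a, 'b) monoid_scheme \<Rightarrow> ('a, 'a) biset_comb set \<Rightarrow> rat" where
  "augmentation S X =
     the_elem (comb_augmentation S ` {x\<in>X. \<forall>B\<in>Poly_Mapping.keys x. left_free S S B})"

definition fusion_characteristic ::
    "nat \<Rightarrow> ('a, 'b) monoid_scheme \<Rightarrow> 'a homs \<Rightarrow> ('a, 'a) biset_comb set \<Rightarrow> bool" where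
  "fusion_characteristic p S F X \<longleftrightarrow> X \<in> biset_module p S S \<and>
     fusion_generated S F X \<and> right_stable p S F X \<and> left_stable p S F X \<and>
     augmentation S X \<in> Z_loc p \<and> (\<exists>v\<in>Z_loc p. augmentation S X * v = 1)"

definition characteristic_idempotent ::
    "nat \<Rightarrow> ('a, 'b) monoid_scheme \<Rightarrow> 'a homs \<Rightarrow> ('a, 'a) biset_comb set \<Rightarrow> bool" where
  "characteristic_idempotent p S F \<omega> \<longleftrightarrow>
     fusion_characteristic p S F \<omega> \<and> biset_comp p S S S \<omega> \<omega> = \<omega>"

section \<open>Basic facts: bisets, and well-definedness of the composition\<close>

text \<open>
  The definitions on classes do not depend on the chosen representatives
  (\<open>biset_comp_rep\<close>, \<open>augmentation_rep\<close>), and the composition is induced by the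
  tensor product of bisets (\<open>biset_comp_biset_class\<close>).
\<close>

lemma group_action_iff:
  assumes "group G"
  shows "group_action G E \<phi> \<longleftrightarrow>
    (\<forall>a\<in>carrier G. \<phi> a \<in> extensional E \<and> (\<forall>x\<in>E. \<phi> a x \<in> E)) \<and>
    (\<forall>x\<in>E. \<phi> \<one>\<^bsub>G\<^esub> x = x) \<and>
    (\<forall>a\<in>carrier G. \<forall>b\<in>carrier G. \<forall>x\<in>E. \<phi> (a \<otimes>\<^bsub>G\<^esub> b) x = \<phi> a (\<phi> b x))" (is "?L \<longleftrightarrow> ?R")
proof
  interpret G: group G by fact
  assume ?L
  then interpret A: group_action G E \<phi> .
  have "\<phi> a \<in> extensional E" if "a \<in> carrier G" for a
    using A.bij_prop0[OF that] A.group_hom that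
    unfolding group_hom_def group_hom_axioms_def hom_def BijGroup_def Bij_def by auto
  then show ?R
    using A.id_eq_one A.composition_rule A.element_image
    by (metis restrict_apply')
next
  interpret G: group G by fact
  assume R: ?R
  have bij: "\<phi> a \<in> Bij E" if a: "a \<in> carrier G" for a
  proof -
    have "bij_betw (\<phi> a) E E"
      by (rule bij_betw_byWitness[where f' = "\<phi> (inv\<^bsub>G\<^esub> a)"])
         (use R a in \<open>auto simp: G.inv_closed simp flip: R[THEN conjunct2, THEN conjunct2, rule_format]\<close>)
    then show ?thesis using R a by (simp add: Bij_def)
  qed
  have "\<phi> (a \<otimes>\<^bsub>G\<^esub> b) = compose E (\<phi> a) (\<phi> b)" if "a \<in> carrier G" "b \<in> carrier G" for a b
    by (rule extensionalityI[of _ E]) (use R that in \<open>auto simp: compose_def\<close>)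
  then have "\<phi> \<in> hom G (BijGroup E)"
    using bij by (auto simp: hom_def BijGroup_def)
  then show ?L
    by (simp add: group_action_def group_hom_def group_hom_axioms_def group_BijGroup assms)
qed


lemma biset_iff:
  assumes "group G" "group H"
  shows "biset G H X \<longleftrightarrow> finite (points X) \<and>
    (\<forall>h\<in>carrier H. \<forall>g\<in>carrier G.
       action X (h, g) \<in> extensional (points X) \<and> (\<forall>x\<in>points X. action X (h, g) x \<in> points X)) \<and>
    (\<forall>x\<in>points X. action X (\<one>\<^bsub>H\<^esub>, \<one>\<^bsub>G\<^esub>) x = x) \<and>
    (\<forall>h\<in>carrier H. \<forall>g\<in>carrier G. \<forall>h'\<in>carrier H. \<forall>g'\<in>carrier G. \<forall>x\<in>points X.
       action X (h, g) (action X (h', g') x) = action X (h \<otimes>\<^bsub>H\<^esub> h', g \<otimes>\<^bsub>G\<^esub> g') x)"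
  unfolding biset_def group_action_iff[OF DirProd_group[OF assms(2,1)]] by fastforce

lemma coset_biset_biset:
  assumes "group G" "group H" "finite (carrier G)" "finite (carrier H)" "subgroup U G"
    "\<phi> \<in> hom (G\<lparr>carrier := U\<rparr>) H"
  shows "biset G H (coset_biset G H U \<phi>)"
proof -
  interpret G: group G by fact
  interpret H: group H by fact
  interpret P: group "H \<times>\<times> G" by (rule DirProd_group[OF assms(2,1)])
  have D: "twisted_diagonal U \<phi> \<subseteq> carrier (H \<times>\<times> G)"
    using assms(6) subgroup.subset[OF assms(5)] by (auto simp: twisted_diagonal_def hom_def)
  let ?D = "twisted_diagonal U \<phi>"
  have c: "a <#\<^bsub>H \<times>\<times> G\<^esub> C \<in> lcosets\<^bsub>H \<times>\<times> G\<^esub> ?D"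
    if a: "a \<in> carrier (H \<times>\<times> G)" and C: "C \<in> lcosets\<^bsub>H \<times>\<times> G\<^esub> ?D" for a C
  proof -
    obtain b where b: "b \<in> carrier (H \<times>\<times> G)" "C = b <#\<^bsub>H \<times>\<times> G\<^esub> ?D"
      using C unfolding LCOSETS_def by blast
    have "a <#\<^bsub>H \<times>\<times> G\<^esub> C = (a \<otimes>\<^bsub>H \<times>\<times> G\<^esub> b) <#\<^bsub>H \<times>\<times> G\<^esub> ?D"
      unfolding b(2) by (rule P.lcos_m_assoc[OF D a b(1)])
    then show ?thesis using P.m_closed[OF a b(1)] unfolding LCOSETS_def by blast
  qed
  have s: "C \<subseteq> carrier (H \<times>\<times> G)" if "C \<in> lcosets\<^bsub>H \<times>\<times> G\<^esub> ?D" for C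
    using that P.l_coset_subset_G[OF D] unfolding LCOSETS_def by blast
  have "finite (lcosets\<^bsub>H \<times>\<times> G\<^esub> ?D)"
    using assms(3,4) by (simp add: LCOSETS_def)
  then show ?thesis unfolding biset_def group_action_iff[OF P.is_group] coset_biset_def
    using c s P.lcos_mult_one P.lcos_m_assoc
    by (simp del: mult_DirProd one_DirProd carrier_DirProd)
qed

lemma biset_transport:
  assumes "group G" "group H" "biset G H X" "inj_on f (points X)"
    and "points Y = f ` points X"
    and "\<And>a. a \<in> carrier (H \<times>\<times> G) \<Longrightarrow> action Y a \<in> extensional (points Y)"
    and "\<And>a x. a \<in> carrier (H \<times>\<times> G) \<Longrightarrow> x \<in> points X \<Longrightarrow> action Y a (f x) = f (action X a x)"
  shows "biset G H Y" "biset_iso G H X Y" "biset_iso G H Y X"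
proof -
  note X = assms(3)[unfolded biset_iff[OF assms(1,2)]]
  show "biset G H Y" unfolding biset_iff[OF assms(1,2)]
    using X assms(5-7) group.is_monoid[OF assms(1)] group.is_monoid[OF assms(2)] by (auto simp: monoid.m_closed)
  show "biset_iso G H X Y" unfolding biset_iso_def
    using assms(4,5,7) by (intro exI[of _ f]) (auto simp: bij_betw_def)
  show "biset_iso G H Y X" unfolding biset_iso_def
    using assms(4,5,7) X by (intro exI[of _ "inv_into (points X) f"])
     (auto simp: bij_betw_def inj_on_inv_into)
qed

lemma nat_copy:
  assumes "group G" "group H" "biset G H X"
  shows "biset G H (nat_copy X)" "biset_iso G H X (nat_copy X)" "biset_iso G H (nat_copy X) X"
proof -
  have "finite (points X)" using assms(3) by (simp add: biset_def)
  then have *: "countable (points X)" by (rule countable_finite)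
  show "biset G H (nat_copy X)" "biset_iso G H X (nat_copy X)" "biset_iso G H (nat_copy X) X"
    by (rule biset_transport[OF assms, where f = "to_nat_on (points X)"];
        use * in \<open>auto simp: nat_copy_def Let_def\<close>)+
qed

lemma biset_iso_trans:
  assumes "group G" "group H" "biset G H X" "biset_iso G H X Y" "biset_iso G H Y Z"
  shows "biset_iso G H X Z"
proof -
  obtain f where f: "bij_betw f (points X) (points Y)"
    "\<And>a x. a \<in> carrier (H \<times>\<times> G) \<Longrightarrow> x \<in> points X \<Longrightarrow> f (action X a x) = action Y a (f x)"
    using assms(4) unfolding biset_iso_def by blast
  obtain g where g: "bij_betw g (points Y) (points Z)"
    "\<And>a x. a \<in> carrier (H \<times>\<times> G) \<Longrightarrow> x \<in> points Y \<Longrightarrow> g (action Y a x) = action Z a (g x)"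
    using assms(5) unfolding biset_iso_def by blast
  show ?thesis unfolding biset_iso_def
    using bij_betw_trans[OF f(1) g(1)] f g
    by (intro exI[of _ "g \<circ> f"]) (auto simp: bij_betwE)
qed

lemma biset_iso_sym:
  assumes "group G" "group H" "biset G H X" "biset_iso G H X Y"
  shows "biset_iso G H Y X"
proof -
  obtain f where f: "bij_betw f (points X) (points Y)"
    "\<And>a x. a \<in> carrier (H \<times>\<times> G) \<Longrightarrow> x \<in> points X \<Longrightarrow> f (action X a x) = action Y a (f x)"
    using assms(4) unfolding biset_iso_def by blast
  have cl: "action X a x \<in> points X" if "a \<in> carrier (H \<times>\<times> G)" "x \<in> points X" for a x
    using assms(3) that unfolding biset_iff[OF assms(1,2)] by auto
  show ?thesis unfolding biset_iso_def
  proof (intro exI[of _ "inv_into (points X) f"] conjI ballI)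
    fix a y assume a: "a \<in> carrier (H \<times>\<times> G)" and "y \<in> points Y"
    then obtain x where x: "x \<in> points X" "y = f x" using f(1) by (auto simp: bij_betw_def)
    have inj: "inj_on f (points X)" using f(1) by (simp add: bij_betw_def)
    show "inv_into (points X) f (action Y a y) = action X a (inv_into (points X) f y)"
      using x inj f(2)[OF a x(1)] cl[OF a x(1)] by (metis inv_into_f_f)
  qed (rule bij_betw_inv_into[OF f(1)])
qed

lemma biset_union:
  assumes "group G" "group H" "biset G H X" "biset G H Y"
  shows "biset G H (biset_union X Y)"
  using assms(3,4) group.is_monoid[OF assms(1)] group.is_monoid[OF assms(2)]
  unfolding biset_iff[OF assms(1,2)] 
  by (auto simp: biset_union_def)

lemma biset_union_iso:
  assumes "biset_iso G H X X'" "biset_iso G H Y Y'"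
  shows "biset_iso G H (biset_union X Y) (biset_union X' Y')"
proof -
  obtain f where f: "bij_betw f (points X) (points X')"
    "\<And>a x. a \<in> carrier (H \<times>\<times> G) \<Longrightarrow> x \<in> points X \<Longrightarrow> f (action X a x) = action X' a (f x)"
    using assms(1) unfolding biset_iso_def by blast
  obtain g where g: "bij_betw g (points Y) (points Y')"
    "\<And>a x. a \<in> carrier (H \<times>\<times> G) \<Longrightarrow> x \<in> points Y \<Longrightarrow> g (action Y a x) = action Y' a (g x)"
    using assms(2) unfolding biset_iso_def by blast
  have "bij_betw (map_sum f g) (points X <+> points Y) (points X' <+> points Y')"
    unfolding bij_betw_def
  proof
    show "inj_on (map_sum f g) (points X <+> points Y)"
    proof (rule inj_onI)
      fix u v assume uv: "u \<in> points X <+> points Y" "v \<in> points X <+> points Y"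
        "map_sum f g u = map_sum f g v"
      then show "u = v"
        using inj_onD[OF bij_betw_imp_inj_on[OF f(1)]] inj_onD[OF bij_betw_imp_inj_on[OF g(1)]]
        by (cases u; cases v) (simp_all add: Plus_def image_iff)
    qed
    show "map_sum f g ` (points X <+> points Y) = points X' <+> points Y'"
      unfolding bij_betw_imp_surj_on[OF f(1), symmetric] bij_betw_imp_surj_on[OF g(1), symmetric]
      by (simp add: Plus_def image_Un image_image)
  qed
  then show ?thesis unfolding biset_iso_def
    using f g by (intro exI[of _ "map_sum f g"]) (auto simp: biset_union_def bij_betwE)
qed

locale biset_pair =
  G: group G + H: group H + K: group K
  for G :: "('g, 'm) monoid_scheme" and H :: "('h, 'n) monoid_scheme" and K :: "('k, 'o) monoid_scheme" +
  fixes Y :: "('k, 'h, 'y) biset" and X :: "('h, 'g, 'x) biset"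
  assumes Y: "biset H K Y" and X: "biset G H X"
begin

definition ob :: "'y \<Rightarrow> 'x \<Rightarrow> ('y \<times> 'x) set" where
  "ob y x = {(action Y (\<one>\<^bsub>K\<^esub>, h) y, action X (h, \<one>\<^bsub>G\<^esub>) x) | h. h \<in> carrier H}"

lemma ob_image: "ob y x = (\<lambda>h. (action Y (\<one>\<^bsub>K\<^esub>, h) y, action X (h, \<one>\<^bsub>G\<^esub>) x)) ` carrier H"
  by (auto simp: ob_def)

lemma Xcl: "h \<in> carrier H \<Longrightarrow> g \<in> carrier G \<Longrightarrow> x \<in> points X \<Longrightarrow> action X (h, g) x \<in> points X"
  and Xone: "x \<in> points X \<Longrightarrow> action X (\<one>\<^bsub>H\<^esub>, \<one>\<^bsub>G\<^esub>) x = x"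
  and Xmul: "h \<in> carrier H \<Longrightarrow> g \<in> carrier G \<Longrightarrow> h' \<in> carrier H \<Longrightarrow> g' \<in> carrier G \<Longrightarrow> x \<in> points X \<Longrightarrow>
       action X (h, g) (action X (h', g') x) = action X (h \<otimes>\<^bsub>H\<^esub> h', g \<otimes>\<^bsub>G\<^esub> g') x"
  and Xfin: "finite (points X)"
  using X unfolding biset_iff[OF G.is_group H.is_group] by blast+

lemma Ycl: "h \<in> carrier K \<Longrightarrow> g \<in> carrier H \<Longrightarrow> x \<in> points Y \<Longrightarrow> action Y (h, g) x \<in> points Y"
  and Yone: "x \<in> points Y \<Longrightarrow> action Y (\<one>\<^bsub>K\<^esub>, \<one>\<^bsub>H\<^esub>) x = x"
  and Ymul: "h \<in> carrier K \<Longrightarrow> g \<in> carrier H \<Longrightarrow> h' \<in> carrier K \<Longrightarrow> g' \<in> carrier H \<Longrightarrow> x \<in> points Y \<Longrightarrow>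
       action Y (h, g) (action Y (h', g') x) = action Y (h \<otimes>\<^bsub>K\<^esub> h', g \<otimes>\<^bsub>H\<^esub> g') x"
  and Yfin: "finite (points Y)"
  using Y unfolding biset_iff[OF H.is_group K.is_group] by blast+

lemma ob_self: "y \<in> points Y \<Longrightarrow> x \<in> points X \<Longrightarrow> (y, x) \<in> ob y x"
  unfolding ob_def using Xone Yone by (force intro!: exI[of _ "\<one>\<^bsub>H\<^esub>"])

lemma ob_sub: "y \<in> points Y \<Longrightarrow> x \<in> points X \<Longrightarrow> ob y x \<subseteq> points Y \<times> points X"
  unfolding ob_def using Xcl Ycl by auto

lemma ob_cong:
  assumes "y \<in> points Y" "x \<in> points X" "(y', x') \<in> ob y x"
  shows "ob y' x' = ob y x"
proof -
  obtain h where h: "h \<in> carrier H" "y' = action Y (\<one>\<^bsub>K\<^esub>, h) y" "x' = action X (h, \<one>\<^bsub>G\<^esub>) x"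
    using assms(3) by (auto simp: ob_def)
  have "ob y' x' = (\<lambda>k. (action Y (\<one>\<^bsub>K\<^esub>, k \<otimes>\<^bsub>H\<^esub> h) y, action X (k \<otimes>\<^bsub>H\<^esub> h, \<one>\<^bsub>G\<^esub>) x)) ` carrier H"
    unfolding ob_image by (rule image_cong) (use h assms(1,2) in \<open>auto simp: Xmul Ymul\<close>)
  also have "\<dots> = (\<lambda>k. (action Y (\<one>\<^bsub>K\<^esub>, k) y, action X (k, \<one>\<^bsub>G\<^esub>) x)) ` (\<lambda>k. k \<otimes>\<^bsub>H\<^esub> h) ` carrier H"
    by (simp only: image_image)
  also have "(\<lambda>k. k \<otimes>\<^bsub>H\<^esub> h) ` carrier H = carrier H"
    using H.surj_const_mult[of "inv\<^bsub>H\<^esub> h"] h(1) H.coset_join2[OF h(1) H.subgroup_self h(1)]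
    by (auto simp: r_coset_def)
  finally show ?thesis by (simp only: ob_image)
qed

lemma ob_eq_iff:
  assumes "y \<in> points Y" "x \<in> points X" "y' \<in> points Y" "x' \<in> points X"
  shows "ob y' x' = ob y x \<longleftrightarrow> (\<exists>h\<in>carrier H. y' = action Y (\<one>\<^bsub>K\<^esub>, h) y \<and> x' = action X (h, \<one>\<^bsub>G\<^esub>) x)"
proof -
  have "ob y' x' = ob y x \<longleftrightarrow> (y', x') \<in> ob y x"
    using ob_cong[OF assms(1,2)] ob_self[OF assms(3,4)] by metis
  then show ?thesis by (auto simp: ob_image image_iff)
qed

lemma tensor_points: "tensor_points G H K Y X = {ob y x | y x. y \<in> points Y \<and> x \<in> points X}"
  by (auto simp: tensor_points_def orbits_def orbit_def ob_def)

lemma tensor_image: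
  assumes "k \<in> carrier K" "g \<in> carrier G" "y \<in> points Y" "x \<in> points X"
  shows "(\<lambda>(y, x). (action Y (k, \<one>\<^bsub>H\<^esub>) y, action X (\<one>\<^bsub>H\<^esub>, g) x)) ` ob y x =
    ob (action Y (k, \<one>\<^bsub>H\<^esub>) y) (action X (\<one>\<^bsub>H\<^esub>, g) x)"
proof -
  have "ob (action Y (k, \<one>\<^bsub>H\<^esub>) y) (action X (\<one>\<^bsub>H\<^esub>, g) x) = (\<lambda>h. (action Y (k, h) y, action X (h, g) x)) ` carrier H"
    unfolding ob_image by (rule image_cong) (use assms in \<open>auto simp: Xmul Ymul\<close>)
  moreover have "(\<lambda>(y, x). (action Y (k, \<one>\<^bsub>H\<^esub>) y, action X (\<one>\<^bsub>H\<^esub>, g) x)) ` ob y x =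
    (\<lambda>h. (action Y (k, h) y, action X (h, g) x)) ` carrier H"
    unfolding ob_image image_image by (rule image_cong) (use assms in \<open>auto simp: Xmul Ymul\<close>)
  ultimately show ?thesis by simp
qed

lemma tensor_action:
  assumes "k \<in> carrier K" "g \<in> carrier G" "y \<in> points Y" "x \<in> points X"
  shows "action (biset_tensor G H K Y X) (k, g) (ob y x) = ob (action Y (k, \<one>\<^bsub>H\<^esub>) y) (action X (\<one>\<^bsub>H\<^esub>, g) x)"
  using assms tensor_image[OF assms] by (auto simp: biset_tensor_def tensor_points)

lemma points_tensor: "points (biset_tensor G H K Y X) = {ob y x | y x. y \<in> points Y \<and> x \<in> points X}"
  by (simp add: biset_tensor_def tensor_points)

lemma biset_tensor: "biset G K (biset_tensor G H K Y X)"
proof -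
  have "{ob y x | y x. y \<in> points Y \<and> x \<in> points X} = (\<lambda>(y, x). ob y x) ` (points Y \<times> points X)" by auto
  then have "finite (points (biset_tensor G H K Y X))"
    using Xfin Yfin by (simp add: points_tensor)
  moreover have "action (biset_tensor G H K Y X) (k, g) \<in> extensional (points (biset_tensor G H K Y X))" for k g
    by (simp add: biset_tensor_def)
  ultimately show ?thesis
    unfolding biset_iff[OF G.is_group K.is_group]
  proof (intro conjI ballI)
    fix k g C assume kg: "k \<in> carrier K" "g \<in> carrier G" and "C \<in> points (biset_tensor G H K Y X)"
    then obtain y x where yx: "y \<in> points Y" "x \<in> points X" "C = ob y x"
      unfolding points_tensor by blast
    show "action (biset_tensor G H K Y X) (k, g) C \<in> points (biset_tensor G H K Y X)"
      unfolding yx(3) tensor_action[OF kg yx(1,2)] points_tensor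
      using Ycl[OF kg(1) H.one_closed yx(1)] Xcl[OF H.one_closed kg(2) yx(2)] by blast
    fix k' g' assume kg': "k' \<in> carrier K" "g' \<in> carrier G"
    show "action (biset_tensor G H K Y X) (k', g') (action (biset_tensor G H K Y X) (k, g) C) =
        action (biset_tensor G H K Y X) (k' \<otimes>\<^bsub>K\<^esub> k, g' \<otimes>\<^bsub>G\<^esub> g) C"
      using kg kg' yx by (simp add: tensor_action Xcl Ycl Xmul Ymul)
  next
    fix C assume "C \<in> points (biset_tensor G H K Y X)"
    then show "action (biset_tensor G H K Y X) (\<one>\<^bsub>K\<^esub>, \<one>\<^bsub>G\<^esub>) C = C"
      by (auto simp: points_tensor tensor_action Xone Yone)
  qed simp_all
qed

text \<open>A criterion for an isomorphism out of the tensor product.\<close>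

lemma tensor_isoI:
  assumes F: "\<And>y x. y \<in> points Y \<Longrightarrow> x \<in> points X \<Longrightarrow> F (ob y x) = f y x"
    and im: "points Z = {f y x | y x. y \<in> points Y \<and> x \<in> points X}"
    and eq: "\<And>y x y' x'. \<lbrakk>y \<in> points Y; x \<in> points X; y' \<in> points Y; x' \<in> points X; f y' x' = f y x\<rbrakk> \<Longrightarrow> 
      \<exists>h\<in>carrier H. y' = action Y (\<one>\<^bsub>K\<^esub>, h) y \<and> x' = action X (h, \<one>\<^bsub>G\<^esub>) x"
    and act: "\<And>k g y x. \<lbrakk>k \<in> carrier K; g \<in> carrier G; y \<in> points Y; x \<in> points X\<rbrakk> \<Longrightarrow> 
      f (action Y (k, \<one>\<^bsub>H\<^esub>) y) (action X (\<one>\<^bsub>H\<^esub>, g) x) = action Z (k, g) (f y x)"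
  shows "biset_iso G K (biset_tensor G H K Y X) Z"
  unfolding biset_iso_def
proof (intro exI[of _ F] conjI ballI)
  have "F ` points (biset_tensor G H K Y X) = points Z"
    unfolding points_tensor im using F by (force simp: image_iff)
  moreover have "inj_on F (points (biset_tensor G H K Y X))"
    unfolding points_tensor
  proof (rule inj_onI)
    fix C' C assume "C' \<in> {ob y x |y x. y \<in> points Y \<and> x \<in> points X}"
      "C \<in> {ob y x |y x. y \<in> points Y \<and> x \<in> points X}" and FC: "F C' = F C"
    then obtain y' x' y x where *: "y' \<in> points Y" "x' \<in> points X" "y \<in> points Y" "x \<in> points X"
      and C: "C' = ob y' x'" "C = ob y x"
      by blast
    have "f y' x' = f y x" using FC * unfolding C by (simp add: F)
    then show "C' = C"
      using eq[OF *(3,4,1,2)] ob_eq_iff[OF *(3,4,1,2)] unfolding C by blast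
  qed
  ultimately show "bij_betw F (points (biset_tensor G H K Y X)) (points Z)" by (simp add: bij_betw_def)
next
  fix a C assume "a \<in> carrier (K \<times>\<times> G)" "C \<in> points (biset_tensor G H K Y X)"
  then show "F (action (biset_tensor G H K Y X) a C) = action Z a (F C)"
    by (auto simp: points_tensor tensor_action F Xcl Ycl act)
qed

end

lemma biset_tensor_iso:
  assumes "group G" "group H" "group K" "biset H K Y" "biset H K Y'" "biset G H X" "biset G H X'"
    "biset_iso H K Y Y'" "biset_iso G H X X'"
  shows "biset_iso G K (biset_tensor G H K Y X) (biset_tensor G H K Y' X')"
proof -
  interpret A: biset_pair G H K Y X using assms by (simp add: biset_pair_def biset_pair_axioms_def)
  interpret B: biset_pair G H K Y' X' using assms by (simp add: biset_pair_def biset_pair_axioms_def)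
  obtain f where f: "bij_betw f (points Y) (points Y')"
    "\<And>a x. a \<in> carrier (K \<times>\<times> H) \<Longrightarrow> x \<in> points Y \<Longrightarrow> f (action Y a x) = action Y' a (f x)"
    using assms(8) unfolding biset_iso_def by blast
  obtain g where g: "bij_betw g (points X) (points X')"
    "\<And>a x. a \<in> carrier (H \<times>\<times> G) \<Longrightarrow> x \<in> points X \<Longrightarrow> g (action X a x) = action X' a (g x)"
    using assms(9) unfolding biset_iso_def by blast
  have fi: "f y \<in> points Y'" if "y \<in> points Y" for y using f(1) that by (rule bij_betw_apply)
  have gi: "g y \<in> points X'" if "y \<in> points X" for y using g(1) that by (rule bij_betw_apply)
  note ff = f(2)[symmetric] and gg = g(2)[symmetric]
  have finj: "f y = f y' \<longleftrightarrow> y = y'" if "y \<in> points Y" "y' \<in> points Y" for y y'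
    using f(1) that by (auto simp: bij_betw_def inj_on_def)
  have ginj: "g y = g y' \<longleftrightarrow> y = y'" if "y \<in> points X" "y' \<in> points X" for y y'
    using g(1) that by (auto simp: bij_betw_def inj_on_def)
  show ?thesis
  proof (rule A.tensor_isoI[where F = "\<lambda>C. map_prod f g ` C" and f = "\<lambda>y x. B.ob (f y) (g x)"])
    fix y x assume "y \<in> points Y" "x \<in> points X"
    then show "map_prod f g ` A.ob y x = B.ob (f y) (g x)"
      unfolding A.ob_def B.ob_def by (force simp: f g image_iff)
  next
    have "f ` points Y = points Y'" "g ` points X = points X'" using f g by (simp_all add: bij_betw_def)
    note fg = this[symmetric]
    show "points (biset_tensor G H K Y' X') = {B.ob (f y) (g x) | y x. y \<in> points Y \<and> x \<in> points X}"
      unfolding B.points_tensor fg by auto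
  next
    fix y x y' x' assume *: "y \<in> points Y" "x \<in> points X" "y' \<in> points Y" "x' \<in> points X"
      "B.ob (f y') (g x') = B.ob (f y) (g x)"
    then show "\<exists>h\<in>carrier H. y' = action Y (\<one>\<^bsub>K\<^esub>, h) y \<and> x' = action X (h, \<one>\<^bsub>G\<^esub>) x"
      by (auto simp: B.ob_eq_iff fi gi ff gg finj ginj A.Xcl A.Ycl)
  next
    fix k l y x assume "k \<in> carrier K" "l \<in> carrier G" "y \<in> points Y" "x \<in> points X"
    then show "B.ob (f (action Y (k, \<one>\<^bsub>H\<^esub>) y)) (g (action X (\<one>\<^bsub>H\<^esub>, l) x)) =
      action (biset_tensor G H K Y' X') (k, l) (B.ob (f y) (g x))"
      by (auto simp: B.tensor_action fi gi f g)
  qed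
qed

lemma biset_tensor_union_left:
  fixes Y :: "('k, 'h, 'y) biset" and Y' :: "('k, 'h, 'z) biset" and X :: "('h, 'g, 'x) biset"
  assumes "group G" "group H" "group K" "biset H K Y" "biset H K Y'" "biset G H X"
  shows "biset_iso G K (biset_tensor G H K (biset_union Y Y') X)
    (biset_union (biset_tensor G H K Y X) (biset_tensor G H K Y' X))"
proof -
  have u: "biset H K (biset_union Y Y')" using assms by (simp add: biset_union)
  interpret U: biset_pair G H K "biset_union Y Y'" X
    using assms u by (simp add: biset_pair_def biset_pair_axioms_def)
  interpret A: biset_pair G H K Y X using assms by (simp add: biset_pair_def biset_pair_axioms_def)
  interpret B: biset_pair G H K Y' X using assms by (simp add: biset_pair_def biset_pair_axioms_def)
  have pU: "points (biset_union Y Y') = points Y <+> points Y'" by (simp add: biset_union_def)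
  have aU: "action (biset_union Y Y') a (Inl y) = Inl (action Y a y)" if "y \<in> points Y" for a y
    using that by (simp add: biset_union_def InlI)
  have aU': "action (biset_union Y Y') a (Inr y) = Inr (action Y' a y)" if "y \<in> points Y'" for a y
    using that by (simp add: biset_union_def InrI)
  have oA: "A.ob y x \<in> points (biset_tensor G H K Y X)" if "y \<in> points Y" "x \<in> points X" for y x
    using that by (auto simp: A.points_tensor)
  have oB: "B.ob y x \<in> points (biset_tensor G H K Y' X)" if "y \<in> points Y'" "x \<in> points X" for y x
    using that by (auto simp: B.points_tensor)
  have tA: "action (biset_union (biset_tensor G H K Y X) (biset_tensor G H K Y' X)) a (Inl C) = Inl (action (biset_tensor G H K Y X) a C)"
    if "C \<in> points (biset_tensor G H K Y X)" for a C
    using that by (simp add: biset_union_def InlI)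
  have tB: "action (biset_union (biset_tensor G H K Y X) (biset_tensor G H K Y' X)) a (Inr C) = Inr (action (biset_tensor G H K Y' X) a C)"
    if "C \<in> points (biset_tensor G H K Y' X)" for a C
    using that by (simp add: biset_union_def InrI)
  define F where "F C = (if \<exists>y x. (Inl y, x) \<in> C then Inl {(y, x). (Inl y, x) \<in> C} else Inr {(y, x). (Inr y, x) \<in> C})"
    for C :: "(('y + 'z) \<times> 'x) set"
  define f where "f z x = (case z of Inl y \<Rightarrow> Inl (A.ob y x) | Inr y \<Rightarrow> Inr (B.ob y x))" for z x
  show ?thesis
  proof (rule U.tensor_isoI[where F = F and f = f])
    fix z x assume z: "z \<in> points (biset_union Y Y')" and x: "x \<in> points X"
    show "F (U.ob z x) = f z x"
    proof (cases z)
      case (Inl y)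
      then have "U.ob z x = (\<lambda>(y, x). (Inl y, x)) ` A.ob y x"
        using z pU aU by (force simp: U.ob_def A.ob_def image_iff)
      moreover have "(y, x) \<in> A.ob y x" using Inl z x by (intro A.ob_self) (auto simp: pU)
      ultimately have "\<exists>y' x'. (Inl y', x') \<in> U.ob z x"
        "{(a, b). (Inl a, b) \<in> U.ob z x} = A.ob y x" by (force simp: image_iff)+
      then show ?thesis using Inl by (simp only: F_def f_def if_True sum.case)
    next
      case (Inr y)
      then have "U.ob z x = (\<lambda>(y, x). (Inr y, x)) ` B.ob y x"
        using z pU aU' by (force simp: U.ob_def B.ob_def image_iff)
      then have "\<not> (\<exists>y' x'. (Inl y', x') \<in> U.ob z x)"
        "{(a, b). (Inr a, b) \<in> U.ob z x} = B.ob y x" by (force simp: image_iff)+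
      then show ?thesis using Inr by (simp only: F_def f_def if_False sum.case)
    qed
  next
    show "points (biset_union (biset_tensor G H K Y X) (biset_tensor G H K Y' X)) =
      {f y x | y x. y \<in> points (biset_union Y Y') \<and> x \<in> points X}"
      (is "?L = ?R")
    proof (rule Set.set_eqI)
      fix w
      show "w \<in> ?L \<longleftrightarrow> w \<in> ?R"
      proof (cases w)
        case (Inl C)
        have "w \<in> ?L \<longleftrightarrow> (\<exists>y\<in>points Y. \<exists>x\<in>points X. C = A.ob y x)" (is "_ = ?M")
          by (auto simp: Inl biset_union_def Plus_def A.points_tensor)
        also have "\<dots> \<longleftrightarrow> w \<in> ?R"
        proof
          assume ?M
          then obtain y x where yx: "y \<in> points Y" "x \<in> points X" "C = A.ob y x" by blast
          have "w = f (Inl y) x" "Inl y \<in> points (biset_union Y Y')" by (use yx in \<open>auto simp: Inl f_def pU\<close>)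
          with yx show "w \<in> ?R" by blast
        next
          assume "w \<in> ?R"
          then obtain z x where z: "z \<in> points (biset_union Y Y')" "x \<in> points X" "w = f z x" by blast
          then show ?M by (cases z) (auto simp: Inl f_def pU)
        qed
        finally show ?thesis .
      next
        case (Inr C)
        have "w \<in> ?L \<longleftrightarrow> (\<exists>y\<in>points Y'. \<exists>x\<in>points X. C = B.ob y x)" (is "_ = ?M")
          by (auto simp: Inr biset_union_def Plus_def B.points_tensor)
        also have "\<dots> \<longleftrightarrow> w \<in> ?R"
        proof
          assume ?M
          then obtain y x where yx: "y \<in> points Y'" "x \<in> points X" "C = B.ob y x" by blast
          have "w = f (Inr y) x" "Inr y \<in> points (biset_union Y Y')" by (use yx in \<open>auto simp: Inr f_def pU\<close>)
          with yx show "w \<in> ?R" by blast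
        next
          assume "w \<in> ?R"
          then obtain z x where z: "z \<in> points (biset_union Y Y')" "x \<in> points X" "w = f z x" by blast
          then show ?M by (cases z) (auto simp: Inr f_def pU)
        qed
        finally show ?thesis .
      qed
    qed
  next
    fix y x y' x' assume "y \<in> points (biset_union Y Y')" "x \<in> points X" "y' \<in> points (biset_union Y Y')" "x' \<in> points X"
      "f y' x' = f y x"
    then show "\<exists>h\<in>carrier H. y' = action (biset_union Y Y') (\<one>\<^bsub>K\<^esub>, h) y \<and> x' = action X (h, \<one>\<^bsub>G\<^esub>) x"
      by (auto simp: pU f_def A.ob_eq_iff B.ob_eq_iff aU aU')
  next
    fix k l y x assume "k \<in> carrier K" "l \<in> carrier G" "y \<in> points (biset_union Y Y')" "x \<in> points X"
    then show "f (action (biset_union Y Y') (k, \<one>\<^bsub>H\<^esub>) y) (action X (\<one>\<^bsub>H\<^esub>, l) x) =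
      action (biset_union (biset_tensor G H K Y X) (biset_tensor G H K Y' X)) (k, l) (f y x)"
      using oA oB
      by (cases y) (auto simp: pU f_def aU aU' A.tensor_action B.tensor_action tA tB)
  qed
qed

lemma biset_tensor_union_right:
  fixes Y :: "('k, 'h, 'y) biset" and X :: "('h, 'g, 'x) biset" and X' :: "('h, 'g, 'z) biset"
  assumes "group G" "group H" "group K" "biset H K Y" "biset G H X" "biset G H X'"
  shows "biset_iso G K (biset_tensor G H K Y (biset_union X X'))
    (biset_union (biset_tensor G H K Y X) (biset_tensor G H K Y X'))"
proof -
  have u: "biset G H (biset_union X X')" using assms by (simp add: biset_union)
  interpret U: biset_pair G H K Y "biset_union X X'"
    using assms u by (simp add: biset_pair_def biset_pair_axioms_def)
  interpret A: biset_pair G H K Y X using assms by (simp add: biset_pair_def biset_pair_axioms_def)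
  interpret B: biset_pair G H K Y X' using assms by (simp add: biset_pair_def biset_pair_axioms_def)
  have pU: "points (biset_union X X') = points X <+> points X'" by (simp add: biset_union_def)
  have aU: "action (biset_union X X') a (Inl y) = Inl (action X a y)" if "y \<in> points X" for a y
    using that by (simp add: biset_union_def InlI)
  have aU': "action (biset_union X X') a (Inr y) = Inr (action X' a y)" if "y \<in> points X'" for a y
    using that by (simp add: biset_union_def InrI)
  have oA: "A.ob y x \<in> points (biset_tensor G H K Y X)" if "y \<in> points Y" "x \<in> points X" for y x
    using that by (auto simp: A.points_tensor)
  have oB: "B.ob y x \<in> points (biset_tensor G H K Y X')" if "y \<in> points Y" "x \<in> points X'" for y x
    using that by (auto simp: B.points_tensor)
  have tA: "action (biset_union (biset_tensor G H K Y X) (biset_tensor G H K Y X')) a (Inl C) = Inl (action (biset_tensor G H K Y X) a C)"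
    if "C \<in> points (biset_tensor G H K Y X)" for a C
    using that by (simp add: biset_union_def InlI)
  have tB: "action (biset_union (biset_tensor G H K Y X) (biset_tensor G H K Y X')) a (Inr C) = Inr (action (biset_tensor G H K Y X') a C)"
    if "C \<in> points (biset_tensor G H K Y X')" for a C
    using that by (simp add: biset_union_def InrI)
  define F where "F C = (if \<exists>y x. (y, Inl x) \<in> C then Inl {(y, x). (y, Inl x) \<in> C} else Inr {(y, x). (y, Inr x) \<in> C})"
    for C :: "('y \<times> ('x + 'z)) set"
  define f where "f y z = (case z of Inl x \<Rightarrow> Inl (A.ob y x) | Inr x \<Rightarrow> Inr (B.ob y x))" for z y
  show ?thesis
  proof (rule U.tensor_isoI[where F = F and f = f])
    fix z y assume z: "z \<in> points (biset_union X X')" and y: "y \<in> points Y"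
    show "F (U.ob y z) = f y z"
    proof (cases z)
      case (Inl x)
      then have "U.ob y z = (\<lambda>(y, x). (y, Inl x)) ` A.ob y x"
        using z pU aU by (force simp: U.ob_def A.ob_def image_iff)
      moreover have "(y, x) \<in> A.ob y x" using Inl z y by (intro A.ob_self) (auto simp: pU)
      ultimately have "\<exists>y' x'. (y', Inl x') \<in> U.ob y z"
        "{(a, b). (a, Inl b) \<in> U.ob y z} = A.ob y x" by (force simp: image_iff)+
      then show ?thesis using Inl by (simp only: F_def f_def if_True sum.case)
    next
      case (Inr x)
      then have "U.ob y z = (\<lambda>(y, x). (y, Inr x)) ` B.ob y x"
        using z pU aU' by (force simp: U.ob_def B.ob_def image_iff)
      then have "\<not> (\<exists>y' x'. (y', Inl x') \<in> U.ob y z)"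
        "{(a, b). (a, Inr b) \<in> U.ob y z} = B.ob y x" by (force simp: image_iff)+
      then show ?thesis using Inr by (simp only: F_def f_def if_False sum.case)
    qed
  next
    show "points (biset_union (biset_tensor G H K Y X) (biset_tensor G H K Y X')) =
      {f y x | y x. y \<in> points Y \<and> x \<in> points (biset_union X X')}"
      (is "?L = ?R")
    proof (rule Set.set_eqI)
      fix w
      show "w \<in> ?L \<longleftrightarrow> w \<in> ?R"
      proof (cases w)
        case (Inl C)
        have "w \<in> ?L \<longleftrightarrow> (\<exists>y\<in>points Y. \<exists>x\<in>points X. C = A.ob y x)" (is "_ = ?M")
          by (auto simp: Inl biset_union_def Plus_def A.points_tensor)
        also have "\<dots> \<longleftrightarrow> w \<in> ?R"
        proof
          assume ?M
          then obtain y x where yx: "y \<in> points Y" "x \<in> points X" "C = A.ob y x" by blast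
          have "w = f y (Inl x)" "Inl x \<in> points (biset_union X X')" by (use yx in \<open>auto simp: Inl f_def pU\<close>)
          with yx show "w \<in> ?R" by blast
        next
          assume "w \<in> ?R"
          then obtain z y where z: "y \<in> points Y" "z \<in> points (biset_union X X')" "w = f y z" by blast
          then show ?M by (cases z) (auto simp: Inl f_def pU)
        qed
        finally show ?thesis .
      next
        case (Inr C)
        have "w \<in> ?L \<longleftrightarrow> (\<exists>y\<in>points Y. \<exists>x\<in>points X'. C = B.ob y x)" (is "_ = ?M")
          by (auto simp: Inr biset_union_def Plus_def B.points_tensor)
        also have "\<dots> \<longleftrightarrow> w \<in> ?R"
        proof
          assume ?M
          then obtain y x where yx: "y \<in> points Y" "x \<in> points X'" "C = B.ob y x" by blast
          have "w = f y (Inr x)" "Inr x \<in> points (biset_union X X')" by (use yx in \<open>auto simp: Inr f_def pU\<close>)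
          with yx show "w \<in> ?R" by blast
        next
          assume "w \<in> ?R"
          then obtain z y where z: "y \<in> points Y" "z \<in> points (biset_union X X')" "w = f y z" by blast
          then show ?M by (cases z) (auto simp: Inr f_def pU)
        qed
        finally show ?thesis .
      qed
    qed
  next
    fix y x y' x' assume "y \<in> points Y" "x \<in> points (biset_union X X')" "y' \<in> points Y" "x' \<in> points (biset_union X X')"
      "f y' x' = f y x"
    then show "\<exists>h\<in>carrier H. y' = action Y (\<one>\<^bsub>K\<^esub>, h) y \<and> x' = action (biset_union X X') (h, \<one>\<^bsub>G\<^esub>) x"
      by (auto simp: pU f_def A.ob_eq_iff B.ob_eq_iff aU aU')
  next
    fix k l y x assume "k \<in> carrier K" "l \<in> carrier G" "y \<in> points Y" "x \<in> points (biset_union X X')"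
    then show "f (action Y (k, \<one>\<^bsub>H\<^esub>) y) (action (biset_union X X') (\<one>\<^bsub>H\<^esub>, l) x) =
      action (biset_union (biset_tensor G H K Y X) (biset_tensor G H K Y X')) (k, l) (f y x)"
      using oA oB
      by (cases x) (auto simp: pU f_def aU aU' A.tensor_action B.tensor_action tA tB)
  qed
qed

lemma Z_loc_mult: "prime p \<Longrightarrow> a \<in> Z_loc p \<Longrightarrow> b \<in> Z_loc p \<Longrightarrow> a * b \<in> Z_loc p"
proof -
  assume p: "prime p" and "a \<in> Z_loc p" "b \<in> Z_loc p"
  then obtain m n k l :: int where *: "a = of_int m / of_int n" "\<not> int p dvd n"
      "b = of_int k / of_int l" "\<not> int p dvd l"
    unfolding Z_loc_def by blast
  have "\<not> int p dvd n * l" using p * by (simp add: prime_dvd_mult_iff)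
  moreover have "a * b = of_int (m * k) / of_int (n * l)" by (simp add: *)
  ultimately show ?thesis unfolding Z_loc_def by blast
qed

lemma Z_loc_add: "prime p \<Longrightarrow> a \<in> Z_loc p \<Longrightarrow> b \<in> Z_loc p \<Longrightarrow> a + b \<in> Z_loc p"
proof -
  assume p: "prime p" and "a \<in> Z_loc p" "b \<in> Z_loc p"
  then obtain m n k l :: int where *: "a = of_int m / of_int n" "\<not> int p dvd n"
      "b = of_int k / of_int l" "\<not> int p dvd l"
    unfolding Z_loc_def by blast
  have nl: "n \<noteq> 0" "l \<noteq> 0" using * by auto
  have "\<not> int p dvd n * l" using p * by (simp add: prime_dvd_mult_iff)
  moreover have "a + b = of_int (m * l + k * n) / of_int (n * l)"
    using nl by (simp add: * field_simps)
  ultimately show ?thesis unfolding Z_loc_def by blast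
qed

lemma Z_loc_of_int: "prime p \<Longrightarrow> of_int a \<in> Z_loc p"
proof -
  assume p: "prime p"
  then have "\<not> int p dvd 1" using prime_gt_1_nat[of p] by auto
  moreover have "of_int a = (of_int a :: rat) / of_int 1" by simp
  ultimately show ?thesis unfolding Z_loc_def by blast
qed

lemma Z_loc_0: "prime p \<Longrightarrow> 0 \<in> Z_loc p" using Z_loc_of_int[of p 0] by simp
lemma Z_loc_1: "prime p \<Longrightarrow> 1 \<in> Z_loc p" using Z_loc_of_int[of p 1] by simp
lemma Z_loc_uminus: "prime p \<Longrightarrow> a \<in> Z_loc p \<Longrightarrow> - a \<in> Z_loc p"
  using Z_loc_mult[OF _ Z_loc_of_int[of p "-1"], of a] by simp

lemma Z_loc_sum: "prime p \<Longrightarrow> (\<And>i. i \<in> I \<Longrightarrow> f i \<in> Z_loc p) \<Longrightarrow> sum f I \<in> Z_loc p"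
  by (induction I rule: infinite_finite_induct) (auto simp: Z_loc_0 Z_loc_add)

lemma combs_0: "prime p \<Longrightarrow> 0 \<in> biset_combs p G H"
  by (simp add: biset_combs_def Z_loc_0)

lemma combs_add: "prime p \<Longrightarrow> x \<in> biset_combs p G H \<Longrightarrow> y \<in> biset_combs p G H \<Longrightarrow> x + y \<in> biset_combs p G H"
  using Poly_Mapping.keys_add[of x y] by (auto simp: biset_combs_def lookup_add Z_loc_add)

lemma combs_uminus: "prime p \<Longrightarrow> x \<in> biset_combs p G H \<Longrightarrow> - x \<in> biset_combs p G H"
  by (auto simp: biset_combs_def Z_loc_uminus in_keys_iff)

lemma combs_diff: "prime p \<Longrightarrow> x \<in> biset_combs p G H \<Longrightarrow> y \<in> biset_combs p G H \<Longrightarrow> x - y \<in> biset_combs p G H"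
  by (simp only: diff_conv_add_uminus combs_add combs_uminus)

lemma combs_single: "prime p \<Longrightarrow> biset G H X \<Longrightarrow> c \<in> Z_loc p \<Longrightarrow> Poly_Mapping.single X c \<in> biset_combs p G H"
  by (auto simp: biset_combs_def lookup_single when_def Z_loc_0 split: if_splits)

lemma combs_sum: "prime p \<Longrightarrow> (\<And>i. i \<in> I \<Longrightarrow> f i \<in> biset_combs p G H) \<Longrightarrow> sum f I \<in> biset_combs p G H"
  by (induction I rule: infinite_finite_induct) (auto simp: combs_0 combs_add)

lemma rels_add: "r \<in> biset_rels p G H \<Longrightarrow> s \<in> biset_rels p G H \<Longrightarrow> r + s \<in> biset_rels p G H"
proof (induction rule: biset_rels.induct)
  case (iso X Y c r) then show ?case using biset_rels.iso[OF iso(1-4)] by (simp add: add.assoc)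
next
  case (union X Y c r) then show ?case using biset_rels.union[OF union(1-3)] by (simp add: add.assoc)
qed simp

lemma rels_uminus: "prime p \<Longrightarrow> r \<in> biset_rels p G H \<Longrightarrow> - r \<in> biset_rels p G H"
proof (rotate_tac, induction rule: biset_rels.induct)
  case (iso X Y c r)
  have "- (Poly_Mapping.single X c - Poly_Mapping.single Y c + r) =
     Poly_Mapping.single X (- c) - Poly_Mapping.single Y (- c) + - r" by (simp add: single_uminus)
  then show ?case using biset_rels.iso[OF iso(1-3) Z_loc_uminus[OF iso(7,4)] iso(6)[OF iso(7)]] by simp
next
  case (union X Y c r)
  have "- (Poly_Mapping.single (nat_copy (biset_union X Y)) c - Poly_Mapping.single X c - Poly_Mapping.single Y c + r) =
     Poly_Mapping.single (nat_copy (biset_union X Y)) (- c) - Poly_Mapping.single X (- c) - Poly_Mapping.single Y (- c) + - r"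
    by (simp add: single_uminus)
  then show ?case using biset_rels.union[OF union(1,2) Z_loc_uminus[OF union(6,3)] union(5)[OF union(6)]] by simp
qed (simp add: biset_rels.zero)

lemma rels_sum: "(\<And>i. i \<in> I \<Longrightarrow> f i \<in> biset_rels p G H) \<Longrightarrow> sum f I \<in> biset_rels p G H"
  by (induction I rule: infinite_finite_induct) (auto simp: biset_rels.zero rels_add)

lemma rels_iso: "\<lbrakk>biset G H X; biset G H Y; biset_iso G H X Y; c \<in> Z_loc p\<rbrakk> \<Longrightarrow>
    Poly_Mapping.single X c - Poly_Mapping.single Y c \<in> biset_rels p G H"
  using biset_rels.iso[OF _ _ _ _ biset_rels.zero] by fastforce

lemma rels_union: "\<lbrakk>biset G H X; biset G H Y; c \<in> Z_loc p\<rbrakk> \<Longrightarrow>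
    Poly_Mapping.single (nat_copy (biset_union X Y)) c
      - Poly_Mapping.single X c - Poly_Mapping.single Y c \<in> biset_rels p G H"
  using biset_rels.union[OF _ _ _ biset_rels.zero] by fastforce

lemma equiv_biset_cong: "prime p \<Longrightarrow> equiv (biset_combs p G H) (biset_cong p G H)"
proof (rule equivI)
  assume p: "prime p"
  show "biset_cong p G H \<subseteq> biset_combs p G H \<times> biset_combs p G H" by (auto simp: biset_cong_def)
  show "refl_on (biset_combs p G H) (biset_cong p G H)" 
    by (rule refl_onI) (auto simp: biset_cong_def biset_rels.zero)
  show "sym (biset_cong p G H)"
    by (rule symI) (use rels_uminus[OF p] in \<open>fastforce simp: biset_cong_def\<close>)
  show "trans (biset_cong p G H)"
    by (rule transI) (use rels_add in \<open>fastforce simp: biset_cong_def\<close>)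
qed

lemma comb_comp_superset:
  assumes "finite A" "Poly_Mapping.keys y \<subseteq> A" "finite B" "Poly_Mapping.keys x \<subseteq> B"
  shows "comb_comp G H K y x = (\<Sum>b\<in>A. \<Sum>c\<in>B. Poly_Mapping.single (nat_copy (biset_tensor G H K b c))
       (Poly_Mapping.lookup y b * Poly_Mapping.lookup x c))"
proof -
  have "comb_comp G H K y x = (\<Sum>b\<in>Poly_Mapping.keys y. \<Sum>c\<in>B. Poly_Mapping.single (nat_copy (biset_tensor G H K b c))
       (Poly_Mapping.lookup y b * Poly_Mapping.lookup x c))"
    unfolding comb_comp_def
    by (intro sum.cong refl sum.mono_neutral_left) (use assms in \<open>auto simp: in_keys_iff\<close>)
  also have "\<dots> = (\<Sum>b\<in>A. \<Sum>c\<in>B. Poly_Mapping.single (nat_copy (biset_tensor G H K b c))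
       (Poly_Mapping.lookup y b * Poly_Mapping.lookup x c))"
    by (intro sum.mono_neutral_left) (use assms in \<open>auto simp: in_keys_iff\<close>)
  finally show ?thesis .
qed

lemma comb_comp_diff_left: "comb_comp G H K (y - y') x = comb_comp G H K y x - comb_comp G H K y' x"
proof -
  let ?A = "Poly_Mapping.keys y \<union> Poly_Mapping.keys y'"
  have "Poly_Mapping.keys (y - y') \<subseteq> ?A" by (auto simp: in_keys_iff lookup_minus)
  then show ?thesis
    by (simp add: comb_comp_superset[of ?A _ "Poly_Mapping.keys x"] lookup_minus left_diff_distrib
        single_diff sum_subtractf)
qed

lemma comb_comp_diff_right: "comb_comp G H K y (x - x') = comb_comp G H K y x - comb_comp G H K y x'"
proof -
  let ?A = "Poly_Mapping.keys x \<union> Poly_Mapping.keys x'"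
  have "Poly_Mapping.keys (x - x') \<subseteq> ?A" by (auto simp: in_keys_iff lookup_minus)
  then show ?thesis
    by (simp add: comb_comp_superset[of "Poly_Mapping.keys y" _ ?A] lookup_minus right_diff_distrib
        single_diff sum_subtractf)
qed

lemma comb_comp_add_left: "comb_comp G H K (y + y') x = comb_comp G H K y x + comb_comp G H K y' x"
  using comb_comp_diff_left[of G H K "y + y'" y' x] by simp

lemma comb_comp_add_right: "comb_comp G H K y (x + x') = comb_comp G H K y x + comb_comp G H K y x'"
  using comb_comp_diff_right[of G H K y "x + x'" x'] by simp

lemma comb_comp_single_left:
  "comb_comp G H K (Poly_Mapping.single B d) x =
     (\<Sum>C\<in>Poly_Mapping.keys x. Poly_Mapping.single (nat_copy (biset_tensor G H K B C)) (d * Poly_Mapping.lookup x C))"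
  by (simp add: comb_comp_superset[of "{B}" _ "Poly_Mapping.keys x"])

lemma comb_comp_single_right:
  "comb_comp G H K y (Poly_Mapping.single C d) =
     (\<Sum>B\<in>Poly_Mapping.keys y. Poly_Mapping.single (nat_copy (biset_tensor G H K B C)) (Poly_Mapping.lookup y B * d))"
  by (simp add: comb_comp_superset[of "Poly_Mapping.keys y" _ "{C}"])

locale biset_comp_setup =
  G: group G + H: group H + K: group K
  for G :: "('g, 'm) monoid_scheme" and H :: "('h, 'n) monoid_scheme" and K :: "('k, 'o) monoid_scheme" +
  fixes p :: nat
  assumes p: "prime p"
begin

lemma tensor_biset: "biset H K Y \<Longrightarrow> biset G H X \<Longrightarrow> biset G K (biset_tensor G H K Y X)"
  by (rule biset_pair.biset_tensor)
    (simp add: biset_pair_def biset_pair_axioms_def G.is_group H.is_group K.is_group)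

lemma copy_biset: "biset H K Y \<Longrightarrow> biset G H X \<Longrightarrow> biset G K (nat_copy (biset_tensor G H K Y X))"
  by (rule nat_copy(1)[OF G.is_group K.is_group tensor_biset])

lemma nat_copy_iso:
  assumes "biset G K X" "biset G K Y" "biset_iso G K X Y"
  shows "biset_iso G K (nat_copy X) (nat_copy Y)"
  using assms nat_copy[OF G.is_group K.is_group] biset_iso_trans[OF G.is_group K.is_group] by meson

lemma single_tensor_iso:
  assumes "biset H K Y" "biset H K Y'" "biset G H X" "biset G H X'" "biset_iso H K Y Y'" "biset_iso G H X X'" "c \<in> Z_loc p"
  shows "Poly_Mapping.single (nat_copy (biset_tensor G H K Y X)) c -
    Poly_Mapping.single (nat_copy (biset_tensor G H K Y' X')) c \<in> biset_rels p G K"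
  by (intro rels_iso copy_biset nat_copy_iso tensor_biset
      biset_tensor_iso[OF G.is_group H.is_group K.is_group] assms)

lemma single_union:
  assumes "biset G K W" "biset G K X" "biset G K Y" "biset_iso G K W (biset_union X Y)" "c \<in> Z_loc p"
  shows "Poly_Mapping.single (nat_copy W) c - Poly_Mapping.single (nat_copy X) c
    - Poly_Mapping.single (nat_copy Y) c \<in> biset_rels p G K"
proof -
  note GK = G.is_group K.is_group
  let ?U = "biset_union (nat_copy X) (nat_copy Y)"
  have U: "biset G K ?U" by (intro biset_union[OF GK] nat_copy[OF GK] assms)
  have "biset_iso G K W ?U"
    by (rule biset_iso_trans[OF GK assms(1,4)]) (intro biset_union_iso nat_copy[OF GK] assms)
  then have "biset_iso G K (nat_copy W) (nat_copy ?U)"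
    using nat_copy[OF GK U] nat_copy[OF GK assms(1)] biset_iso_trans[OF GK] assms(1) U by meson
  then have "Poly_Mapping.single (nat_copy W) c - Poly_Mapping.single (nat_copy ?U) c \<in> biset_rels p G K"
    by (intro rels_iso nat_copy[OF GK] assms U)
  from rels_add[OF this rels_union[OF nat_copy(1)[OF GK assms(2)] nat_copy(1)[OF GK assms(3)] assms(5)]]
  show ?thesis by (simp add: algebra_simps)
qed

lemma comb_comp_closed:
  "y \<in> biset_combs p H K \<Longrightarrow> x \<in> biset_combs p G H \<Longrightarrow> comb_comp G H K y x \<in> biset_combs p G K"
  unfolding comb_comp_def
  by (intro combs_sum[OF p] combs_single[OF p] copy_biset Z_loc_mult[OF p]) (auto simp: biset_combs_def)

lemma biset_iso_refl: "biset_iso L M Z Z"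
  unfolding biset_iso_def by (intro exI[of _ id]) auto

lemma comb_comp_rels_right:
  assumes y: "y \<in> biset_combs p H K" and r: "r \<in> biset_rels p G H"
  shows "comb_comp G H K y r \<in> biset_rels p G K"
  using r
proof induction
  case zero
  show ?case by (simp add: comb_comp_def biset_rels.zero)
next
  case (iso X X' c r)
  have "comb_comp G H K y (Poly_Mapping.single X c - Poly_Mapping.single X' c) \<in> biset_rels p G K"
    unfolding comb_comp_diff_right comb_comp_single_right sum_subtractf[symmetric]
    using y iso by (intro rels_sum single_tensor_iso Z_loc_mult[OF p] biset_iso_refl) (auto simp: biset_combs_def)
  then show ?case using iso.IH by (simp only: comb_comp_add_right rels_add)
next
  case (union X X' c r)
  have u: "biset G H (biset_union X X')"
    by (intro biset_union G.is_group H.is_group union)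
  note cu = nat_copy[OF G.is_group H.is_group u]
  have "comb_comp G H K y (Poly_Mapping.single (nat_copy (biset_union X X')) c
      - Poly_Mapping.single X c - Poly_Mapping.single X' c) \<in> biset_rels p G K"
    unfolding comb_comp_diff_right comb_comp_single_right sum_subtractf[symmetric]
  proof (rule rels_sum)
    fix B assume "B \<in> Poly_Mapping.keys y"
    then have B: "biset H K B" and c: "Poly_Mapping.lookup y B * c \<in> Z_loc p"
      using y union Z_loc_mult[OF p] by (auto simp: biset_combs_def)
    have "biset_iso G K (biset_tensor G H K B (nat_copy (biset_union X X')))
        (biset_union (biset_tensor G H K B X) (biset_tensor G H K B X'))"
      by (rule biset_iso_trans[OF G.is_group K.is_group tensor_biset[OF B cu(1)]
        biset_tensor_iso[OF G.is_group H.is_group K.is_group B B cu(1) u biset_iso_refl cu(3)]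
        biset_tensor_union_right[OF G.is_group H.is_group K.is_group B union(1,2)]])
    then show "Poly_Mapping.single (nat_copy (biset_tensor G H K B (nat_copy (biset_union X X')))) (Poly_Mapping.lookup y B * c)
      - Poly_Mapping.single (nat_copy (biset_tensor G H K B X)) (Poly_Mapping.lookup y B * c)
      - Poly_Mapping.single (nat_copy (biset_tensor G H K B X')) (Poly_Mapping.lookup y B * c) \<in> biset_rels p G K"
      by (intro single_union tensor_biset B cu(1) union(1,2) c)
  qed
  then show ?case using union.IH by (simp only: comb_comp_add_right rels_add)
qed

lemma comb_comp_rels_left:
  assumes x: "x \<in> biset_combs p G H" and r: "r \<in> biset_rels p H K"
  shows "comb_comp G H K r x \<in> biset_rels p G K"
  using r
proof induction
  case zero
  show ?case by (simp add: comb_comp_def biset_rels.zero)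
next
  case (iso Y Y' c r)
  have "comb_comp G H K (Poly_Mapping.single Y c - Poly_Mapping.single Y' c) x \<in> biset_rels p G K"
    unfolding comb_comp_diff_left comb_comp_single_left sum_subtractf[symmetric]
    using x iso by (intro rels_sum single_tensor_iso Z_loc_mult[OF p] biset_iso_refl) (auto simp: biset_combs_def)
  then show ?case using iso.IH by (simp only: comb_comp_add_left rels_add)
next
  case (union Y Y' c r)
  have u: "biset H K (biset_union Y Y')"
    by (intro biset_union H.is_group K.is_group union)
  note cu = nat_copy[OF H.is_group K.is_group u]
  have "comb_comp G H K (Poly_Mapping.single (nat_copy (biset_union Y Y')) c
      - Poly_Mapping.single Y c - Poly_Mapping.single Y' c) x \<in> biset_rels p G K"
    unfolding comb_comp_diff_left comb_comp_single_left sum_subtractf[symmetric]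
  proof (rule rels_sum)
    fix B assume "B \<in> Poly_Mapping.keys x"
    then have B: "biset G H B" and c: "c * Poly_Mapping.lookup x B \<in> Z_loc p"
      using x union Z_loc_mult[OF p] by (auto simp: biset_combs_def)
    have "biset_iso G K (biset_tensor G H K (nat_copy (biset_union Y Y')) B)
        (biset_union (biset_tensor G H K Y B) (biset_tensor G H K Y' B))"
      by (rule biset_iso_trans[OF G.is_group K.is_group tensor_biset[OF cu(1) B]
        biset_tensor_iso[OF G.is_group H.is_group K.is_group cu(1) u B B cu(3) biset_iso_refl]
        biset_tensor_union_left[OF G.is_group H.is_group K.is_group union(1,2) B]])
    then show "Poly_Mapping.single (nat_copy (biset_tensor G H K (nat_copy (biset_union Y Y')) B)) (c * Poly_Mapping.lookup x B)
      - Poly_Mapping.single (nat_copy (biset_tensor G H K Y B)) (c * Poly_Mapping.lookup x B)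
      - Poly_Mapping.single (nat_copy (biset_tensor G H K Y' B)) (c * Poly_Mapping.lookup x B) \<in> biset_rels p G K"
      by (intro single_union tensor_biset B cu(1) union(1,2) c)
  qed
  then show ?case using union.IH by (simp only: comb_comp_add_left rels_add)
qed

lemma comb_comp_cong:
  assumes "(y, y') \<in> biset_cong p H K" "(x, x') \<in> biset_cong p G H"
  shows "(comb_comp G H K y x, comb_comp G H K y' x') \<in> biset_cong p G K"
proof -
  have c: "y \<in> biset_combs p H K" "y' \<in> biset_combs p H K" "x \<in> biset_combs p G H" "x' \<in> biset_combs p G H"
    and r: "y - y' \<in> biset_rels p H K" "x - x' \<in> biset_rels p G H"
    using assms by (auto simp: biset_cong_def)
  have "comb_comp G H K y x - comb_comp G H K y' x' = comb_comp G H K (y - y') x + comb_comp G H K y' (x - x')"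
    by (simp add: comb_comp_diff_left comb_comp_diff_right)
  also have "\<dots> \<in> biset_rels p G K"
    by (intro rels_add comb_comp_rels_left comb_comp_rels_right c r)
  finally show ?thesis using c by (auto simp: biset_cong_def comb_comp_closed)
qed

lemma comb_comp_congruent2:
  "congruent2 (biset_cong p H K) (biset_cong p G H) (\<lambda>y x. biset_cong p G K `` {comb_comp G H K y x})"
  by (intro congruent2I' equiv_class_eq[OF equiv_biset_cong[OF p]] comb_comp_cong)

theorem biset_comp_rep:
  assumes "y \<in> biset_combs p H K" "x \<in> biset_combs p G H"
  shows "biset_comp p G H K (biset_cong p H K `` {y}) (biset_cong p G H `` {x}) =
    biset_cong p G K `` {comb_comp G H K y x}"
  unfolding biset_comp_def
  by (rule UN_equiv_class2[OF equiv_biset_cong[OF p] equiv_biset_cong[OF p] comb_comp_congruent2 assms])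

theorem biset_comp_closed:
  assumes "Y \<in> biset_module p H K" "X \<in> biset_module p G H"
  shows "biset_comp p G H K Y X \<in> biset_module p G K"
proof -
  obtain y x where "y \<in> biset_combs p H K" "Y = biset_cong p H K `` {y}"
      "x \<in> biset_combs p G H" "X = biset_cong p G H `` {x}"
    using assms unfolding biset_module_def quotient_def by blast
  then show ?thesis
    by (simp add: biset_comp_rep biset_module_def quotientI comb_comp_closed)
qed

theorem biset_comp_biset_class:
  assumes "biset H K Y" "biset G H X"
  shows "biset_comp p G H K (biset_class p H K Y) (biset_class p G H X) =
    biset_class p G K (biset_tensor G H K Y X)"
proof -
  note c = nat_copy[OF H.is_group K.is_group assms(1)] nat_copy[OF G.is_group H.is_group assms(2)]
  have "biset_comp p G H K (biset_class p H K Y) (biset_class p G H X) =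
     biset_cong p G K `` {Poly_Mapping.single (nat_copy (biset_tensor G H K (nat_copy Y) (nat_copy X))) 1}"
    unfolding biset_class_def
    by (simp add: biset_comp_rep combs_single p Z_loc_1 c comb_comp_single_left)
  also have "\<dots> = biset_class p G K (biset_tensor G H K Y X)"
    unfolding biset_class_def
    by (rule equiv_class_eq[OF equiv_biset_cong[OF p]])
      (auto simp: biset_cong_def intro!: combs_single p Z_loc_1 copy_biset single_tensor_iso c assms)
  finally show ?thesis .
qed

end

theorem biset_class_iso:
  assumes "prime p" "group G" "group H" "biset G H X" "biset G H Y" "biset_iso G H X Y"
  shows "biset_class p G H X = biset_class p G H Y"
proof -
  have "biset_iso G H (nat_copy X) (nat_copy Y)"
    using assms nat_copy[OF assms(2,3)] biset_iso_trans[OF assms(2,3)] by meson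
  then show ?thesis
    unfolding biset_class_def
    by (intro equiv_class_eq[OF equiv_biset_cong[OF assms(1)]])
      (auto simp: biset_cong_def intro!: combs_single rels_iso Z_loc_1 nat_copy assms)
qed

theorem comb_augmentation_cong:
  assumes "group S" "(x, y) \<in> biset_cong p S S"
  shows "comb_augmentation S x = comb_augmentation S y"
proof -
  have sup: "comb_augmentation S x = (\<Sum>B\<in>A. Poly_Mapping.lookup x B * (of_nat (card (points B)) / of_nat (order S)))"
    if "finite A" "Poly_Mapping.keys x \<subseteq> A" for A x
    unfolding comb_augmentation_def
    by (rule sum.mono_neutral_left) (use that in \<open>auto simp: in_keys_iff\<close>)
  have diff: "comb_augmentation S (x - y) = comb_augmentation S x - comb_augmentation S y" for x y
  proof -
    have "Poly_Mapping.keys (x - y) \<subseteq> Poly_Mapping.keys x \<union> Poly_Mapping.keys y" by (auto simp: in_keys_iff lookup_minus)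
    then show ?thesis
      by (simp add: sup[of "Poly_Mapping.keys x \<union> Poly_Mapping.keys y"] lookup_minus left_diff_distrib sum_subtractf diff_divide_distrib)
  qed
  have add: "comb_augmentation S (x + y) = comb_augmentation S x + comb_augmentation S y" for x y
    using diff[of "x + y" y] by simp
  have single: "comb_augmentation S (Poly_Mapping.single B c) = c * (of_nat (card (points B)) / of_nat (order S))" for B c
    by (simp add: sup[of "{B}"])
  have "comb_augmentation S r = 0" if "r \<in> biset_rels p S S" for r
    using that
  proof induction
    case zero
    show ?case by (simp add: comb_augmentation_def)
  next
    case (iso X Y c r)
    then have "card (points X) = card (points Y)" by (auto simp: biset_iso_def bij_betw_same_card)
    then show ?case using iso.IH by (simp add: add diff single)
  next
    case (union X Y c r)
    have fin: "finite (points X)" "finite (points Y)" using union by (auto simp: biset_def)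
    have "biset_iso S S (biset_union X Y) (nat_copy (biset_union X Y))"
      by (intro nat_copy biset_union assms union)
    then have "card (points (nat_copy (biset_union X Y))) = card (points X <+> points Y)"
      by (auto simp: biset_iso_def biset_union_def dest: bij_betw_same_card)
    also have "\<dots> = card (points X) + card (points Y)" using fin by (rule card_Plus)
    finally show ?case using union.IH by (simp add: add diff single algebra_simps add_divide_distrib)
  qed
  moreover have "x - y \<in> biset_rels p S S" using assms(2) by (simp add: biset_cong_def)
  ultimately show ?thesis using diff[of x y] by simp
qed

theorem augmentation_rep:
  assumes "prime p" "group S" "X \<in> biset_module p S S" "x \<in> X"
    and "\<And>B. B \<in> Poly_Mapping.keys x \<Longrightarrow> left_free S S B"
  shows "augmentation S X = comb_augmentation S x"
proof -
  have "comb_augmentation S y = comb_augmentation S x" if "y \<in> X" for y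
    using comb_augmentation_cong[OF assms(2)] that assms(4)
      quotient_eq_iff[OF equiv_biset_cong[OF assms(1)] assms(3)[unfolded biset_module_def]
        assms(3)[unfolded biset_module_def] that assms(4)] by blast
  then have "comb_augmentation S ` {y\<in>X. \<forall>B\<in>Poly_Mapping.keys y. left_free S S B} = {comb_augmentation S x}"
    using assms(4,5) by blast
  then show ?thesis by (simp add: augmentation_def)
qed

end

theory Submission
  imports Defs
begin

text \<open>
  Both sides of the equation are compared through their marks. The mark of a biset at a subgroup of
  \<open>R \<times> T\<close> is its number of fixed points, and by Burnside's theorem (\<open>class_mark_eqI\<close>) an element of
  the localized Grothendieck group is determined by its marks. For the composition there is a
  matrix product formula (\<open>mark_tensor\<close>, \<open>class_mark_comp\<close>): for homomorphisms \<open>a: L \<rightarrow> K\<close> and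
  \<open>b: L \<rightarrow> G\<close>, and \<open>X\<close> left-free,
  \<open>|H| \<cdot> mark(a, b, Y \<circ> X) = \<Sum> c \<in> Hom(L, H). mark(a, c, Y) \<cdot> mark(c, b, X)\<close>.

  The marks of the characteristic idempotent of a fusion system \<open>F\<close> on \<open>S\<close> are known explicitly
  (\<open>idem_mark\<close>): the mark at \<open>(a, b)\<close> is \<open>|S| / |F(P, S)|\<close>, where \<open>P\<close> is the image of \<open>b\<close>, if
  \<open>a = \<alpha> \<circ> b\<close> for some \<open>\<alpha> \<in> F(P, S)\<close>, and \<open>0\<close> otherwise. It vanishes in the second case since the
  idempotent is \<open>F\<close>-generated, and by stability it depends in the first case only on \<open>P\<close>. Writing
  \<open>m\<close> for its value, the product formula turns idempotency into \<open>|S| m = |F(P, S)| m\<^sup>2\<close>. The number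
  \<open>|F(P, S)| m / |S|\<close> counts the fixed points of the p-group \<open>P\<close> on the left orbits of the
  idempotent, hence it is congruent modulo \<open>p\<close> to the augmentation, a unit; so \<open>m \<noteq> 0\<close> and
  \<open>m = |S| / |F(P, S)|\<close>.

  This gives the marks of the left-hand side at once. For the right-hand side the product formula
  yields a sum over homomorphisms \<open>c\<close> into \<open>R \<inter> T\<close>, in which \<open>c\<close> contributes iff it is the
  intermediate step of a factorization of \<open>(a, b)\<close> through \<open>K\<close> and \<open>H\<close>. If \<open>Q\<close> is the image of one
  such \<open>c\<close>, then there are \<open>|Hom_(H \<inter> K)(Q, R \<inter> T)|\<close> of them (\<open>card_factorizations\<close>), so the mark is
  \<open>|R| |T| |Hom_(H \<inter> K)(Q, R \<inter> T)| / (|R \<inter> T| |H(Q, R)| |K(Q, T)|)\<close>; without a factorization it is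
  \<open>0\<close>. Hence the marks agree iff all morphisms \<open>P \<rightarrow> R\<close> of \<open>F\<close> with \<open>P \<le> T\<close> factorize and
  \<open>|S| |R \<inter> T| / |F(Q, S)| = |R| |T| |Hom_(H \<inter> K)(Q, R \<inter> T)| / (|H(Q, R)| |K(Q, T)|)\<close>
  for all \<open>Q \<le> R \<inter> T\<close>. For \<open>Q = 1\<close> the latter says \<open>|S| |R \<inter> T| = |R| |T|\<close>, that is, \<open>S = R T\<close>, and
  given this it is the numerical condition in the definition of the composition product.
\<close>

section \<open>Marks of bisets\<close>

text \<open>Marks are taken along a pair of maps \<open>a: L \<rightarrow> H\<close>, \<open>b: L \<rightarrow> G\<close> instead of along a subgroup of
\<open>H \<times> G\<close>. For \<open>a = fst\<close>, \<open>b = snd\<close> on a subgroup of \<open>H \<times> G\<close> this is the usual mark, and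
for homomorphisms \<open>a\<close>, \<open>b\<close> on a group it is the mark of the image of \<open>(a, b)\<close>. The gain is that
the mark of a composite becomes a matrix product (\<open>mark_tensor\<close>) in which no inverse of a
homomorphism occurs.\<close>

definition fixed_points ::
    "'l set \<Rightarrow> ('l \<Rightarrow> 'h) \<Rightarrow> ('l \<Rightarrow> 'g) \<Rightarrow> ('h, 'g, 'x) biset \<Rightarrow> 'x set" where
  "fixed_points L a b X = {x \<in> points X. \<forall>u\<in>L. action X (a u, b u) x = x}"

definition mark ::
    "'l set \<Rightarrow> ('l \<Rightarrow> 'h) \<Rightarrow> ('l \<Rightarrow> 'g) \<Rightarrow> ('h, 'g, 'x) biset \<Rightarrow> nat" where
  "mark L a b X = card (fixed_points L a b X)"

text \<open>Homomorphisms are counted below, so they have to be determined by their values on the carrier.\<close>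

definition homs :: "('l, 'q) monoid_scheme \<Rightarrow> ('h, 'n) monoid_scheme \<Rightarrow> ('l \<Rightarrow> 'h) set" where
  "homs L H = hom L H \<inter> extensional (carrier L)"

abbreviation conjugators ::
    "('h, 'n) monoid_scheme \<Rightarrow> ('l, 'q) monoid_scheme \<Rightarrow> ('l \<Rightarrow> 'h) \<Rightarrow> ('l \<Rightarrow> 'h) \<Rightarrow> 'h set" where
  "conjugators H L a c \<equiv>
     {h \<in> carrier H. \<forall>u\<in>carrier L. a u = h \<otimes>\<^bsub>H\<^esub> c u \<otimes>\<^bsub>H\<^esub> inv\<^bsub>H\<^esub> h}"

lemma homsD: "c \<in> homs L H \<Longrightarrow> c \<in> hom L H"
  by (simp add: homs_def)

lemma finite_homs:
  assumes "finite (carrier L)" "finite (carrier H)"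
  shows "finite (homs L H)"
proof (rule finite_subset)
  show "homs L H \<subseteq> carrier L \<rightarrow>\<^sub>E carrier H"
    by (auto simp: homs_def hom_def PiE_def)
qed (use assms in \<open>simp add: finite_PiE\<close>)

lemma restrict_homs:
  assumes "group L" "c \<in> hom L H"
  shows "restrict c (carrier L) \<in> homs L H"
  using assms group.is_monoid[OF assms(1)] by (auto simp: homs_def hom_def monoid.m_closed)

lemma homs_eqI: "c \<in> homs L H \<Longrightarrow> d \<in> homs L H' \<Longrightarrow> (\<And>u. u \<in> carrier L \<Longrightarrow> c u = d u) \<Longrightarrow> c = d"
  by (auto simp: homs_def intro: extensionalityI)

lemma mark_cong:
  assumes "\<And>u. u \<in> L \<Longrightarrow> a u = a' u" "\<And>u. u \<in> L \<Longrightarrow> b u = b' u"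
  shows "mark L a b X = mark L a' b' X"
  unfolding mark_def fixed_points_def using assms by simp

text \<open>This makes the homomorphisms in \<open>mark_tensor\<close> unique.\<close>

lemma left_free_cancel:
  assumes "group G" "group H" and X: "biset G H X" and "left_free G H X"
    and h: "h \<in> carrier H" "h' \<in> carrier H" and g: "g \<in> carrier G" and x: "x \<in> points X"
    and eq: "action X (h, g) x = action X (h', g) x"
  shows "h = h'"
proof -
  interpret G: group G by fact
  interpret H: group H by fact
  note X' = X[unfolded biset_iff[OF assms(1,2)]]
  have "action X (inv\<^bsub>H\<^esub> h' \<otimes>\<^bsub>H\<^esub> h, \<one>\<^bsub>G\<^esub>) x = action X (inv\<^bsub>H\<^esub> h', inv\<^bsub>G\<^esub> g) (action X (h, g) x)"
    using X' h g x by simp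
  also have "\<dots> = x" unfolding eq using X' h g x by simp
  finally have "inv\<^bsub>H\<^esub> h' \<otimes>\<^bsub>H\<^esub> h = \<one>\<^bsub>H\<^esub>"
    using assms(4) h x unfolding left_free_def by (meson H.inv_closed H.m_closed)
  then show ?thesis using h by (metis H.inv_closed H.inv_equality H.inv_inv)
qed

lemma mark_iso:
  assumes X: "biset G H X" "biset_iso G H X Y" and "group G" "group H"
    and a: "a \<in> L \<rightarrow> carrier H" "b \<in> L \<rightarrow> carrier G"
  shows "mark L a b X = mark L a b Y"
proof -
  obtain f where f: "bij_betw f (points X) (points Y)"
    "\<And>a x. a \<in> carrier (H \<times>\<times> G) \<Longrightarrow> x \<in> points X \<Longrightarrow> f (action X a x) = action Y a (f x)"
    using X(2) unfolding biset_iso_def by blast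
  have inj: "inj_on f (points X)" and im: "f ` points X = points Y"
    using f(1) by (auto simp: bij_betw_def)
  have eq: "action Y (a u, b u) (f x) = f x \<longleftrightarrow> action X (a u, b u) x = x"
    if "u \<in> L" "x \<in> points X" for u x
  proof -
    have m: "(a u, b u) \<in> carrier (H \<times>\<times> G)" using a that by auto
    then have "action X (a u, b u) x \<in> points X"
      using X(1) that unfolding biset_iff[OF assms(3,4)] by auto
    then show ?thesis
      unfolding f(2)[OF m that(2), symmetric] using inj that(2) by (auto dest: inj_onD)
  qed
  have "fixed_points L a b Y = f ` fixed_points L a b X"
  proof
    show "fixed_points L a b Y \<subseteq> f ` fixed_points L a b X"
      unfolding fixed_points_def im[symmetric] using eq by auto
    show "f ` fixed_points L a b X \<subseteq> fixed_points L a b Y"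
      unfolding fixed_points_def im[symmetric] using eq by auto
  qed
  then show ?thesis unfolding mark_def
    by (simp add: card_image inj_on_subset[OF inj] fixed_points_def)
qed

lemma mark_union:
  assumes "finite (points X)" "finite (points Y)"
  shows "mark L a b (biset_union X Y) = mark L a b X + mark L a b Y"
proof -
  have "fixed_points L a b (biset_union X Y) = fixed_points L a b X <+> fixed_points L a b Y"
    by (force simp: fixed_points_def biset_union_def)
  then show ?thesis
    unfolding mark_def using assms by (simp add: card_Plus fixed_points_def)
qed

text \<open>Translation by \<open>(h, g)\<close> carries the fixed points of a subgroup of \<open>H \<times> G\<close> to those of its
conjugate.\<close>

lemma mark_conj:
  assumes X: "biset G H X" and "group G" "group H"
    and a: "a \<in> L \<rightarrow> carrier H" "b \<in> L \<rightarrow> carrier G" and h: "h \<in> carrier H" and g: "g \<in> carrier G"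
  shows "mark L (\<lambda>u. h \<otimes>\<^bsub>H\<^esub> a u \<otimes>\<^bsub>H\<^esub> inv\<^bsub>H\<^esub> h) (\<lambda>u. g \<otimes>\<^bsub>G\<^esub> b u \<otimes>\<^bsub>G\<^esub> inv\<^bsub>G\<^esub> g) X = mark L a b X"
proof -
  interpret G: group G by fact
  interpret H: group H by fact
  note X' = X[unfolded biset_iff[OF assms(2,3)]]
  have aL: "\<And>u. u \<in> L \<Longrightarrow> a u \<in> carrier H" "\<And>u. u \<in> L \<Longrightarrow> b u \<in> carrier G" using a by auto
  let ?a' = "\<lambda>u. h \<otimes>\<^bsub>H\<^esub> a u \<otimes>\<^bsub>H\<^esub> inv\<^bsub>H\<^esub> h" and ?b' = "\<lambda>u. g \<otimes>\<^bsub>G\<^esub> b u \<otimes>\<^bsub>G\<^esub> inv\<^bsub>G\<^esub> g"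
  have comm: "action X (?a' u, ?b' u) (action X (h, g) x) = action X (h, g) (action X (a u, b u) x)"
    if "u \<in> L" "x \<in> points X" for u x
    using X' that aL h g by (simp add: H.m_assoc G.m_assoc)
  have cl: "action X (h, g) x \<in> points X" "action X (a u, b u) x \<in> points X"
    if "x \<in> points X" "u \<in> L" for x u
    using X' that aL h g by auto
  have bij: "bij_betw (action X (h, g)) (points X) (points X)"
    by (rule bij_betw_byWitness[where f' = "action X (inv\<^bsub>H\<^esub> h, inv\<^bsub>G\<^esub> g)"]) (use X' h g in auto)
  have iff: "action X (?a' u, ?b' u) (action X (h, g) x) = action X (h, g) x \<longleftrightarrow> action X (a u, b u) x = x"
    if "u \<in> L" "x \<in> points X" for u x
    using comm[OF that] cl[OF that(2,1)] that(2) inj_onD[OF bij_betw_imp_inj_on[OF bij]] by metis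
  have "fixed_points L ?a' ?b' X = action X (h, g) ` fixed_points L a b X"
    using iff bij_betw_imp_surj_on[OF bij] by (fastforce simp: fixed_points_def)
  moreover have "inj_on (action X (h, g)) (fixed_points L a b X)"
    using bij_betw_imp_inj_on[OF bij] by (rule inj_on_subset) (auto simp: fixed_points_def)
  ultimately show ?thesis unfolding mark_def by (simp add: card_image)
qed

section \<open>Marks of composites and of transitive bisets\<close>

text \<open>The class of \<open>(y, x)\<close> in \<open>Y \<times>\<^sub>H X\<close> is fixed by \<open>(a u, b u)\<close> iff some \<open>c u \<in> H\<close> satisfies
\<open>(a u, c u) y = y\<close> and \<open>(c u, b u) x = x\<close>. As \<open>X\<close> is left-free, \<open>c u\<close> is unique, so \<open>c\<close> is a
homomorphism. Counting the pairs over the fixed classes gives the left-hand side, since each class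
consists of \<open>|H|\<close> pairs, and counting them by \<open>c\<close> gives the right-hand side.\<close>

lemma (in biset_pair) mark_tensor:
  fixes L :: "('l, 'q) monoid_scheme"
  assumes L: "group L" "finite (carrier L)" and fH: "finite (carrier H)"
    and a: "a \<in> hom L K" and b: "b \<in> hom L G" and lf: "left_free G H X"
  shows "card (carrier H) * mark (carrier L) a b (biset_tensor G H K Y X) =
    (\<Sum>c\<in>homs L H. mark (carrier L) a c Y * mark (carrier L) c b X)"
proof -
  interpret L: group L by fact
  let ?T = "biset_tensor G H K Y X"
  let ?fix = "fixed_points (carrier L)"
  \<comment> \<open>\<open>W\<close> will turn out to be the set of all pairs in fixed classes, sorted by the homomorphism \<open>c\<close>.\<close>
  define W where "W = (\<Union>c\<in>homs L H. ?fix a c Y \<times> ?fix c b X)"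
  have aL: "\<And>u. u \<in> carrier L \<Longrightarrow> a u \<in> carrier K" "\<And>u. u \<in> carrier L \<Longrightarrow> b u \<in> carrier G"
    using a b by (auto simp: hom_def)
  note canc = left_free_cancel[OF G.is_group H.is_group X lf]
  have stab: "action ?T (a u, b u) (ob y x) = ob y x \<longleftrightarrow>
      (\<exists>k\<in>carrier H. action Y (a u, k) y = y \<and> action X (k, b u) x = x)"
    if u: "u \<in> carrier L" and yx: "y \<in> points Y" "x \<in> points X" for u y x
  proof -
    note au = aL[OF u]
    have "action ?T (a u, b u) (ob y x) = ob y x \<longleftrightarrow> (\<exists>h\<in>carrier H.
        action Y (a u, \<one>\<^bsub>H\<^esub>) y = action Y (\<one>\<^bsub>K\<^esub>, h) y \<and> action X (\<one>\<^bsub>H\<^esub>, b u) x = action X (h, \<one>\<^bsub>G\<^esub>) x)"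
      using au yx by (simp add: tensor_action ob_eq_iff Ycl Xcl)
    also have "\<dots> \<longleftrightarrow> (\<exists>h\<in>carrier H. action Y (a u, inv\<^bsub>H\<^esub> h) y = y \<and> action X (inv\<^bsub>H\<^esub> h, b u) x = x)"
    proof (rule bex_cong[OF refl])
      fix h assume h: "h \<in> carrier H"
      have "action Y (a u, \<one>\<^bsub>H\<^esub>) y = action Y (\<one>\<^bsub>K\<^esub>, h) y \<longleftrightarrow>
         action Y (\<one>\<^bsub>K\<^esub>, h) (action Y (a u, inv\<^bsub>H\<^esub> h) y) = action Y (\<one>\<^bsub>K\<^esub>, h) y"
        using h au yx by (simp add: Ymul)
      also have "\<dots> \<longleftrightarrow> action Y (a u, inv\<^bsub>H\<^esub> h) y = y"
      proof
        assume "action Y (\<one>\<^bsub>K\<^esub>, h) (action Y (a u, inv\<^bsub>H\<^esub> h) y) = action Y (\<one>\<^bsub>K\<^esub>, h) y"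
        then have "action Y (\<one>\<^bsub>K\<^esub>, inv\<^bsub>H\<^esub> h) (action Y (\<one>\<^bsub>K\<^esub>, h) (action Y (a u, inv\<^bsub>H\<^esub> h) y)) =
          action Y (\<one>\<^bsub>K\<^esub>, inv\<^bsub>H\<^esub> h) (action Y (\<one>\<^bsub>K\<^esub>, h) y)" by simp
        then show "action Y (a u, inv\<^bsub>H\<^esub> h) y = y"
          using h au yx by (simp add: Ymul Ycl Yone)
      qed simp
      finally have 1: "action Y (a u, \<one>\<^bsub>H\<^esub>) y = action Y (\<one>\<^bsub>K\<^esub>, h) y \<longleftrightarrow> action Y (a u, inv\<^bsub>H\<^esub> h) y = y" .
      have "action X (\<one>\<^bsub>H\<^esub>, b u) x = action X (h, \<one>\<^bsub>G\<^esub>) x \<longleftrightarrow>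
         action X (h, \<one>\<^bsub>G\<^esub>) (action X (inv\<^bsub>H\<^esub> h, b u) x) = action X (h, \<one>\<^bsub>G\<^esub>) x"
        using h au yx by (simp add: Xmul)
      also have "\<dots> \<longleftrightarrow> action X (inv\<^bsub>H\<^esub> h, b u) x = x"
      proof
        assume "action X (h, \<one>\<^bsub>G\<^esub>) (action X (inv\<^bsub>H\<^esub> h, b u) x) = action X (h, \<one>\<^bsub>G\<^esub>) x"
        then have "action X (inv\<^bsub>H\<^esub> h, \<one>\<^bsub>G\<^esub>) (action X (h, \<one>\<^bsub>G\<^esub>) (action X (inv\<^bsub>H\<^esub> h, b u) x)) =
          action X (inv\<^bsub>H\<^esub> h, \<one>\<^bsub>G\<^esub>) (action X (h, \<one>\<^bsub>G\<^esub>) x)" by simp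
        then show "action X (inv\<^bsub>H\<^esub> h, b u) x = x"
          using h au yx by (simp add: Xmul Xcl Xone)
      qed simp
      finally show "(action Y (a u, \<one>\<^bsub>H\<^esub>) y = action Y (\<one>\<^bsub>K\<^esub>, h) y \<and>
          action X (\<one>\<^bsub>H\<^esub>, b u) x = action X (h, \<one>\<^bsub>G\<^esub>) x) =
         (action Y (a u, inv\<^bsub>H\<^esub> h) y = y \<and> action X (inv\<^bsub>H\<^esub> h, b u) x = x)" using 1 by simp
    qed
    also have "\<dots> \<longleftrightarrow> (\<exists>k\<in>carrier H. action Y (a u, k) y = y \<and> action X (k, b u) x = x)"
      by (metis H.inv_closed H.inv_inv)
    finally show ?thesis .
  qed
  have W_iff: "(y, x) \<in> W \<longleftrightarrow> ob y x \<in> ?fix a b ?T" if yx: "y \<in> points Y" "x \<in> points X" for y x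
  proof
    assume "(y, x) \<in> W"
    then obtain c where c: "c \<in> homs L H" "y \<in> ?fix a c Y" "x \<in> ?fix c b X" by (auto simp: W_def)
    have "c u \<in> carrier H" if "u \<in> carrier L" for u
      using c(1) that by (auto simp: homs_def hom_def)
    then show "ob y x \<in> ?fix a b ?T"
      using c(2,3) yx stab[OF _ yx] unfolding fixed_points_def points_tensor by blast
  next
    assume "ob y x \<in> ?fix a b ?T"
    then have "\<forall>u\<in>carrier L. \<exists>k. k \<in> carrier H \<and> action Y (a u, k) y = y \<and> action X (k, b u) x = x"
      using stab[OF _ yx] by (auto simp: fixed_points_def)
    then obtain c where c: "\<And>u. u \<in> carrier L \<Longrightarrow> c u \<in> carrier H"
        "\<And>u. u \<in> carrier L \<Longrightarrow> action Y (a u, c u) y = y"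
        "\<And>u. u \<in> carrier L \<Longrightarrow> action X (c u, b u) x = x"
      by metis
    \<comment> \<open>Left freeness makes the element \<open>c u\<close> unique, hence multiplicative in \<open>u\<close>.\<close>
    have "c (u \<otimes>\<^bsub>L\<^esub> v) = c u \<otimes>\<^bsub>H\<^esub> c v" if u: "u \<in> carrier L" "v \<in> carrier L" for u v
    proof (rule canc[where x = x and g = "b (u \<otimes>\<^bsub>L\<^esub> v)"])
      have "action X (c u \<otimes>\<^bsub>H\<^esub> c v, b (u \<otimes>\<^bsub>L\<^esub> v)) x = action X (c u, b u) (action X (c v, b v) x)"
        using u c(1) aL yx b by (simp add: Xmul hom_mult)
      then show "action X (c (u \<otimes>\<^bsub>L\<^esub> v), b (u \<otimes>\<^bsub>L\<^esub> v)) x = action X (c u \<otimes>\<^bsub>H\<^esub> c v, b (u \<otimes>\<^bsub>L\<^esub> v)) x"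
        using u c(3) by simp
    qed (use u c(1) aL yx in auto)
    then have "restrict c (carrier L) \<in> homs L H"
      using c(1) by (intro restrict_homs L) (auto simp: hom_def)
    moreover have "y \<in> ?fix a (restrict c (carrier L)) Y" "x \<in> ?fix (restrict c (carrier L)) b X"
      using c yx by (auto simp: fixed_points_def)
    ultimately show "(y, x) \<in> W" unfolding W_def by blast
  qed
  have Wsub: "W \<subseteq> points Y \<times> points X" by (auto simp: W_def fixed_points_def)
  have finW: "finite W" using Wsub by (rule finite_subset) (simp add: Xfin Yfin)
  have fixT: "?fix a b ?T \<subseteq> {ob y x | y x. y \<in> points Y \<and> x \<in> points X}"
    by (auto simp: fixed_points_def points_tensor)
  have un: "\<Union> (?fix a b ?T) = W"
  proof (intro equalityI subsetI)
    fix z assume "z \<in> \<Union> (?fix a b ?T)"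
    then obtain y x where yx: "y \<in> points Y" "x \<in> points X" "ob y x \<in> ?fix a b ?T" "z \<in> ob y x"
      using fixT by blast
    obtain y' x' where z: "z = (y', x')" by (cases z)
    then have "y' \<in> points Y" "x' \<in> points X" "ob y' x' = ob y x"
      using ob_sub[OF yx(1,2)] ob_cong[OF yx(1,2)] yx(4) by auto
    then show "z \<in> W" using W_iff yx(3) z by simp
  next
    fix z assume z: "z \<in> W"
    then obtain y x where "z = (y, x)" "y \<in> points Y" "x \<in> points X" using Wsub by auto
    then show "z \<in> \<Union> (?fix a b ?T)" using W_iff ob_self z by blast
  qed
  have "card (carrier H) * card (?fix a b ?T) = card (\<Union> (?fix a b ?T))"
  proof (rule card_partition)
    have "finite (points ?T)" using biset_tensor by (simp add: biset_def)
    then show "finite (?fix a b ?T)" by (simp add: fixed_points_def)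
    show "finite (\<Union> (?fix a b ?T))" by (simp add: un finW)
    show "card C = card (carrier H)" if C: "C \<in> ?fix a b ?T" for C
    proof -
      obtain y x where yx: "y \<in> points Y" "x \<in> points X" "C = ob y x" using fixT C by blast
      have "inj_on (\<lambda>h. (action Y (\<one>\<^bsub>K\<^esub>, h) y, action X (h, \<one>\<^bsub>G\<^esub>) x)) (carrier H)"
        by (intro inj_onI canc[where x = x and g = "\<one>\<^bsub>G\<^esub>"]) (use yx in auto)
      then show ?thesis by (simp add: yx(3) ob_image card_image)
    qed
    show "C \<inter> C' = {}" if CC: "C \<in> ?fix a b ?T" "C' \<in> ?fix a b ?T" "C \<noteq> C'" for C C'
    proof -
      obtain y x y' x' where yx: "y \<in> points Y" "x \<in> points X" "C = ob y x"
        "y' \<in> points Y" "x' \<in> points X" "C' = ob y' x'" using fixT CC(1,2) by blast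
      have "z \<notin> C'" if "z \<in> C" for z
        using that ob_cong[OF yx(1,2)] ob_cong[OF yx(4,5)] CC(3) unfolding yx(3,6) by (cases z) metis
      then show ?thesis by blast
    qed
  qed
  also have "card (\<Union> (?fix a b ?T)) = (\<Sum>c\<in>homs L H. card (?fix a c Y \<times> ?fix c b X))"
    unfolding un W_def
  proof (rule card_UN_disjoint[OF finite_homs[OF L(2) fH]])
    show "\<forall>c\<in>homs L H. finite (?fix a c Y \<times> ?fix c b X)"
      using Xfin Yfin by (simp add: fixed_points_def)
    show "\<forall>c\<in>homs L H. \<forall>d\<in>homs L H. c \<noteq> d \<longrightarrow>
        (?fix a c Y \<times> ?fix c b X) \<inter> (?fix a d Y \<times> ?fix d b X) = {}"
    proof (intro ballI impI)
      fix c d assume cd: "c \<in> homs L H" "d \<in> homs L H" "c \<noteq> d"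
      have "c = d" if x: "x \<in> ?fix c b X" "x \<in> ?fix d b X" for x
      proof (rule homs_eqI[OF cd(1,2)])
        fix u assume u: "u \<in> carrier L"
        show "c u = d u"
          by (rule canc[where x = x and g = "b u"])
            (use u x cd(1,2) aL in \<open>auto simp: homs_def hom_def fixed_points_def\<close>)
      qed
      then show "(?fix a c Y \<times> ?fix c b X) \<inter> (?fix a d Y \<times> ?fix d b X) = {}" using cd(3) by blast
    qed
  qed
  finally show ?thesis by (simp add: mark_def card_cartesian_product)
qed

lemma finite_coset_biset:
  assumes "finite (carrier G)" "finite (carrier H)"
  shows "finite (points (coset_biset G H P \<beta>))"
  using assms by (simp add: coset_biset_def LCOSETS_def)

lemma twisted_diagonal_subgroup:
  assumes "group G" "group H" "subgroup P G" "\<beta> \<in> hom (G\<lparr>carrier := P\<rparr>) H"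
  shows "subgroup (twisted_diagonal P \<beta>) (H \<times>\<times> G)"
proof -
  interpret G: group G by fact
  interpret H: group H by fact
  interpret P: subgroup P G by fact
  interpret GP: group "G\<lparr>carrier := P\<rparr>" by (rule P.subgroup_is_group[OF assms(1)])
  interpret \<beta>: group_hom "G\<lparr>carrier := P\<rparr>" H \<beta>
    by (simp add: group_hom_def group_hom_axioms_def assms GP.is_group)
  interpret D: group "H \<times>\<times> G" by (rule DirProd_group[OF assms(2,1)])
  show ?thesis
  proof (rule D.subgroupI)
    show "twisted_diagonal P \<beta> \<subseteq> carrier (H \<times>\<times> G)"
      using \<beta>.hom_closed P.subset by (auto simp: twisted_diagonal_def)
    show "twisted_diagonal P \<beta> \<noteq> {}" using P.one_closed unfolding twisted_diagonal_def by blast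
    show "inv\<^bsub>H \<times>\<times> G\<^esub> z \<in> twisted_diagonal P \<beta>" if "z \<in> twisted_diagonal P \<beta>" for z
    proof -
      obtain u where u: "u \<in> P" "z = (\<beta> u, u)" using \<open>z \<in> _\<close> by (auto simp: twisted_diagonal_def)
      have "inv\<^bsub>G\<^esub> u = inv\<^bsub>G\<lparr>carrier := P\<rparr>\<^esub> u"
        using G.m_inv_consistent[OF assms(3) u(1)] by simp
      then have "\<beta> (inv\<^bsub>G\<^esub> u) = inv\<^bsub>H\<^esub> \<beta> u" using \<beta>.hom_inv u by simp
      then show ?thesis
        using u P.mem_carrier[OF u(1)] \<beta>.hom_closed[of u] P.m_inv_closed[OF u(1)]
        by (simp add: twisted_diagonal_def inv_DirProd[OF assms(2,1)])
    qed
    show "z \<otimes>\<^bsub>H \<times>\<times> G\<^esub> w \<in> twisted_diagonal P \<beta>"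
      if zw: "z \<in> twisted_diagonal P \<beta>" "w \<in> twisted_diagonal P \<beta>" for z w
    proof -
      obtain u v where uv: "u \<in> P" "v \<in> P" "z = (\<beta> u, u)" "w = (\<beta> v, v)"
        using zw by (auto simp: twisted_diagonal_def)
      then have "z \<otimes>\<^bsub>H \<times>\<times> G\<^esub> w = (\<beta> (u \<otimes>\<^bsub>G\<^esub> v), u \<otimes>\<^bsub>G\<^esub> v)"
        using \<beta>.hom_mult[of u v] by simp
      then show ?thesis using P.m_closed[OF uv(1,2)] by (auto simp: twisted_diagonal_def)
    qed
  qed
qed

lemma left_free_coset_biset:
  assumes "group G" "group H" "subgroup P G" "\<beta> \<in> hom (G\<lparr>carrier := P\<rparr>) H"
  shows "left_free G H (coset_biset G H P \<beta>)"
  unfolding left_free_def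
proof (intro ballI impI)
  fix h C assume h: "h \<in> carrier H" and C: "C \<in> points (coset_biset G H P \<beta>)"
    and fx: "action (coset_biset G H P \<beta>) (h, \<one>\<^bsub>G\<^esub>) C = C"
  interpret G: group G by fact
  interpret H: group H by fact
  interpret D: group "H \<times>\<times> G" by (rule DirProd_group[OF assms(2,1)])
  have sg: "subgroup (twisted_diagonal P \<beta>) (H \<times>\<times> G)" by (rule twisted_diagonal_subgroup[OF assms])
  interpret T: subgroup "twisted_diagonal P \<beta>" "H \<times>\<times> G" by (rule sg)
  obtain k g where kg: "k \<in> carrier H" "g \<in> carrier G"
      "C = (k, g) <#\<^bsub>H \<times>\<times> G\<^esub> twisted_diagonal P \<beta>"
    using C by (auto simp: coset_biset_def LCOSETS_def)
  have "(h \<otimes>\<^bsub>H\<^esub> k, g) \<in> (h, \<one>\<^bsub>G\<^esub>) <#\<^bsub>H \<times>\<times> G\<^esub> C"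
    using D.lcos_self[OF _ sg, of "(k, g)"] kg h by (force simp: l_coset_def)
  also have "\<dots> = C" using fx C by (simp add: coset_biset_def)
  finally have "inv\<^bsub>H \<times>\<times> G\<^esub> (k, g) \<otimes>\<^bsub>H \<times>\<times> G\<^esub> (h \<otimes>\<^bsub>H\<^esub> k, g) \<in> twisted_diagonal P \<beta>"
    unfolding kg(3) by (intro T.lcos_module_imp[OF D.is_group]) (use kg in auto)
  then have "inv\<^bsub>H\<^esub> k \<otimes>\<^bsub>H\<^esub> (h \<otimes>\<^bsub>H\<^esub> k) = \<beta> \<one>\<^bsub>G\<^esub>"
    using kg h by (auto simp: twisted_diagonal_def inv_DirProd[OF assms(2,1)])
  also have "\<beta> \<one>\<^bsub>G\<^esub> = \<one>\<^bsub>H\<^esub>"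
    using hom_one[OF assms(4) subgroup.subgroup_is_group[OF assms(3,1)] assms(2)] by simp
  finally have e: "inv\<^bsub>H\<^esub> k \<otimes>\<^bsub>H\<^esub> (h \<otimes>\<^bsub>H\<^esub> k) = \<one>\<^bsub>H\<^esub>" .
  have "h = k \<otimes>\<^bsub>H\<^esub> (inv\<^bsub>H\<^esub> k \<otimes>\<^bsub>H\<^esub> (h \<otimes>\<^bsub>H\<^esub> k)) \<otimes>\<^bsub>H\<^esub> inv\<^bsub>H\<^esub> k"
    using kg(1) h by (simp add: H.m_assoc[symmetric]) (simp add: H.m_assoc)
  then show "h = \<one>\<^bsub>H\<^esub>" unfolding e using kg(1) by simp
qed

text \<open>The coset of \<open>(h, g)\<close> is fixed by \<open>(a u, b u)\<close> iff \<open>a u = h \<beta>(c u) h\<inverse>\<close> and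
\<open>b u = g (c u) g\<inverse>\<close> for some \<open>c u \<in> P\<close>, which is determined by \<open>g\<close> and \<open>b\<close>. So the pairs
\<open>(h, g)\<close> in fixed cosets, \<open>|P|\<close> for each coset, are sorted by the homomorphism \<open>c: L \<rightarrow> P\<close>.\<close>

lemma mark_coset_biset:
  fixes L :: "('l, 'q) monoid_scheme"
  assumes G: "group G" "group H" "finite (carrier G)" "finite (carrier H)"
    and P: "subgroup P G" "\<beta> \<in> hom (G\<lparr>carrier := P\<rparr>) H"
    and L: "group L" "finite (carrier L)" and a: "a \<in> hom L H" "b \<in> hom L G"
  shows "card P * mark (carrier L) a b (coset_biset G H P \<beta>) =
    (\<Sum>c\<in>homs L (G\<lparr>carrier := P\<rparr>).
       card (conjugators H L a (\<lambda>u. \<beta> (c u))) *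
       card (conjugators G L b c))"
proof -
  interpret G: group G by fact
  interpret H: group H by fact
  interpret L: group L by fact
  interpret P: subgroup P G by fact
  interpret D: group "H \<times>\<times> G" by (rule DirProd_group[OF assms(2,1)])
  let ?D = "twisted_diagonal P \<beta>"
  let ?X = "coset_biset G H P \<beta>"
  have sg: "subgroup ?D (H \<times>\<times> G)" by (rule twisted_diagonal_subgroup[OF G(1,2) P])
  interpret T: subgroup ?D "H \<times>\<times> G" by (rule sg)
  have \<beta>P: "\<And>u. u \<in> P \<Longrightarrow> \<beta> u \<in> carrier H" using P(2) by (auto simp: hom_def)
  have aL: "\<And>u. u \<in> carrier L \<Longrightarrow> a u \<in> carrier H" "\<And>u. u \<in> carrier L \<Longrightarrow> b u \<in> carrier G"
    using a by (auto simp: hom_def)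
  define A where "A c = conjugators H L a (\<lambda>u. \<beta> (c u))" for c
  define B where "B c = conjugators G L b c" for c :: "'l \<Rightarrow> _"
  define W where "W = (\<Union>c\<in>homs L (G\<lparr>carrier := P\<rparr>). A c \<times> B c)"
  let ?fix = "fixed_points (carrier L) a b ?X"
  have stab: "(a u, b u) <#\<^bsub>H \<times>\<times> G\<^esub> ((h, g) <#\<^bsub>H \<times>\<times> G\<^esub> ?D) = (h, g) <#\<^bsub>H \<times>\<times> G\<^esub> ?D \<longleftrightarrow>
      (\<exists>v\<in>P. a u = h \<otimes>\<^bsub>H\<^esub> \<beta> v \<otimes>\<^bsub>H\<^esub> inv\<^bsub>H\<^esub> h \<and> b u = g \<otimes>\<^bsub>G\<^esub> v \<otimes>\<^bsub>G\<^esub> inv\<^bsub>G\<^esub> g)"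
    if u: "u \<in> carrier L" and hg: "h \<in> carrier H" "g \<in> carrier G" for u h g
  proof -
    note au = aL[OF u]
    have "(a u, b u) <#\<^bsub>H \<times>\<times> G\<^esub> ((h, g) <#\<^bsub>H \<times>\<times> G\<^esub> ?D) =
        (a u \<otimes>\<^bsub>H\<^esub> h, b u \<otimes>\<^bsub>G\<^esub> g) <#\<^bsub>H \<times>\<times> G\<^esub> ?D"
      using D.lcos_m_assoc[OF T.subset, of "(a u, b u)" "(h, g)"] au hg by simp
    moreover have "(a u \<otimes>\<^bsub>H\<^esub> h, b u \<otimes>\<^bsub>G\<^esub> g) <#\<^bsub>H \<times>\<times> G\<^esub> ?D = (h, g) <#\<^bsub>H \<times>\<times> G\<^esub> ?D \<longleftrightarrow>
        (a u \<otimes>\<^bsub>H\<^esub> h, b u \<otimes>\<^bsub>G\<^esub> g) \<in> (h, g) <#\<^bsub>H \<times>\<times> G\<^esub> ?D"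
      using D.lcos_self[OF _ sg, of "(a u \<otimes>\<^bsub>H\<^esub> h, b u \<otimes>\<^bsub>G\<^esub> g)"]
        D.l_repr_independence[OF _ _ sg, of "(a u \<otimes>\<^bsub>H\<^esub> h, b u \<otimes>\<^bsub>G\<^esub> g)" "(h, g)"] au hg by auto
    moreover have "\<dots> \<longleftrightarrow> (\<exists>v\<in>P. a u \<otimes>\<^bsub>H\<^esub> h = h \<otimes>\<^bsub>H\<^esub> \<beta> v \<and> b u \<otimes>\<^bsub>G\<^esub> g = g \<otimes>\<^bsub>G\<^esub> v)"
      by (force simp: l_coset_def twisted_diagonal_def)
    moreover have "a u \<otimes>\<^bsub>H\<^esub> h = h \<otimes>\<^bsub>H\<^esub> \<beta> v \<longleftrightarrow> a u = h \<otimes>\<^bsub>H\<^esub> \<beta> v \<otimes>\<^bsub>H\<^esub> inv\<^bsub>H\<^esub> h"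
        "b u \<otimes>\<^bsub>G\<^esub> g = g \<otimes>\<^bsub>G\<^esub> v \<longleftrightarrow> b u = g \<otimes>\<^bsub>G\<^esub> v \<otimes>\<^bsub>G\<^esub> inv\<^bsub>G\<^esub> g" if "v \<in> P" for v
      using that au hg \<beta>P[OF that] P.mem_carrier[OF that] H.inv_solve_right G.inv_solve_right
      by (metis H.m_closed, metis G.m_closed)
    ultimately show ?thesis by simp
  qed
  have conjG: "v = w" if "v \<in> carrier G" "w \<in> carrier G" "g \<in> carrier G"
    "g \<otimes>\<^bsub>G\<^esub> v \<otimes>\<^bsub>G\<^esub> inv\<^bsub>G\<^esub> g = g \<otimes>\<^bsub>G\<^esub> w \<otimes>\<^bsub>G\<^esub> inv\<^bsub>G\<^esub> g" for v w g
    using that by simp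
  have W_iff: "(h, g) \<in> W \<longleftrightarrow> (h, g) <#\<^bsub>H \<times>\<times> G\<^esub> ?D \<in> ?fix"
    if hg: "h \<in> carrier H" "g \<in> carrier G" for h g
  proof -
    have in_pts: "(h, g) <#\<^bsub>H \<times>\<times> G\<^esub> ?D \<in> points ?X"
      using hg by (auto simp: coset_biset_def LCOSETS_def)
    have fix_iff: "(h, g) <#\<^bsub>H \<times>\<times> G\<^esub> ?D \<in> ?fix \<longleftrightarrow>
      (\<forall>u\<in>carrier L. \<exists>v\<in>P. a u = h \<otimes>\<^bsub>H\<^esub> \<beta> v \<otimes>\<^bsub>H\<^esub> inv\<^bsub>H\<^esub> h \<and> b u = g \<otimes>\<^bsub>G\<^esub> v \<otimes>\<^bsub>G\<^esub> inv\<^bsub>G\<^esub> g)"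
      using stab hg in_pts by (auto simp: fixed_points_def coset_biset_def)
    show ?thesis unfolding fix_iff
    proof
      assume "(h, g) \<in> W"
      then show "\<forall>u\<in>carrier L. \<exists>v\<in>P. a u = h \<otimes>\<^bsub>H\<^esub> \<beta> v \<otimes>\<^bsub>H\<^esub> inv\<^bsub>H\<^esub> h \<and> b u = g \<otimes>\<^bsub>G\<^esub> v \<otimes>\<^bsub>G\<^esub> inv\<^bsub>G\<^esub> g"
        unfolding W_def A_def B_def homs_def hom_def by force
    next
      assume "\<forall>u\<in>carrier L. \<exists>v\<in>P. a u = h \<otimes>\<^bsub>H\<^esub> \<beta> v \<otimes>\<^bsub>H\<^esub> inv\<^bsub>H\<^esub> h \<and> b u = g \<otimes>\<^bsub>G\<^esub> v \<otimes>\<^bsub>G\<^esub> inv\<^bsub>G\<^esub> g"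
      then obtain c where c: "\<And>u. u \<in> carrier L \<Longrightarrow> c u \<in> P"
        "\<And>u. u \<in> carrier L \<Longrightarrow> a u = h \<otimes>\<^bsub>H\<^esub> \<beta> (c u) \<otimes>\<^bsub>H\<^esub> inv\<^bsub>H\<^esub> h"
        "\<And>u. u \<in> carrier L \<Longrightarrow> b u = g \<otimes>\<^bsub>G\<^esub> c u \<otimes>\<^bsub>G\<^esub> inv\<^bsub>G\<^esub> g" by metis
      have "c (u \<otimes>\<^bsub>L\<^esub> v) = c u \<otimes>\<^bsub>G\<^esub> c v" if u: "u \<in> carrier L" "v \<in> carrier L" for u v
      proof (rule conjG[OF _ _ hg(2)])
        note cu = c(1)[OF u(1)] c(1)[OF u(2)] 
        note cG = cu[THEN P.mem_carrier]
        have "g \<otimes>\<^bsub>G\<^esub> c (u \<otimes>\<^bsub>L\<^esub> v) \<otimes>\<^bsub>G\<^esub> inv\<^bsub>G\<^esub> g = b u \<otimes>\<^bsub>G\<^esub> b v"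
          using c(3)[of "u \<otimes>\<^bsub>L\<^esub> v"] u a(2) by (simp add: hom_mult)
        also have "\<dots> = (g \<otimes>\<^bsub>G\<^esub> c u) \<otimes>\<^bsub>G\<^esub> (inv\<^bsub>G\<^esub> g \<otimes>\<^bsub>G\<^esub> (g \<otimes>\<^bsub>G\<^esub> (c v \<otimes>\<^bsub>G\<^esub> inv\<^bsub>G\<^esub> g)))"
          using c(3) u cG hg by (simp add: G.m_assoc)
        also have "\<dots> = g \<otimes>\<^bsub>G\<^esub> (c u \<otimes>\<^bsub>G\<^esub> c v) \<otimes>\<^bsub>G\<^esub> inv\<^bsub>G\<^esub> g"
          using cG hg by (simp add: G.m_assoc[symmetric])
        finally show "g \<otimes>\<^bsub>G\<^esub> c (u \<otimes>\<^bsub>L\<^esub> v) \<otimes>\<^bsub>G\<^esub> inv\<^bsub>G\<^esub> g = g \<otimes>\<^bsub>G\<^esub> (c u \<otimes>\<^bsub>G\<^esub> c v) \<otimes>\<^bsub>G\<^esub> inv\<^bsub>G\<^esub> g" .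
      qed (use u c(1) P.mem_carrier in auto)
      then have "restrict c (carrier L) \<in> homs L (G\<lparr>carrier := P\<rparr>)"
        using c(1) by (intro restrict_homs L) (auto simp: hom_def)
      moreover have "h \<in> A (restrict c (carrier L))" "g \<in> B (restrict c (carrier L))"
        using c hg by (auto simp: A_def B_def)
      ultimately show "(h, g) \<in> W" unfolding W_def by blast
    qed
  qed
  have Wsub: "W \<subseteq> carrier H \<times> carrier G" by (auto simp: W_def A_def B_def)
  have finW: "finite W" using Wsub by (rule finite_subset) (simp add: G)
  have fixT: "?fix \<subseteq> {(h, g) <#\<^bsub>H \<times>\<times> G\<^esub> ?D | h g. h \<in> carrier H \<and> g \<in> carrier G}"
    by (auto simp: fixed_points_def coset_biset_def LCOSETS_def)
  have un: "\<Union> ?fix = W"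
  proof (intro equalityI subsetI)
    fix z assume "z \<in> \<Union> ?fix"
    then obtain h g where hg: "h \<in> carrier H" "g \<in> carrier G" "(h, g) <#\<^bsub>H \<times>\<times> G\<^esub> ?D \<in> ?fix"
        "z \<in> (h, g) <#\<^bsub>H \<times>\<times> G\<^esub> ?D"
      using fixT by blast
    obtain h' g' where z: "z = (h', g')" by (cases z)
    have "z \<in> carrier (H \<times>\<times> G)" using T.elemlcos_carrier[OF D.is_group _ hg(4)] hg by auto
    then have h': "h' \<in> carrier H" "g' \<in> carrier G" using z by auto
    have "(h', g') <#\<^bsub>H \<times>\<times> G\<^esub> ?D = (h, g) <#\<^bsub>H \<times>\<times> G\<^esub> ?D"
      using D.l_repr_independence[OF hg(4) _ sg] hg z by auto
    then show "z \<in> W" using W_iff[OF h'] hg(3) z by simp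
  next
    fix z assume z: "z \<in> W"
    then obtain h g where hg: "z = (h, g)" "h \<in> carrier H" "g \<in> carrier G" using Wsub by auto
    moreover have "(h, g) \<in> (h, g) <#\<^bsub>H \<times>\<times> G\<^esub> ?D" using D.lcos_self[OF _ sg] hg by auto
    ultimately show "z \<in> \<Union> ?fix" using W_iff z by blast
  qed
  have "card P * card ?fix = card (\<Union> ?fix)"
  proof (rule card_partition)
    show "finite ?fix" using finite_coset_biset[OF G(3,4)] by (simp add: fixed_points_def)
    show "finite (\<Union> ?fix)" by (simp add: un finW)
    have "?D = (\<lambda>u. (\<beta> u, u)) ` P" by (auto simp: twisted_diagonal_def)
    then have cD: "card ?D = card P" by (simp add: card_image inj_on_def)
    show "card C = card P" if C: "C \<in> ?fix" for C
    proof -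
      obtain h g where "h \<in> carrier H" "g \<in> carrier G" "C = (h, g) <#\<^bsub>H \<times>\<times> G\<^esub> ?D" using fixT C by blast
      then have "C \<in> lcosets\<^bsub>H \<times>\<times> G\<^esub> ?D" by (auto simp: LCOSETS_def)
      then show ?thesis using D.l_card_cosets_equal[of C ?D] T.subset G(3,4) cD by simp
    qed
    show "C \<inter> C' = {}" if CC: "C \<in> ?fix" "C' \<in> ?fix" "C \<noteq> C'" for C C'
    proof -
      have "C \<in> lcosets\<^bsub>H \<times>\<times> G\<^esub> ?D" "C' \<in> lcosets\<^bsub>H \<times>\<times> G\<^esub> ?D"
        using CC(1,2) by (auto simp: fixed_points_def coset_biset_def)
      then show ?thesis using D.lcos_disjoint[OF sg] CC(3) by blast
    qed
  qed
  also have "card (\<Union> ?fix) = (\<Sum>c\<in>homs L (G\<lparr>carrier := P\<rparr>). card (A c \<times> B c))"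
    unfolding un W_def
  proof (rule card_UN_disjoint)
    have "finite P" using P.subset G(3) by (rule finite_subset)
    then show "finite (homs L (G\<lparr>carrier := P\<rparr>))" by (intro finite_homs) (simp_all add: L)
    show "\<forall>c\<in>homs L (G\<lparr>carrier := P\<rparr>). finite (A c \<times> B c)"
      using G(3,4) by (simp add: A_def B_def)
    show "\<forall>c\<in>homs L (G\<lparr>carrier := P\<rparr>). \<forall>d\<in>homs L (G\<lparr>carrier := P\<rparr>). c \<noteq> d \<longrightarrow>
        (A c \<times> B c) \<inter> (A d \<times> B d) = {}"
    proof (intro ballI impI)
      fix c d assume cd: "c \<in> homs L (G\<lparr>carrier := P\<rparr>)" "d \<in> homs L (G\<lparr>carrier := P\<rparr>)" "c \<noteq> d"
      have cP: "c u \<in> P" "d u \<in> P" if "u \<in> carrier L" for u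
        using cd(1,2) that by (auto simp: homs_def hom_def)
      have "c = d" if g: "g \<in> B c" "g \<in> B d" for g
      proof (rule homs_eqI[OF cd(1,2)])
        fix u assume u: "u \<in> carrier L"
        show "c u = d u"
          by (rule conjG[of _ _ g]) (use u g cP P.mem_carrier in \<open>auto simp: B_def\<close>)
      qed
      then show "(A c \<times> B c) \<inter> (A d \<times> B d) = {}" using cd(3) by blast
    qed
  qed
  finally show ?thesis by (simp add: mark_def card_cartesian_product A_def B_def)
qed

section \<open>Marks on the Grothendieck group\<close>

definition linear_ext :: "(('h, 'g) nbiset \<Rightarrow> rat) \<Rightarrow> ('h, 'g) biset_comb \<Rightarrow> rat" where
  "linear_ext f x = (\<Sum>B\<in>Poly_Mapping.keys x. Poly_Mapping.lookup x B * f B)"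

lemma linear_ext_superset:
  "finite A \<Longrightarrow> Poly_Mapping.keys x \<subseteq> A \<Longrightarrow> linear_ext f x = (\<Sum>B\<in>A. Poly_Mapping.lookup x B * f B)"
  unfolding linear_ext_def by (rule sum.mono_neutral_left) (auto simp: in_keys_iff)

lemma linear_ext_0 [simp]: "linear_ext f 0 = 0"
  by (simp add: linear_ext_def)

lemma linear_ext_diff: "linear_ext f (x - y) = linear_ext f x - linear_ext f y"
proof -
  have "Poly_Mapping.keys (x - y) \<subseteq> Poly_Mapping.keys x \<union> Poly_Mapping.keys y"
    by (auto simp: in_keys_iff lookup_minus)
  then show ?thesis
    by (simp add: linear_ext_superset[of "Poly_Mapping.keys x \<union> Poly_Mapping.keys y"] lookup_minus
      left_diff_distrib sum_subtractf)
qed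

lemma linear_ext_add: "linear_ext f (x + y) = linear_ext f x + linear_ext f y"
  using linear_ext_diff[of f "x + y" y] by simp

lemma linear_ext_single [simp]: "linear_ext f (Poly_Mapping.single B c) = c * f B"
  by (simp add: linear_ext_superset[of "{B}"])

lemma linear_ext_sum: "linear_ext f (\<Sum>i\<in>I. x i) = (\<Sum>i\<in>I. linear_ext f (x i))"
  by (induction I rule: infinite_finite_induct) (simp_all add: linear_ext_add)

lemma linear_ext_rels:
  assumes iso: "\<And>X Y. biset G H X \<Longrightarrow> biset G H Y \<Longrightarrow> biset_iso G H X Y \<Longrightarrow> f X = f Y"
    and add: "\<And>X Y. biset G H X \<Longrightarrow> biset G H Y \<Longrightarrow> f (nat_copy (biset_union X Y)) = f X + f Y"
    and r: "r \<in> biset_rels p G H"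
  shows "linear_ext f r = 0"
  using r
proof induction
  case zero
  show ?case by simp
next
  case (iso X Y c r)
  then show ?case using assms(1) by (simp add: linear_ext_add linear_ext_diff)
next
  case (union X Y c r)
  then show ?case using add by (simp add: linear_ext_add linear_ext_diff algebra_simps)
qed

lemma biset_module_rep:
  assumes "prime p" "Z \<in> biset_module p G H" "z \<in> Z"
  shows "z \<in> biset_combs p G H" "Z = biset_cong p G H `` {z}"
proof -
  note eq = equiv_biset_cong[OF assms(1)]
  obtain w where w: "w \<in> biset_combs p G H" "Z = biset_cong p G H `` {w}"
    using assms(2) unfolding biset_module_def quotient_def by blast
  show "z \<in> biset_combs p G H" using w assms(3) by (auto simp: biset_cong_def)
  show "Z = biset_cong p G H `` {z}"
    using equiv_class_eq[OF eq, of w z] w assms(3) by simp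
qed

lemma biset_module_nonempty:
  assumes "prime p" "Z \<in> biset_module p G H"
  obtains z where "z \<in> Z"
  using in_quotient_imp_non_empty[OF equiv_biset_cong[OF assms(1)]] assms(2)
  unfolding biset_module_def by blast

lemma biset_class_rep:
  assumes "prime p" "group G" "group H" "biset G H X"
  shows "biset_class p G H X \<in> biset_module p G H"
    and "Poly_Mapping.single (nat_copy X) 1 \<in> biset_class p G H X"
proof -
  have s: "Poly_Mapping.single (nat_copy X) 1 \<in> biset_combs p G H"
    by (intro combs_single Z_loc_1 nat_copy assms)
  then show "biset_class p G H X \<in> biset_module p G H"
    unfolding biset_class_def biset_module_def by (rule quotientI)
  show "Poly_Mapping.single (nat_copy X) 1 \<in> biset_class p G H X"
    unfolding biset_class_def by (rule equiv_class_self[OF equiv_biset_cong[OF assms(1)] s])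
qed

text \<open>The value does not depend on the chosen representative (\<open>class_mark_eq\<close>).\<close>

definition class_mark ::
    "'l set \<Rightarrow> ('l \<Rightarrow> 'h) \<Rightarrow> ('l \<Rightarrow> 'g) \<Rightarrow> ('h, 'g) biset_comb set \<Rightarrow> rat" where
  "class_mark L a b Z = linear_ext (\<lambda>B. of_nat (mark L a b B)) (SOME z. z \<in> Z)"

lemma class_mark_cong:
  assumes "\<And>u. u \<in> L \<Longrightarrow> a u = a' u" "\<And>u. u \<in> L \<Longrightarrow> b u = b' u"
  shows "class_mark L a b Z = class_mark L a' b' Z"
proof -
  have "(\<lambda>B. rat_of_nat (mark L a b B)) = (\<lambda>B. of_nat (mark L a' b' B))"
    using mark_cong[of L a a' b b', OF assms] by (intro ext arg_cong[where f = of_nat])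
  then show ?thesis unfolding class_mark_def by (rule arg_cong)
qed

lemma class_mark_image:
  "class_mark L (\<lambda>u. a (f u)) (\<lambda>u. b (f u)) Z = class_mark (f ` L) a b Z"
  by (simp add: class_mark_def mark_def fixed_points_def)

lemma mark_rels:
  fixes G :: "('g, 'm) monoid_scheme" and H :: "('h, 'n) monoid_scheme"
  assumes "group G" "group H" and a: "a \<in> L \<rightarrow> carrier H" "b \<in> L \<rightarrow> carrier G"
    and r: "r \<in> biset_rels p G H"
  shows "linear_ext (\<lambda>B. of_nat (mark L a b B)) r = 0"
  using _ _ r
proof (rule linear_ext_rels)
  fix X Y assume "biset G H X" "biset G H Y" "biset_iso G H X Y"
  then show "rat_of_nat (mark L a b X) = of_nat (mark L a b Y)"
    using mark_iso assms by fastforce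
next
  fix X Y :: "('h, 'g) nbiset" assume XY: "biset G H X" "biset G H Y"
  note u = biset_union[OF assms(1,2) XY]
  have "mark L a b (nat_copy (biset_union X Y)) = mark L a b (biset_union X Y)"
    using mark_iso[OF u nat_copy(2)[OF assms(1,2) u] assms(1,2) a] by simp
  also have "\<dots> = mark L a b X + mark L a b Y"
    using XY by (intro mark_union) (auto simp: biset_def)
  finally show "rat_of_nat (mark L a b (nat_copy (biset_union X Y))) =
    of_nat (mark L a b X) + of_nat (mark L a b Y)" by simp
qed

lemma class_mark_eq:
  assumes "prime p" "group G" "group H" "Z \<in> biset_module p G H" "z \<in> Z"
    and a: "a \<in> L \<rightarrow> carrier H" "b \<in> L \<rightarrow> carrier G"
  shows "class_mark L a b Z = linear_ext (\<lambda>B. of_nat (mark L a b B)) z"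
proof -
  define w where "w = (SOME z. z \<in> Z)"
  have "w \<in> Z" unfolding w_def using assms(5) by (rule someI)
  then have "z - w \<in> biset_rels p G H"
    using biset_module_rep(2)[OF assms(1,4,5)] by (auto simp: biset_cong_def)
  from mark_rels[OF assms(2,3) a this] show ?thesis
    by (simp add: class_mark_def w_def linear_ext_diff)
qed

lemma class_mark_biset_class:
  assumes "prime p" "group G" "group H" "biset G H X"
    and a: "a \<in> L \<rightarrow> carrier H" "b \<in> L \<rightarrow> carrier G"
  shows "class_mark L a b (biset_class p G H X) = of_nat (mark L a b X)"
proof -
  have "mark L a b X = mark L a b (nat_copy X)"
    by (rule mark_iso[OF assms(4) nat_copy(2)[OF assms(2-4)] assms(2,3) a])
  then show ?thesis
    using class_mark_eq[OF assms(1-3) biset_class_rep[OF assms(1-4)] a] by simp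
qed

lemma hom_funcset: "a \<in> hom L H \<Longrightarrow> a \<in> carrier L \<rightarrow> carrier H"
  by (simp add: hom_def)

lemma class_mark_conj:
  assumes "prime p" "group G" "group H" "Z \<in> biset_module p G H"
    and a: "a \<in> L \<rightarrow> carrier H" "b \<in> L \<rightarrow> carrier G" and h: "h \<in> carrier H" and g: "g \<in> carrier G"
  shows "class_mark L (\<lambda>u. h \<otimes>\<^bsub>H\<^esub> a u \<otimes>\<^bsub>H\<^esub> inv\<^bsub>H\<^esub> h) (\<lambda>u. g \<otimes>\<^bsub>G\<^esub> b u \<otimes>\<^bsub>G\<^esub> inv\<^bsub>G\<^esub> g) Z = class_mark L a b Z"
proof -
  obtain z where z: "z \<in> Z" using biset_module_nonempty[OF assms(1,4)] .
  interpret G: group G by fact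
  interpret H: group H by fact
  have f: "(\<lambda>u. h \<otimes>\<^bsub>H\<^esub> a u \<otimes>\<^bsub>H\<^esub> inv\<^bsub>H\<^esub> h) \<in> L \<rightarrow> carrier H"
    "(\<lambda>u. g \<otimes>\<^bsub>G\<^esub> b u \<otimes>\<^bsub>G\<^esub> inv\<^bsub>G\<^esub> g) \<in> L \<rightarrow> carrier G" using a h g by auto
  have "\<And>B. B \<in> Poly_Mapping.keys z \<Longrightarrow> biset G H B"
    using biset_module_rep(1)[OF assms(1,4) z] by (auto simp: biset_combs_def)
  then show ?thesis
    unfolding class_mark_eq[OF assms(1-4) z a] class_mark_eq[OF assms(1-4) z f] linear_ext_def
    using mark_conj[OF _ assms(2,3) a h g] by (intro sum.cong) auto
qed

lemma class_mark_conj_left: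
  assumes "prime p" "group G" "group H" "Z \<in> biset_module p G H"
    and a: "a \<in> L \<rightarrow> carrier H" "b \<in> L \<rightarrow> carrier G" and h: "h \<in> carrier H"
    and a': "\<And>u. u \<in> L \<Longrightarrow> a' u = h \<otimes>\<^bsub>H\<^esub> a u \<otimes>\<^bsub>H\<^esub> inv\<^bsub>H\<^esub> h"
  shows "class_mark L a' b Z = class_mark L a b Z"
proof -
  interpret G: group G by fact
  have "class_mark L a' b Z = class_mark L (\<lambda>u. h \<otimes>\<^bsub>H\<^esub> a u \<otimes>\<^bsub>H\<^esub> inv\<^bsub>H\<^esub> h)
      (\<lambda>u. \<one>\<^bsub>G\<^esub> \<otimes>\<^bsub>G\<^esub> b u \<otimes>\<^bsub>G\<^esub> inv\<^bsub>G\<^esub> \<one>\<^bsub>G\<^esub>) Z"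
    using a' funcset_mem[OF a(2)] by (intro class_mark_cong) simp_all
  then show ?thesis using class_mark_conj[OF assms(1-4) a h G.one_closed] by simp
qed

lemma class_mark_conj_right:
  assumes "prime p" "group G" "group H" "Z \<in> biset_module p G H"
    and a: "a \<in> L \<rightarrow> carrier H" "b \<in> L \<rightarrow> carrier G" and g: "g \<in> carrier G"
    and b': "\<And>u. u \<in> L \<Longrightarrow> b' u = g \<otimes>\<^bsub>G\<^esub> b u \<otimes>\<^bsub>G\<^esub> inv\<^bsub>G\<^esub> g"
  shows "class_mark L a b' Z = class_mark L a b Z"
proof -
  interpret H: group H by fact
  have "class_mark L a b' Z = class_mark L (\<lambda>u. \<one>\<^bsub>H\<^esub> \<otimes>\<^bsub>H\<^esub> a u \<otimes>\<^bsub>H\<^esub> inv\<^bsub>H\<^esub> \<one>\<^bsub>H\<^esub>)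
      (\<lambda>u. g \<otimes>\<^bsub>G\<^esub> b u \<otimes>\<^bsub>G\<^esub> inv\<^bsub>G\<^esub> g) Z"
    using b' funcset_mem[OF a(1)] by (intro class_mark_cong) simp_all
  then show ?thesis using class_mark_conj[OF assms(1-4) a H.one_closed g] by simp
qed

lemma left_free_iso:
  assumes "group G" "group H" "biset G H X" "biset_iso G H X Y" "left_free G H X"
  shows "left_free G H Y"
proof -
  interpret G: group G by fact
  interpret H: group H by fact
  obtain f where f: "bij_betw f (points X) (points Y)"
    "\<And>a x. a \<in> carrier (H \<times>\<times> G) \<Longrightarrow> x \<in> points X \<Longrightarrow> f (action X a x) = action Y a (f x)"
    using assms(4) unfolding biset_iso_def by blast
  show ?thesis unfolding left_free_def
  proof (intro ballI impI)
    fix h y assume h: "h \<in> carrier H" and y: "y \<in> points Y" and fx: "action Y (h, \<one>\<^bsub>G\<^esub>) y = y"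
    obtain x where x: "x \<in> points X" "y = f x" using y f(1) by (auto simp: bij_betw_def)
    have "f (action X (h, \<one>\<^bsub>G\<^esub>) x) = f x" using f(2)[of "(h, \<one>\<^bsub>G\<^esub>)" x] h x fx by simp
    moreover have "action X (h, \<one>\<^bsub>G\<^esub>) x \<in> points X"
      using assms(3) h x unfolding biset_iff[OF assms(1,2)] by simp
    ultimately have "action X (h, \<one>\<^bsub>G\<^esub>) x = x"
      using f(1) x by (auto simp: bij_betw_def dest: inj_onD)
    then show "h = \<one>\<^bsub>H\<^esub>" using assms(5) h x(1) unfolding left_free_def by blast
  qed
qed

text \<open>Membership in the span of the left-free bisets.\<close>

definition left_free_class ::
    "('g, 'm) monoid_scheme \<Rightarrow> ('h, 'n) monoid_scheme \<Rightarrow> ('h, 'g) biset_comb set \<Rightarrow> bool" where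
  "left_free_class G H X \<longleftrightarrow> (\<exists>x\<in>X. \<forall>B\<in>Poly_Mapping.keys x. left_free G H B)"

lemma transitive_class_left_free:
  assumes "prime p" "group G" "group H" "finite (carrier G)" "finite (carrier H)"
    and "subgroup P G" "\<beta> \<in> hom (G\<lparr>carrier := P\<rparr>) H"
  shows "transitive_class p G H P \<beta> \<in> biset_module p G H"
    and "left_free_class G H (transitive_class p G H P \<beta>)"
proof -
  note b = coset_biset_biset[OF assms(2-7)]
  note c = biset_class_rep[OF assms(1-3) b]
  show "transitive_class p G H P \<beta> \<in> biset_module p G H" by (rule c(1))
  have "left_free G H (nat_copy (coset_biset G H P \<beta>))"
    by (rule left_free_iso[OF assms(2,3) b nat_copy(2)[OF assms(2,3) b]
      left_free_coset_biset[OF assms(2,3,6,7)]])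
  then show "left_free_class G H (transitive_class p G H P \<beta>)"
    unfolding left_free_class_def using c(2) by (intro bexI) auto
qed

lemma class_mark_transitive:
  assumes "prime p" "group G" "group H" "finite (carrier G)" "finite (carrier H)"
    and P: "subgroup P G" "\<beta> \<in> hom (G\<lparr>carrier := P\<rparr>) H"
    and L: "group L" "finite (carrier L)" and a: "a \<in> hom L H" "b \<in> hom L G"
  shows "of_nat (card P) * class_mark (carrier L) a b (transitive_class p G H P \<beta>) =
    (\<Sum>c\<in>homs L (G\<lparr>carrier := P\<rparr>).
       of_nat (card (conjugators H L a (\<lambda>u. \<beta> (c u)))) *
       of_nat (card (conjugators G L b c)))"
  unfolding class_mark_biset_class[OF assms(1-3) coset_biset_biset[OF assms(2-7)] a[THEN hom_funcset]]
  using arg_cong[OF mark_coset_biset[OF assms(2-11)], of rat_of_nat] by simp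

section \<open>Composition of classes in terms of marks\<close>

context biset_comp_setup
begin

lemma class_mark_comp:
  fixes L :: "('l, 'q) monoid_scheme"
  assumes L: "group L" "finite (carrier L)" and fH: "finite (carrier H)"
    and a: "a \<in> hom L K" and b: "b \<in> hom L G"
    and Y: "Y \<in> biset_module p H K" and X: "X \<in> biset_module p G H" "left_free_class G H X"
  shows "of_nat (card (carrier H)) * class_mark (carrier L) a b (biset_comp p G H K Y X) =
    (\<Sum>c\<in>homs L H. class_mark (carrier L) a c Y * class_mark (carrier L) c b X)"
proof -
  obtain y where y: "y \<in> Y" using biset_module_nonempty[OF p Y] .
  obtain x where x: "x \<in> X" "\<And>B. B \<in> Poly_Mapping.keys x \<Longrightarrow> left_free G H B"
    using X(2) by (auto simp: left_free_class_def)
  note yr = biset_module_rep[OF p Y y] and xr = biset_module_rep[OF p X(1) x(1)]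
  have bis: "\<And>B. B \<in> Poly_Mapping.keys y \<Longrightarrow> biset H K B" "\<And>B. B \<in> Poly_Mapping.keys x \<Longrightarrow> biset G H B"
    using yr(1) xr(1) by (auto simp: biset_combs_def)
  note f = a[THEN hom_funcset] b[THEN hom_funcset]
  let ?m = "\<lambda>a b B. rat_of_nat (mark (carrier L) a b B)"
  have cH: "c \<in> carrier L \<rightarrow> carrier H" if "c \<in> homs L H" for c
    using homsD[OF that] by (rule hom_funcset)
  have "comb_comp G H K y x \<in> biset_comp p G H K Y X"
    using equiv_class_self[OF equiv_biset_cong[OF p] comb_comp_closed[OF yr(1) xr(1)]]
      biset_comp_rep[OF yr(1) xr(1)] yr(2) xr(2) by simp
  then have "class_mark (carrier L) a b (biset_comp p G H K Y X) = linear_ext (?m a b) (comb_comp G H K y x)"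
    by (intro class_mark_eq[OF p G.is_group K.is_group biset_comp_closed[OF Y X(1)]] f)
  then have "of_nat (card (carrier H)) * class_mark (carrier L) a b (biset_comp p G H K Y X) =
      (\<Sum>B\<in>Poly_Mapping.keys y. \<Sum>C\<in>Poly_Mapping.keys x.
        Poly_Mapping.lookup y B * Poly_Mapping.lookup x C *
          (of_nat (card (carrier H)) * ?m a b (nat_copy (biset_tensor G H K B C))))"
    by (simp add: comb_comp_def linear_ext_sum sum_distrib_left mult_ac)
  also have "\<dots> = (\<Sum>B\<in>Poly_Mapping.keys y. \<Sum>C\<in>Poly_Mapping.keys x.
        Poly_Mapping.lookup y B * Poly_Mapping.lookup x C * (\<Sum>c\<in>homs L H. ?m a c B * ?m c b C))"
  proof (intro sum.cong refl arg_cong2[where f = "(*)"])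
    fix B C assume "B \<in> Poly_Mapping.keys y" "C \<in> Poly_Mapping.keys x"
    then have BC: "biset H K B" "biset G H C" "left_free G H C" using bis x(2) by auto
    interpret BC: biset_pair G H K B C by unfold_locales (rule BC)+
    note t = BC.biset_tensor
    have "mark (carrier L) a b (nat_copy (biset_tensor G H K B C)) = mark (carrier L) a b (biset_tensor G H K B C)"
      using mark_iso[OF t nat_copy(2)[OF G.is_group K.is_group t] G.is_group K.is_group f] by simp
    then show "of_nat (card (carrier H)) * ?m a b (nat_copy (biset_tensor G H K B C)) =
      (\<Sum>c\<in>homs L H. ?m a c B * ?m c b C)"
      using arg_cong[OF BC.mark_tensor[OF L fH a b BC(3)], of rat_of_nat] by simp
  qed
  also have "\<dots> = (\<Sum>c\<in>homs L H. \<Sum>B\<in>Poly_Mapping.keys y. \<Sum>C\<in>Poly_Mapping.keys x.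
        (Poly_Mapping.lookup y B * ?m a c B) * (Poly_Mapping.lookup x C * ?m c b C))"
    by (subst sum.swap, rule sum.swap[THEN trans])
       (simp add: sum_distrib_left sum.swap[of _ "homs L H"] mult_ac)
  also have "\<dots> = (\<Sum>c\<in>homs L H. linear_ext (?m a c) y * linear_ext (?m c b) x)"
    by (simp add: linear_ext_def sum_product)
  also have "\<dots> = (\<Sum>c\<in>homs L H. class_mark (carrier L) a c Y * class_mark (carrier L) c b X)"
    using cH class_mark_eq[OF p H.is_group K.is_group Y y f(1)]
      class_mark_eq[OF p G.is_group H.is_group X(1) x(1) _ f(2)]
    by (intro sum.cong refl) simp
  finally show ?thesis .
qed

end

lemma (in group) inv_cancel:
  assumes "x \<in> carrier G" "y \<in> carrier G"
  shows "inv x \<otimes> (x \<otimes> y) = y" "x \<otimes> (inv x \<otimes> y) = y"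
  using assms by (simp_all add: m_assoc[symmetric])

text \<open>Sorts the elements \<open>h\<close> of \<open>H\<close> by the conjugate \<open>h d h\<inverse>\<close> of \<open>d\<close>: the numbers of conjugators are
the weights of a sum over the conjugates of \<open>d\<close>, on which \<open>f\<close> is constant.\<close>

lemma sum_over_conjugates:
  fixes f :: "('l \<Rightarrow> 'h) \<Rightarrow> rat"
  assumes L: "group L" "finite (carrier L)" and H: "group H" "finite (carrier H)"
    and d: "d \<in> hom L H"
    and f: "\<And>c h. c \<in> homs L H \<Longrightarrow> h \<in> carrier H \<Longrightarrow>
      (\<And>u. u \<in> carrier L \<Longrightarrow> c u = h \<otimes>\<^bsub>H\<^esub> d u \<otimes>\<^bsub>H\<^esub> inv\<^bsub>H\<^esub> h) \<Longrightarrow> f c = f d"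
  shows "(\<Sum>c\<in>homs L H. of_nat (card (conjugators H L c d)) * f c)
    = of_nat (card (carrier H)) * f d"
proof -
  interpret H: group H by fact
  define A where "A c = conjugators H L c d" for c
  have dL: "\<And>u. u \<in> carrier L \<Longrightarrow> d u \<in> carrier H" using d by (auto simp: hom_def)
  have "(\<Sum>c\<in>homs L H. of_nat (card (A c)) * f c) = (\<Sum>c\<in>homs L H. of_nat (card (A c)) * f d)"
  proof (intro sum.cong refl)
    fix c assume c: "c \<in> homs L H"
    show "of_nat (card (A c)) * f c = of_nat (card (A c)) * f d"
    proof (cases "A c = {}")
      case False
      then obtain h where "h \<in> A c" by blast
      then have "f c = f d" using f[OF c, of h] by (auto simp: A_def)
      then show ?thesis by simp
    qed simp
  qed
  also have "\<dots> = of_nat (\<Sum>c\<in>homs L H. card (A c)) * f d"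
    by (simp add: sum_distrib_right)
  also have "(\<Sum>c\<in>homs L H. card (A c)) = card (\<Union>c\<in>homs L H. A c)"
  proof (rule card_UN_disjoint[symmetric, OF finite_homs[OF L(2) H(2)]])
    show "\<forall>c\<in>homs L H. finite (A c)" using H(2) by (simp add: A_def)
    show "\<forall>c\<in>homs L H. \<forall>c'\<in>homs L H. c \<noteq> c' \<longrightarrow> A c \<inter> A c' = {}"
    proof (intro ballI impI)
      fix c c' assume c: "c \<in> homs L H" "c' \<in> homs L H" "c \<noteq> c'"
      have "c = c'" if "h \<in> A c" "h \<in> A c'" for h
        using that by (intro homs_eqI[OF c(1,2)]) (simp add: A_def)
      then show "A c \<inter> A c' = {}" using c(3) by blast
    qed
  qed
  also have "(\<Union>c\<in>homs L H. A c) = carrier H"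
  proof
    show "carrier H \<subseteq> (\<Union>c\<in>homs L H. A c)"
    proof
      fix h assume h: "h \<in> carrier H"
      let ?c = "restrict (\<lambda>u. h \<otimes>\<^bsub>H\<^esub> d u \<otimes>\<^bsub>H\<^esub> inv\<^bsub>H\<^esub> h) (carrier L)"
      have "h \<otimes>\<^bsub>H\<^esub> (d u \<otimes>\<^bsub>H\<^esub> d v) \<otimes>\<^bsub>H\<^esub> inv\<^bsub>H\<^esub> h = h \<otimes>\<^bsub>H\<^esub> d u \<otimes>\<^bsub>H\<^esub> inv\<^bsub>H\<^esub> h \<otimes>\<^bsub>H\<^esub> (h \<otimes>\<^bsub>H\<^esub> d v \<otimes>\<^bsub>H\<^esub> inv\<^bsub>H\<^esub> h)"
        if "u \<in> carrier L" "v \<in> carrier L" for u v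
        using h dL that by (simp add: H.m_assoc H.inv_cancel)
      then have "?c \<in> homs L H"
        using h d dL by (intro restrict_homs[OF L(1)]) (simp add: hom_def)
      moreover have "h \<in> A ?c" using h by (simp add: A_def)
      ultimately show "h \<in> (\<Union>c\<in>homs L H. A c)" by blast
    qed
  qed (auto simp: A_def)
  finally show ?thesis by (simp add: A_def)
qed

lemma (in group) conj_swap:
  assumes "g \<in> carrier G" "x \<in> carrier G" "y \<in> carrier G"
  shows "x = g \<otimes> y \<otimes> inv g \<longleftrightarrow> y = inv g \<otimes> x \<otimes> g"
  using assms by (auto simp: m_assoc inv_cancel)

lemma sum_over_inverse_conjugates:
  fixes f :: "('l \<Rightarrow> 'h) \<Rightarrow> rat"
  assumes L: "group L" "finite (carrier L)" and H: "group H" "finite (carrier H)"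
    and d: "d \<in> hom L H"
    and f: "\<And>c h. c \<in> homs L H \<Longrightarrow> h \<in> carrier H \<Longrightarrow>
      (\<And>u. u \<in> carrier L \<Longrightarrow> c u = h \<otimes>\<^bsub>H\<^esub> d u \<otimes>\<^bsub>H\<^esub> inv\<^bsub>H\<^esub> h) \<Longrightarrow> f c = f d"
  shows "(\<Sum>c\<in>homs L H. of_nat (card (conjugators H L d c)) * f c)
    = of_nat (card (carrier H)) * f d"
proof -
  interpret H: group H by fact
  have "card (conjugators H L d c) =
      card (conjugators H L c d)" if c: "c \<in> homs L H" for c
  proof (rule bij_betw_same_card[of "\<lambda>h. inv\<^bsub>H\<^esub> h"], rule bij_betw_byWitness[where f' = "\<lambda>h. inv\<^bsub>H\<^esub> h"])
    have cl: "c u \<in> carrier H" "d u \<in> carrier H" if "u \<in> carrier L" for u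
      using c d that by (auto simp: homs_def hom_def)
    show "(\<lambda>h. inv\<^bsub>H\<^esub> h) ` conjugators H L d c
      \<subseteq> conjugators H L c d"
      "(\<lambda>h. inv\<^bsub>H\<^esub> h) ` conjugators H L c d
      \<subseteq> conjugators H L d c"
      using H.conj_swap cl by auto
  qed auto
  then have "(\<Sum>c\<in>homs L H. of_nat (card (conjugators H L d c)) * f c)
    = (\<Sum>c\<in>homs L H. of_nat (card (conjugators H L c d)) * f c)"
    by (intro sum.cong refl arg_cong2[where f = "(*)"] arg_cong[where f = rat_of_nat])
  also have "\<dots> = of_nat (card (carrier H)) * f d"
    by (rule sum_over_conjugates[OF L H d, of f, OF f])
  finally show ?thesis .
qed

context biset_comp_setup
begin

text \<open>Composing with a transitive biset: after inserting \<open>mark_coset_biset\<close> into the matrix product, the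
sum over the intermediate homomorphism \<open>L \<rightarrow> H\<close> runs over conjugates of \<open>\<beta> \<circ> c\<close> only and
collapses, because marks are invariant under conjugation.\<close>

lemma class_mark_comp_coset_right:
  fixes L :: "('l, 'q) monoid_scheme"
  assumes L: "group L" "finite (carrier L)" and fin: "finite (carrier G)" "finite (carrier H)"
    and a: "a \<in> hom L K" and b: "b \<in> hom L G"
    and Y: "Y \<in> biset_module p H K" and P: "subgroup P G" "\<beta> \<in> hom (G\<lparr>carrier := P\<rparr>) H"
  shows "of_nat (card P) * class_mark (carrier L) a b (biset_comp p G H K Y (transitive_class p G H P \<beta>)) =
    (\<Sum>c\<in>homs L (G\<lparr>carrier := P\<rparr>).
       of_nat (card (conjugators G L b c)) *
       class_mark (carrier L) a (\<beta> \<circ> c) Y)"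
proof -
  let ?X = "transitive_class p G H P \<beta>"
  let ?C = "homs L (G\<lparr>carrier := P\<rparr>)"
  let ?n = "\<lambda>c. rat_of_nat (card (conjugators G L b c))"
  let ?k = "\<lambda>d c. rat_of_nat (card (conjugators H L d (\<lambda>u. \<beta> (c u))))"
  note X = transitive_class_left_free[OF p G.is_group H.is_group fin P]
  have H0: "rat_of_nat (card (carrier H)) \<noteq> 0" using fin(2) by auto
  have "of_nat (card (carrier H)) * (of_nat (card P) * class_mark (carrier L) a b (biset_comp p G H K Y ?X)) =
     (\<Sum>d\<in>homs L H. class_mark (carrier L) a d Y * (of_nat (card P) * class_mark (carrier L) d b ?X))"
    using class_mark_comp[OF L fin(2) a b Y X] by (simp add: sum_distrib_left mult_ac)
  also have "\<dots> = (\<Sum>d\<in>homs L H. class_mark (carrier L) a d Y * (\<Sum>c\<in>?C. ?k d c * ?n c))"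
    using class_mark_transitive[OF p G.is_group H.is_group fin P L homsD b]
    by (intro sum.cong refl) simp
  also have "\<dots> = (\<Sum>c\<in>?C. ?n c * (\<Sum>d\<in>homs L H. ?k d c * class_mark (carrier L) a d Y))"
    by (simp add: sum_distrib_left mult_ac) (subst sum.swap, simp)
  also have "\<dots> = (\<Sum>c\<in>?C. ?n c * (of_nat (card (carrier H)) * class_mark (carrier L) a (\<beta> \<circ> c) Y))"
  proof (intro sum.cong refl arg_cong2[where f = "(*)"])
    fix c assume "c \<in> ?C"
    then have bc: "\<beta> \<circ> c \<in> hom L H" using P(2) hom_compose homsD by blast
    show "(\<Sum>d\<in>homs L H. ?k d c * class_mark (carrier L) a d Y) =
        of_nat (card (carrier H)) * class_mark (carrier L) a (\<beta> \<circ> c) Y"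
      using sum_over_conjugates[OF L H.is_group fin(2) bc, of "\<lambda>d. class_mark (carrier L) a d Y"]
        class_mark_conj_right[OF p H.is_group K.is_group Y hom_funcset[OF a] hom_funcset[OF bc]] by simp
  qed
  also have "\<dots> = of_nat (card (carrier H)) * (\<Sum>c\<in>?C. ?n c * class_mark (carrier L) a (\<beta> \<circ> c) Y)"
    by (simp add: sum_distrib_left mult_ac)
  finally show ?thesis using H0 by simp
qed

lemma class_mark_comp_coset_left:
  fixes L :: "('l, 'q) monoid_scheme"
  assumes L: "group L" "finite (carrier L)" and fin: "finite (carrier H)" "finite (carrier K)"
    and a: "a \<in> hom L K" and b: "b \<in> hom L G"
    and X: "X \<in> biset_module p G H" "left_free_class G H X"
    and P: "subgroup P H" "\<beta> \<in> hom (H\<lparr>carrier := P\<rparr>) K"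
  shows "of_nat (card P) * class_mark (carrier L) a b (biset_comp p G H K (transitive_class p H K P \<beta>) X) =
    (\<Sum>c\<in>homs L (H\<lparr>carrier := P\<rparr>).
       of_nat (card (conjugators K L a (\<lambda>u. \<beta> (c u)))) *
       class_mark (carrier L) c b X)"
proof -
  let ?Y = "transitive_class p H K P \<beta>"
  let ?C = "homs L (H\<lparr>carrier := P\<rparr>)"
  let ?n = "\<lambda>d c. rat_of_nat (card (conjugators H L d c))"
  let ?k = "\<lambda>c. rat_of_nat (card (conjugators K L a (\<lambda>u. \<beta> (c u))))"
  note Y = transitive_class_left_free(1)[OF p H.is_group K.is_group fin P]
  have H0: "rat_of_nat (card (carrier H)) \<noteq> 0" using fin(1) by auto
  have "of_nat (card (carrier H)) * (of_nat (card P) * class_mark (carrier L) a b (biset_comp p G H K ?Y X)) =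
     (\<Sum>d\<in>homs L H. (of_nat (card P) * class_mark (carrier L) a d ?Y) * class_mark (carrier L) d b X)"
    using class_mark_comp[OF L fin(1) a b Y X] by (simp add: sum_distrib_left mult_ac)
  also have "\<dots> = (\<Sum>d\<in>homs L H. (\<Sum>c\<in>?C. ?k c * ?n d c) * class_mark (carrier L) d b X)"
    using class_mark_transitive[OF p H.is_group K.is_group fin P L a homsD]
    by (intro sum.cong refl) simp
  also have "\<dots> = (\<Sum>c\<in>?C. ?k c * (\<Sum>d\<in>homs L H. ?n d c * class_mark (carrier L) d b X))"
    by (simp add: sum_distrib_left sum_distrib_right mult_ac) (subst sum.swap, simp)
  also have "\<dots> = (\<Sum>c\<in>?C. ?k c * (of_nat (card (carrier H)) * class_mark (carrier L) c b X))"
  proof (intro sum.cong refl arg_cong2[where f = "(*)"])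
    fix c assume "c \<in> ?C"
    then have c: "c \<in> hom L H" using subgroup.subset[OF P(1)] by (auto simp: homs_def hom_def)
    show "(\<Sum>d\<in>homs L H. ?n d c * class_mark (carrier L) d b X) =
        of_nat (card (carrier H)) * class_mark (carrier L) c b X"
      by (rule sum_over_conjugates[OF L H.is_group fin(1) c])
        (rule class_mark_conj_left[OF p G.is_group H.is_group X(1) hom_funcset[OF c] hom_funcset[OF b]])
  qed
  also have "\<dots> = of_nat (card (carrier H)) * (\<Sum>c\<in>?C. ?k c * class_mark (carrier L) c b X)"
    by (simp add: sum_distrib_left mult_ac)
  finally show ?thesis using H0 by simp
qed

text \<open>Composition with \<open>[G, \<beta>]\<close> is restriction along \<open>\<beta>: G \<rightarrow> H\<close>, hence the marks are simply pulled back.\<close>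

lemma class_mark_comp_restriction:
  fixes L :: "('l, 'q) monoid_scheme"
  assumes L: "group L" "finite (carrier L)" and fin: "finite (carrier G)" "finite (carrier H)"
    and a: "a \<in> hom L K" and b: "b \<in> hom L G"
    and Y: "Y \<in> biset_module p H K" and \<beta>: "\<beta> \<in> hom G H"
  shows "class_mark (carrier L) a b (biset_comp p G H K Y (transitive_class p G H (carrier G) \<beta>)) =
    class_mark (carrier L) a (\<lambda>u. \<beta> (b u)) Y"
proof -
  have G0: "rat_of_nat (card (carrier G)) \<noteq> 0" using fin(1) by auto
  interpret \<beta>: group_hom G H \<beta> by unfold_locales (rule \<beta>)
  have inv: "class_mark (carrier L) a (\<beta> \<circ> c) Y = class_mark (carrier L) a (\<beta> \<circ> b) Y"
    if "c \<in> homs L G" "g \<in> carrier G" "\<And>u. u \<in> carrier L \<Longrightarrow> c u = g \<otimes>\<^bsub>G\<^esub> b u \<otimes>\<^bsub>G\<^esub> inv\<^bsub>G\<^esub> g" for c g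
  proof (rule class_mark_conj_right[OF p H.is_group K.is_group Y hom_funcset[OF a]])
    show "\<beta> \<circ> b \<in> carrier L \<rightarrow> carrier H" using hom_compose[OF b \<beta>] by (rule hom_funcset)
    show "\<beta> g \<in> carrier H" using that(2) by simp
    show "(\<beta> \<circ> c) u = \<beta> g \<otimes>\<^bsub>H\<^esub> (\<beta> \<circ> b) u \<otimes>\<^bsub>H\<^esub> inv\<^bsub>H\<^esub> \<beta> g" if "u \<in> carrier L" for u
      using that \<open>g \<in> carrier G\<close> \<open>\<And>u. u \<in> carrier L \<Longrightarrow> c u = _ u\<close> b by (simp add: hom_in_carrier)
  qed
  have "of_nat (card (carrier G)) * class_mark (carrier L) a b
      (biset_comp p G H K Y (transitive_class p G H (carrier G) \<beta>)) =
    of_nat (card (carrier G)) * class_mark (carrier L) a (\<beta> \<circ> b) Y"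
  proof -
    have GG: "G\<lparr>carrier := carrier G\<rparr> = G" by simp
    note class_mark_comp_coset_right[OF L fin a b Y G.subgroup_self, of \<beta>, unfolded GG, OF \<beta>]
    also have "(\<Sum>c\<in>homs L G. of_nat (card (conjugators G L b c)) *
       class_mark (carrier L) a (\<beta> \<circ> c) Y) = of_nat (card (carrier G)) * class_mark (carrier L) a (\<beta> \<circ> b) Y"
      by (rule sum_over_inverse_conjugates[OF L G.is_group fin(1) b, of "\<lambda>c. class_mark (carrier L) a (\<beta> \<circ> c) Y", OF inv])
    finally show ?thesis .
  qed
  then show ?thesis using G0 by (simp add: comp_def)
qed

text \<open>For an isomorphism \<open>\<beta>: P \<rightarrow> K\<close>, composition with \<open>[P, \<beta>]\<close> on the left is restriction to \<open>P\<close> followed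
by transport along \<open>\<beta>\<close>. This covers both \<open>[R, id]\<close> in the theorem and the classes that define left
stability.\<close>

lemma class_mark_comp_iso:
  fixes L :: "('l, 'q) monoid_scheme"
  assumes L: "group L" "finite (carrier L)" and fin: "finite (carrier H)" "finite (carrier K)"
    and a: "a \<in> hom L K" and b: "b \<in> hom L G"
    and X: "X \<in> biset_module p G H" "left_free_class G H X"
    and P: "subgroup P H" "\<beta> \<in> hom (H\<lparr>carrier := P\<rparr>) K"
    and \<beta>': "\<beta>' \<in> hom K (H\<lparr>carrier := P\<rparr>)"
    and inverse: "\<And>x. x \<in> P \<Longrightarrow> \<beta>' (\<beta> x) = x" "\<And>k. k \<in> carrier K \<Longrightarrow> \<beta> (\<beta>' k) = k"
  shows "class_mark (carrier L) a b (biset_comp p G H K (transitive_class p H K P \<beta>) X) =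
    class_mark (carrier L) (\<lambda>u. \<beta>' (a u)) b X"
proof -
  interpret L: group L by fact
  interpret HP: group "H\<lparr>carrier := P\<rparr>" by (rule subgroup.subgroup_is_group[OF P(1) H.is_group])
  interpret \<beta>': group_hom K "H\<lparr>carrier := P\<rparr>" \<beta>' by unfold_locales (rule \<beta>')
  let ?n = "\<lambda>d. rat_of_nat (card (conjugators K L a d))"
  let ?m = "\<lambda>d. class_mark (carrier L) (\<lambda>u. \<beta>' (d u)) b X"
  have "bij_betw \<beta> P (carrier K)"
    using inverse P(2) \<beta>' by (intro bij_betw_byWitness[where f' = \<beta>']) (auto simp: hom_def)
  then have cP: "card P = card (carrier K)" by (rule bij_betw_same_card)
  have K0: "rat_of_nat (card (carrier K)) \<noteq> 0" using fin(2) by auto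
  have inv: "?m d = ?m a" if dk: "d \<in> homs L K" "k \<in> carrier K"
    "\<And>u. u \<in> carrier L \<Longrightarrow> d u = k \<otimes>\<^bsub>K\<^esub> a u \<otimes>\<^bsub>K\<^esub> inv\<^bsub>K\<^esub> k" for d k
  proof (rule class_mark_conj_left[OF p G.is_group H.is_group X(1)])
    have sub: "P \<subseteq> carrier H" using P(1) by (rule subgroup.subset)
    show "(\<lambda>u. \<beta>' (a u)) \<in> carrier L \<rightarrow> carrier H"
      using a \<beta>' sub by (auto simp: hom_def)
    show "b \<in> carrier L \<rightarrow> carrier G" using b by (rule hom_funcset)
    have kP: "\<beta>' k \<in> P" using \<beta>'.hom_closed[OF dk(2)] by simp
    then show "\<beta>' k \<in> carrier H" using sub by blast
    show "\<beta>' (d u) = \<beta>' k \<otimes>\<^bsub>H\<^esub> \<beta>' (a u) \<otimes>\<^bsub>H\<^esub> inv\<^bsub>H\<^esub> \<beta>' k" if "u \<in> carrier L" for u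
      using that dk a H.m_inv_consistent[OF P(1) kP] \<beta>'.hom_mult \<beta>'.hom_inv
      by (simp add: hom_in_carrier)
  qed
  have "of_nat (card P) * class_mark (carrier L) a b (biset_comp p G H K (transitive_class p H K P \<beta>) X) =
    (\<Sum>c\<in>homs L (H\<lparr>carrier := P\<rparr>). ?n (\<lambda>u. \<beta> (c u)) * class_mark (carrier L) c b X)"
    by (rule class_mark_comp_coset_left[OF L fin a b X P])
  also have "\<dots> = (\<Sum>d\<in>homs L K. ?n d * ?m d)"
  proof (rule sum.reindex_bij_witness[where i = "\<lambda>d. \<lambda>u\<in>carrier L. \<beta>' (d u)" and j = "\<lambda>c. \<lambda>u\<in>carrier L. \<beta> (c u)"])
    fix c assume c: "c \<in> homs L (H\<lparr>carrier := P\<rparr>)"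
    have cP: "c u \<in> P" if "u \<in> carrier L" for u using c that by (auto simp: homs_def hom_def)
    show "(\<lambda>u\<in>carrier L. \<beta>' ((\<lambda>u\<in>carrier L. \<beta> (c u)) u)) = c"
      using c cP inverse(1) by (intro extensionalityI[of _ "carrier L"]) (auto simp: homs_def)
    show "(\<lambda>u\<in>carrier L. \<beta> (c u)) \<in> homs L K"
      using restrict_homs[OF L(1) hom_compose[OF homsD[OF c] P(2)]] by (simp add: comp_def)
    have "?m (\<lambda>u\<in>carrier L. \<beta> (c u)) = class_mark (carrier L) c b X"
      using cP inverse(1) by (intro class_mark_cong) auto
    moreover have "?n (\<lambda>u\<in>carrier L. \<beta> (c u)) = ?n (\<lambda>u. \<beta> (c u))" by simp
    ultimately show "?n (\<lambda>u\<in>carrier L. \<beta> (c u)) * ?m (\<lambda>u\<in>carrier L. \<beta> (c u)) =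
       ?n (\<lambda>u. \<beta> (c u)) * class_mark (carrier L) c b X" by simp
  next
    fix d assume d: "d \<in> homs L K"
    have dK: "d u \<in> carrier K" if "u \<in> carrier L" for u using d that by (auto simp: homs_def hom_def)
    show "(\<lambda>u\<in>carrier L. \<beta> ((\<lambda>u\<in>carrier L. \<beta>' (d u)) u)) = d"
      using d dK inverse(2) by (intro extensionalityI[of _ "carrier L"]) (auto simp: homs_def)
    show "(\<lambda>u\<in>carrier L. \<beta>' (d u)) \<in> homs L (H\<lparr>carrier := P\<rparr>)"
      using restrict_homs[OF L(1) hom_compose[OF homsD[OF d] \<beta>']] by (simp add: comp_def)
  qed
  also have "\<dots> = of_nat (card (carrier K)) * ?m a"
    by (rule sum_over_inverse_conjugates[OF L K.is_group fin(2) a, of ?m, OF inv])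
  finally show ?thesis using K0 cP by simp
qed

end

section \<open>Marks detect elements of the Grothendieck group\<close>

definition transitive_biset ::
    "('g, 'm) monoid_scheme \<Rightarrow> ('h, 'n) monoid_scheme \<Rightarrow> ('h, 'g, 'x) biset \<Rightarrow> bool" where
  "transitive_biset G H X \<longleftrightarrow> biset G H X \<and> points X \<noteq> {} \<and>
     (\<forall>x\<in>points X. points X = (\<lambda>a. action X a x) ` carrier (H \<times>\<times> G))"

lemma biset_action:
  assumes "group G" "group H" "biset G H X"
  shows "a \<in> carrier (H \<times>\<times> G) \<Longrightarrow> x \<in> points X \<Longrightarrow> action X a x \<in> points X"
    and "x \<in> points X \<Longrightarrow> action X \<one>\<^bsub>H \<times>\<times> G\<^esub> x = x"
    and "a \<in> carrier (H \<times>\<times> G) \<Longrightarrow> b \<in> carrier (H \<times>\<times> G) \<Longrightarrow> x \<in> points X \<Longrightarrow>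
      action X (a \<otimes>\<^bsub>H \<times>\<times> G\<^esub> b) x = action X a (action X b x)"
    and "a \<in> carrier (H \<times>\<times> G) \<Longrightarrow> action X a \<in> extensional (points X)"
    and "finite (points X)"
  using assms(3) unfolding biset_def group_action_iff[OF DirProd_group[OF assms(2,1)]] by blast+

lemma biset_action_inv:
  assumes "group G" "group H" "biset G H X" "a \<in> carrier (H \<times>\<times> G)" "x \<in> points X"
  shows "action X (inv\<^bsub>H \<times>\<times> G\<^esub> a) (action X a x) = x"
proof -
  interpret M: group "H \<times>\<times> G" by (rule DirProd_group[OF assms(2,1)])
  show ?thesis
    using biset_action[OF assms(1-3)] assms(4,5) M.inv_closed M.l_inv by metis
qed

definition restrict_biset :: "('h, 'g, 'x) biset \<Rightarrow> 'x set \<Rightarrow> ('h, 'g, 'x) biset" where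
  "restrict_biset X E = \<lparr>points = E, action = (\<lambda>a. restrict (action X a) E)\<rparr>"

lemma restrict_biset:
  assumes "group G" "group H" "biset G H X" and E: "E \<subseteq> points X"
    and inv: "\<And>a x. a \<in> carrier (H \<times>\<times> G) \<Longrightarrow> x \<in> E \<Longrightarrow> action X a x \<in> E"
  shows "biset G H (restrict_biset X E)"
proof -
  interpret M: group "H \<times>\<times> G" by (rule DirProd_group[OF assms(2,1)])
  note X = biset_action[OF assms(1-3)]
  show ?thesis
    unfolding biset_def group_action_iff[OF M.is_group]
    using X E inv finite_subset[OF E X(5)]
    by (simp add: restrict_biset_def subset_iff del: mult_DirProd one_DirProd carrier_DirProd)
qed

lemma biset_union_restrict:
  assumes "group G" "group H" "biset G H X" and E: "E \<subseteq> points X"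
    and inv: "\<And>a x. a \<in> carrier (H \<times>\<times> G) \<Longrightarrow> x \<in> E \<Longrightarrow> action X a x \<in> E"
    and inv': "\<And>a x. a \<in> carrier (H \<times>\<times> G) \<Longrightarrow> x \<in> points X - E \<Longrightarrow> action X a x \<in> points X - E"
  shows "biset_iso G H X (biset_union (restrict_biset X E) (restrict_biset X (points X - E)))"
  unfolding biset_iso_def
proof (intro exI[of _ "\<lambda>x. if x \<in> E then Inl x else Inr x"] conjI ballI)
  show "bij_betw (\<lambda>x. if x \<in> E then Inl x else Inr x) (points X)
    (points (biset_union (restrict_biset X E) (restrict_biset X (points X - E))))"
    by (rule bij_betw_byWitness[where f' = "case_sum id id"])
      (use E in \<open>auto simp: biset_union_def restrict_biset_def\<close>)
  fix a x assume a: "a \<in> carrier (H \<times>\<times> G)" and x: "x \<in> points X"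
  show "(if action X a x \<in> E then Inl (action X a x) else Inr (action X a x)) =
    action (biset_union (restrict_biset X E) (restrict_biset X (points X - E))) a
      (if x \<in> E then Inl x else Inr x)"
    using inv[OF a, of x] inv'[OF a, of x] x
    by (auto simp: biset_union_def restrict_biset_def)
qed

lemma biset_orbit:
  assumes "group G" "group H" "biset G H X" and x: "x \<in> points X"
  defines "E \<equiv> (\<lambda>a. action X a x) ` carrier (H \<times>\<times> G)"
  shows "E \<subseteq> points X" "x \<in> E"
    and "a \<in> carrier (H \<times>\<times> G) \<Longrightarrow> y \<in> E \<Longrightarrow> action X a y \<in> E"
    and "a \<in> carrier (H \<times>\<times> G) \<Longrightarrow> y \<in> points X - E \<Longrightarrow> action X a y \<in> points X - E"
    and "y \<in> E \<Longrightarrow> E = (\<lambda>a. action X a y) ` carrier (H \<times>\<times> G)"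
proof -
  interpret M: group "H \<times>\<times> G" by (rule DirProd_group[OF assms(2,1)])
  define m where "m = carrier (H \<times>\<times> G)"
  note X = biset_action[OF assms(1-3)]
  show E: "E \<subseteq> points X" using X(1) x unfolding E_def by blast
  show "x \<in> E" unfolding E_def using X(2)[OF x] M.one_closed by (metis imageI)
  have cl: "action X a y \<in> E" if ay: "a \<in> carrier (H \<times>\<times> G)" "y \<in> E" for a y
  proof -
    obtain b where b: "b \<in> carrier (H \<times>\<times> G)" "y = action X b x" using ay(2) unfolding E_def by blast
    then have "action X a y = action X (a \<otimes>\<^bsub>H \<times>\<times> G\<^esub> b) x" using X(3) ay(1) x by metis
    then show ?thesis unfolding E_def using M.m_closed[OF ay(1) b(1)] by blast
  qed
  then show "a \<in> carrier (H \<times>\<times> G) \<Longrightarrow> y \<in> E \<Longrightarrow> action X a y \<in> E" .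
  show "action X a y \<in> points X - E" if a: "a \<in> carrier (H \<times>\<times> G)" and y: "y \<in> points X - E"
  proof -
    have "action X a y \<notin> E"
      using cl[OF M.inv_closed[OF a], of "action X a y"] biset_action_inv[OF assms(1-3) a, of y] y by auto
    then show ?thesis using X(1) a y by blast
  qed
  show "E = (\<lambda>a. action X a y) ` carrier (H \<times>\<times> G)" if y: "y \<in> E"
  proof
    show "(\<lambda>a. action X a y) ` carrier (H \<times>\<times> G) \<subseteq> E" using cl y by blast
    obtain b where b: "b \<in> carrier (H \<times>\<times> G)" "y = action X b x" using y unfolding E_def by blast
    have xy: "x = action X (inv\<^bsub>H \<times>\<times> G\<^esub> b) y" unfolding b(2) using biset_action_inv[OF assms(1-3) b(1) x] by simp
    show "E \<subseteq> (\<lambda>a. action X a y) ` carrier (H \<times>\<times> G)"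
    proof
      fix z assume "z \<in> E"
      then obtain a where a: "a \<in> carrier (H \<times>\<times> G)" "z = action X a x" unfolding E_def by blast
      then have "z = action X (a \<otimes>\<^bsub>H \<times>\<times> G\<^esub> inv\<^bsub>H \<times>\<times> G\<^esub> b) y"
        using xy X(3)[OF a(1) M.inv_closed[OF b(1)], of y] y E by auto
      then show "z \<in> (\<lambda>a. action X a y) ` carrier (H \<times>\<times> G)"
        using M.m_closed[OF a(1) M.inv_closed[OF b(1)]] by blast
    qed
  qed
qed

text \<open>The empty biset is isomorphic to the disjoint union of two copies of itself, so its class vanishes.\<close>

lemma empty_biset_rels:
  assumes "prime p" "group G" "group H" "biset G H X" "points X = {}" "c \<in> Z_loc p"
  shows "Poly_Mapping.single X c \<in> biset_rels p G H"
proof -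
  note u = biset_union[OF assms(2,3,4,4)]
  note cu = nat_copy[OF assms(2,3) u]
  have "biset_iso G H (biset_union X X) X"
    unfolding biset_iso_def bij_betw_def using assms(5) by (simp add: biset_union_def Plus_def)
  then have "biset_iso G H (nat_copy (biset_union X X)) X"
    by (rule biset_iso_trans[OF assms(2,3) cu(1,3)])
  then have "Poly_Mapping.single (nat_copy (biset_union X X)) c - Poly_Mapping.single X c \<in> biset_rels p G H"
    by (intro rels_iso cu assms)
  moreover have "- (Poly_Mapping.single (nat_copy (biset_union X X)) c - Poly_Mapping.single X c
      - Poly_Mapping.single X c) \<in> biset_rels p G H"
    by (intro rels_uminus rels_union assms)
  ultimately have "(Poly_Mapping.single (nat_copy (biset_union X X)) c - Poly_Mapping.single X c) +
    - (Poly_Mapping.single (nat_copy (biset_union X X)) c - Poly_Mapping.single X c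
      - Poly_Mapping.single X c) \<in> biset_rels p G H"
    by (rule rels_add)
  then show ?thesis by simp
qed

text \<open>Splits off one orbit at a time.\<close>

lemma single_transitive_decomposition:
  fixes G :: "('g, 'm) monoid_scheme" and H :: "('h, 'n) monoid_scheme" and X :: "('h, 'g) nbiset"
  assumes p: "prime p" and G: "group G" and H: "group H" and c: "c \<in> Z_loc p"
    and "biset G H X"
  shows "\<exists>y\<in>biset_combs p G H. Poly_Mapping.single X c - y \<in> biset_rels p G H \<and>
    (\<forall>B\<in>Poly_Mapping.keys y. transitive_biset G H B)"
  using assms(5)
proof (induction "card (points X)" arbitrary: X rule: less_induct)
  case less
  note X = biset_action[OF G H less.prems]
  show ?case
  proof (cases "points X = {}")
    case True
    then show ?thesis
      using empty_biset_rels[OF p G H less.prems True c] by (intro bexI[of _ 0] combs_0 p) simp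
  next
    case False
    then obtain x where x: "x \<in> points X" by blast
    define E where "E = (\<lambda>a. action X a x) ` carrier (H \<times>\<times> G)"
    note E = biset_orbit[OF G H less.prems x, folded E_def]
    have rE: "biset G H (restrict_biset X E)"
      by (rule restrict_biset[OF G H less.prems E(1,3)])
    have rE': "biset G H (restrict_biset X (points X - E))"
      by (rule restrict_biset[OF G H less.prems _ E(4)]) auto
    have "E = (\<lambda>a. restrict (action X a) E y) ` carrier (H \<times>\<times> G)" if "y \<in> E" for y
      using E(5)[OF that] that by simp
    then have trE: "transitive_biset G H (restrict_biset X E)"
      unfolding transitive_biset_def using rE E(2) by (auto simp: restrict_biset_def)
    have "card (points X - E) < card (points X)"
      using X(5) E(1,2) by (intro psubset_card_mono) auto
    then obtain y where y: "y \<in> biset_combs p G H"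
      "Poly_Mapping.single (restrict_biset X (points X - E)) c - y \<in> biset_rels p G H"
      "\<forall>B\<in>Poly_Mapping.keys y. transitive_biset G H B"
      using less.hyps[of "restrict_biset X (points X - E)"] rE' by (auto simp: restrict_biset_def)
    let ?U = "biset_union (restrict_biset X E) (restrict_biset X (points X - E))"
    note U = biset_union[OF G H rE rE']
    have "biset_iso G H X (nat_copy ?U)"
      by (rule biset_iso_trans[OF G H less.prems
        biset_union_restrict[OF G H less.prems E(1,3,4)] nat_copy(2)[OF G H U]])
    then have "Poly_Mapping.single X c - Poly_Mapping.single (nat_copy ?U) c \<in> biset_rels p G H"
      by (intro rels_iso less.prems nat_copy(1)[OF G H U] c)
    moreover have "Poly_Mapping.single (nat_copy ?U) c - Poly_Mapping.single (restrict_biset X E) c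
        - Poly_Mapping.single (restrict_biset X (points X - E)) c \<in> biset_rels p G H"
      by (intro rels_union rE rE' c)
    ultimately have "Poly_Mapping.single X c - Poly_Mapping.single (nat_copy ?U) c +
        (Poly_Mapping.single (nat_copy ?U) c - Poly_Mapping.single (restrict_biset X E) c
        - Poly_Mapping.single (restrict_biset X (points X - E)) c) +
        (Poly_Mapping.single (restrict_biset X (points X - E)) c - y) \<in> biset_rels p G H"
      using y(2) by (intro rels_add)
    then have "Poly_Mapping.single X c - (Poly_Mapping.single (restrict_biset X E) c + y) \<in> biset_rels p G H"
      by (simp add: algebra_simps)
    moreover have "Poly_Mapping.single (restrict_biset X E) c + y \<in> biset_combs p G H"
      by (intro combs_add combs_single p rE c y)
    moreover have "\<forall>B\<in>Poly_Mapping.keys (Poly_Mapping.single (restrict_biset X E) c + y). transitive_biset G H B"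
      using keys_add[of "Poly_Mapping.single (restrict_biset X E) c" y] y(3) trE
      by (auto split: if_splits)
    ultimately show ?thesis by blast
  qed
qed

lemma poly_mapping_eq_sum_single: "x = (\<Sum>B\<in>Poly_Mapping.keys x. Poly_Mapping.single B (Poly_Mapping.lookup x B))"
  by (rule poly_mapping_eqI) (simp add: lookup_sum lookup_single when_def in_keys_iff)

lemma transitive_decomposition:
  fixes G :: "('g, 'm) monoid_scheme" and H :: "('h, 'n) monoid_scheme"
  assumes p: "prime p" and G: "group G" and H: "group H" and x: "x \<in> biset_combs p G H"
  shows "\<exists>y\<in>biset_combs p G H. x - y \<in> biset_rels p G H \<and>
    (\<forall>B\<in>Poly_Mapping.keys y. transitive_biset G H B)"
proof -
  let ?s = "\<lambda>B. Poly_Mapping.single B (Poly_Mapping.lookup x B)"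
  have "\<forall>B\<in>Poly_Mapping.keys x. \<exists>y. y \<in> biset_combs p G H \<and> ?s B - y \<in> biset_rels p G H \<and>
    (\<forall>B\<in>Poly_Mapping.keys y. transitive_biset G H B)"
    using single_transitive_decomposition[OF p G H] x by (fastforce simp: biset_combs_def)
  then obtain y where y: "\<And>B. B \<in> Poly_Mapping.keys x \<Longrightarrow> y B \<in> biset_combs p G H"
    "\<And>B. B \<in> Poly_Mapping.keys x \<Longrightarrow> ?s B - y B \<in> biset_rels p G H"
    "\<And>B C. B \<in> Poly_Mapping.keys x \<Longrightarrow> C \<in> Poly_Mapping.keys (y B) \<Longrightarrow> transitive_biset G H C"
    by metis
  show ?thesis
  proof (intro bexI[of _ "\<Sum>B\<in>Poly_Mapping.keys x. y B"] conjI)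
    show "(\<Sum>B\<in>Poly_Mapping.keys x. y B) \<in> biset_combs p G H"
      by (intro combs_sum p y)
    have "(\<Sum>B\<in>Poly_Mapping.keys x. ?s B - y B) \<in> biset_rels p G H"
      by (intro rels_sum y)
    then show "x - (\<Sum>B\<in>Poly_Mapping.keys x. y B) \<in> biset_rels p G H"
      using poly_mapping_eq_sum_single[of x] by (simp add: sum_subtractf)
    show "\<forall>B\<in>Poly_Mapping.keys (\<Sum>B\<in>Poly_Mapping.keys x. y B). transitive_biset G H B"
    proof
      fix C assume "C \<in> Poly_Mapping.keys (\<Sum>B\<in>Poly_Mapping.keys x. y B)"
      then have "(\<Sum>B\<in>Poly_Mapping.keys x. Poly_Mapping.lookup (y B) C) \<noteq> 0"
        by (simp add: in_keys_iff lookup_sum)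
      then obtain B where "B \<in> Poly_Mapping.keys x" "Poly_Mapping.lookup (y B) C \<noteq> 0"
        by (meson sum.neutral)
      then show "transitive_biset G H C" using y(3) by (simp add: in_keys_iff)
    qed
  qed
qed

text \<open>A point \<open>z\<close> of \<open>C\<close> that is fixed by the stabilizer of \<open>x\<close> yields an equivariant map \<open>a x \<mapsto> a z\<close>; it is
onto since \<open>C\<close> is transitive, and bijective if \<open>C\<close> is at least as large as \<open>B\<close>.\<close>

lemma transitive_iso_if_fixed:
  assumes G: "group G" and H: "group H" and B: "transitive_biset G H B" and C: "transitive_biset G H C"
    and card: "card (points B) \<le> card (points C)"
    and x: "x \<in> points B" and z: "z \<in> points C"
    and fixed: "\<And>a. a \<in> carrier (H \<times>\<times> G) \<Longrightarrow> action B a x = x \<Longrightarrow> action C a z = z"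
  shows "biset_iso G H B C"
proof -
  interpret M: group "H \<times>\<times> G" by (rule DirProd_group[OF H G])
  have bB: "biset G H B" and bC: "biset G H C" using B C by (auto simp: transitive_biset_def)
  note XB = biset_action[OF G H bB] and XC = biset_action[OF G H bC]
  have oB: "points B = (\<lambda>a. action B a x) ` carrier (H \<times>\<times> G)"
    and oC: "points C = (\<lambda>a. action C a z) ` carrier (H \<times>\<times> G)"
    using B C x z unfolding transitive_biset_def by blast+
  define f where "f w = action C (SOME a. a \<in> carrier (H \<times>\<times> G) \<and> action B a x = w) z" for w
  have f: "f (action B a x) = action C a z" if a: "a \<in> carrier (H \<times>\<times> G)" for a
  proof -
    define b where "b = (SOME b. b \<in> carrier (H \<times>\<times> G) \<and> action B b x = action B a x)"
    have b: "b \<in> carrier (H \<times>\<times> G)" "action B b x = action B a x"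
      unfolding b_def using someI[of "\<lambda>b. b \<in> carrier (H \<times>\<times> G) \<and> action B b x = action B a x" a] a by blast+
    note ia = M.inv_closed[OF a]
    have "action B (inv\<^bsub>H \<times>\<times> G\<^esub> a \<otimes>\<^bsub>H \<times>\<times> G\<^esub> b) x = x"
      using XB(3)[OF ia b(1) x] b(2) biset_action_inv[OF G H bB a x] by simp
    then have "action C (inv\<^bsub>H \<times>\<times> G\<^esub> a) (action C b z) = z"
      using fixed[OF M.m_closed[OF ia b(1)]] XC(3)[OF ia b(1) z] by simp
    then have "action C a z = action C (a \<otimes>\<^bsub>H \<times>\<times> G\<^esub> inv\<^bsub>H \<times>\<times> G\<^esub> a) (action C b z)"
      using XC(3)[OF a ia XC(1)[OF b(1) z]] by simp
    also have "\<dots> = action C b z" using XC(1,2) b(1) z M.r_inv[OF a] by simp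
    finally show ?thesis by (simp add: f_def b_def)
  qed
  have surj: "f ` points B = points C"
    unfolding oB oC image_image by (rule image_cong) (simp_all add: f del: carrier_DirProd)
  then have "card (points B) = card (f ` points B)"
    using card card_image_le[OF XB(5), of f] by simp
  then have "inj_on f (points B)" using eq_card_imp_inj_on[OF XB(5), of f] by simp
  then have "bij_betw f (points B) (points C)" using surj by (simp add: bij_betw_def)
  moreover have "f (action B a y) = action C a (f y)" if a: "a \<in> carrier (H \<times>\<times> G)" and y: "y \<in> points B" for a y
  proof -
    obtain b where b: "b \<in> carrier (H \<times>\<times> G)" "y = action B b x" using y oB by blast
    have "action B a y = action B (a \<otimes>\<^bsub>H \<times>\<times> G\<^esub> b) x" using XB(3)[OF a b(1) x] b(2) by simp
    then show ?thesis using f[OF M.m_closed[OF a b(1)]] f[OF b(1)] XC(3)[OF a b(1) z] b(2) by simp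
  qed
  ultimately show ?thesis unfolding biset_iso_def by blast
qed

lemma stabilizer_biset_subgroup:
  assumes G: "group G" and H: "group H" and B: "biset G H B" and x: "x \<in> points B"
  shows "subgroup {a \<in> carrier (H \<times>\<times> G). action B a x = x} (H \<times>\<times> G)"
proof -
  interpret M: group "H \<times>\<times> G" by (rule DirProd_group[OF H G])
  note X = biset_action[OF G H B]
  show ?thesis
  proof (rule M.subgroupI)
    show "{a \<in> carrier (H \<times>\<times> G). action B a x = x} \<noteq> {}" using X(2)[OF x] M.one_closed by blast
    fix a assume a: "a \<in> {a \<in> carrier (H \<times>\<times> G). action B a x = x}"
    show "inv\<^bsub>H \<times>\<times> G\<^esub> a \<in> {a \<in> carrier (H \<times>\<times> G). action B a x = x}"
      using a biset_action_inv[OF G H B, of a x] x M.inv_closed by auto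
    fix b assume b: "b \<in> {a \<in> carrier (H \<times>\<times> G). action B a x = x}"
    show "a \<otimes>\<^bsub>H \<times>\<times> G\<^esub> b \<in> {a \<in> carrier (H \<times>\<times> G). action B a x = x}"
      using a b X(3)[of a b x] x M.m_closed by auto
  qed auto
qed

text \<open>Burnside's argument: choose a representative with as few terms as
possible among those that consist of transitive bisets. Then these are pairwise non-isomorphic. If
there are any, the stabilizer of a point in a smallest one, \<open>B\<close>, has no fixed points on the others by
\<open>transitive_iso_if_fixed\<close>, so the mark at this stabilizer is a nonzero multiple of the
coefficient of \<open>B\<close>.\<close>

lemma zero_marks_rels:
  fixes G :: "('g, 'm) monoid_scheme" and H :: "('h, 'n) monoid_scheme"
  assumes p: "prime p" and G: "group G" and H: "group H" and x: "x \<in> biset_combs p G H"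
    and zero: "\<And>D. subgroup D (H \<times>\<times> G) \<Longrightarrow> linear_ext (\<lambda>B. of_nat (mark D fst snd B)) x = 0"
  shows "x \<in> biset_rels p G H"
proof -
  let ?P = "\<lambda>y. y \<in> biset_combs p G H \<and> x - y \<in> biset_rels p G H \<and>
    (\<forall>B\<in>Poly_Mapping.keys y. transitive_biset G H B)"
  obtain y0 where "?P y0" using transitive_decomposition[OF p G H x] by blast
  then obtain y where y: "?P y" and least: "\<And>y'. ?P y' \<Longrightarrow> card (Poly_Mapping.keys y) \<le> card (Poly_Mapping.keys y')"
    using ex_has_least_nat[of ?P y0 "\<lambda>y. card (Poly_Mapping.keys y)"] by blast
  have tr: "\<And>B. B \<in> Poly_Mapping.keys y \<Longrightarrow> transitive_biset G H B" using y by blast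
  have bs: "\<And>B. B \<in> Poly_Mapping.keys y \<Longrightarrow> biset G H B" using tr by (auto simp: transitive_biset_def)
  have noniso: "\<not> biset_iso G H B C"
    if BC: "B \<in> Poly_Mapping.keys y" "C \<in> Poly_Mapping.keys y" "B \<noteq> C" for B C
  proof
    assume iso: "biset_iso G H B C"
    let ?c = "Poly_Mapping.lookup y C"
    have c: "?c \<in> Z_loc p" using y by (auto simp: biset_combs_def)
    \<comment> \<open>Moving the coefficient of \<open>C\<close> to \<open>B\<close> removes a term.\<close>
    define y' where "y' = y + (Poly_Mapping.single B ?c - Poly_Mapping.single C ?c)"
    have r: "Poly_Mapping.single B ?c - Poly_Mapping.single C ?c \<in> biset_rels p G H"
      by (intro rels_iso bs BC iso c)
    have keys: "Poly_Mapping.keys y' \<subseteq> Poly_Mapping.keys y - {C}"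
      using BC by (auto simp: y'_def in_keys_iff lookup_add lookup_minus lookup_single when_def split: if_splits)
    have "x - y' = (x - y) + - (Poly_Mapping.single B ?c - Poly_Mapping.single C ?c)"
      by (simp add: y'_def)
    also have "\<dots> \<in> biset_rels p G H" using y by (intro rels_add rels_uminus p r) blast
    finally have "x - y' \<in> biset_rels p G H" .
    moreover have "y' \<in> biset_combs p G H"
      unfolding y'_def using y by (intro combs_add combs_diff combs_single p bs BC c) blast
    ultimately have "card (Poly_Mapping.keys y) \<le> card (Poly_Mapping.keys y')"
      using keys tr by (intro least) blast
    moreover have "card (Poly_Mapping.keys y') < card (Poly_Mapping.keys y)"
      using keys BC(2) by (intro psubset_card_mono) auto
    ultimately show False by simp
  qed
  have "Poly_Mapping.keys y = {}"
  proof (rule ccontr)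
    assume "Poly_Mapping.keys y \<noteq> {}"
    then obtain B0 where "B0 \<in> Poly_Mapping.keys y" by blast
    then obtain B where B: "B \<in> Poly_Mapping.keys y"
      and minB: "\<And>C. C \<in> Poly_Mapping.keys y \<Longrightarrow> card (points B) \<le> card (points C)"
      using ex_has_least_nat[of "\<lambda>B. B \<in> Poly_Mapping.keys y" B0 "\<lambda>B. card (points B)"] by blast
    obtain x0 where x0: "x0 \<in> points B" using tr[OF B] by (auto simp: transitive_biset_def)
    let ?D = "{a \<in> carrier (H \<times>\<times> G). action B a x0 = x0}"
    have D: "subgroup ?D (H \<times>\<times> G)" by (rule stabilizer_biset_subgroup[OF G H bs[OF B] x0])
    have other: "mark ?D fst snd C = 0" if C: "C \<in> Poly_Mapping.keys y" "C \<noteq> B" for C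
    proof -
      have "z \<notin> fixed_points ?D fst snd C" for z
      proof
        assume "z \<in> fixed_points ?D fst snd C"
        then have z: "z \<in> points C"
          and fz: "\<And>a. a \<in> carrier (H \<times>\<times> G) \<Longrightarrow> action B a x0 = x0 \<Longrightarrow> action C a z = z"
          by (auto simp: fixed_points_def simp del: carrier_DirProd)
        have "biset_iso G H B C"
          by (rule transitive_iso_if_fixed[OF G H tr[OF B] tr[OF C(1)] minB[OF C(1)] x0 z fz])
        then show False using noniso[OF B C(1)] C(2) by blast
      qed
      then have "fixed_points ?D fst snd C = {}" by blast
      then show ?thesis unfolding mark_def by (simp only: card.empty)
    qed
    have "x0 \<in> fixed_points ?D fst snd B" using x0 by (auto simp: fixed_points_def)
    moreover have "finite (fixed_points ?D fst snd B)"
      using biset_action(5)[OF G H bs[OF B]] by (simp add: fixed_points_def)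
    ultimately have pos: "mark ?D fst snd B \<noteq> 0" by (auto simp: mark_def)
    have "fst \<in> ?D \<rightarrow> carrier H" "snd \<in> ?D \<rightarrow> carrier G" by auto
    from mark_rels[OF G H this] y have "linear_ext (\<lambda>B. of_nat (mark ?D fst snd B)) (x - y) = 0" by blast
    then have "0 = linear_ext (\<lambda>B. of_nat (mark ?D fst snd B)) y"
      using zero[OF D] by (simp add: linear_ext_diff)
    also have "\<dots> = (\<Sum>C\<in>{B}. Poly_Mapping.lookup y C * of_nat (mark ?D fst snd C))"
      unfolding linear_ext_def using B other by (intro sum.mono_neutral_right) auto
    finally show False using pos B by (simp add: in_keys_iff)
  qed
  then have "y = 0" by simp
  then show ?thesis using y by simp
qed

theorem class_mark_eqI:
  assumes p: "prime p" and G: "group G" and H: "group H"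
    and Z: "Z \<in> biset_module p G H" "Z' \<in> biset_module p G H"
    and eq: "\<And>D. subgroup D (H \<times>\<times> G) \<Longrightarrow> class_mark D fst snd Z = class_mark D fst snd Z'"
  shows "Z = Z'"
proof -
  obtain z z' where z: "z \<in> Z" "z' \<in> Z'"
    using biset_module_nonempty[OF p Z(1)] biset_module_nonempty[OF p Z(2)] by metis
  note r = biset_module_rep[OF p Z(1) z(1)] and r' = biset_module_rep[OF p Z(2) z(2)]
  have "z - z' \<in> biset_rels p G H"
  proof (rule zero_marks_rels[OF p G H combs_diff[OF p r(1) r'(1)]])
    fix D assume D: "subgroup D (H \<times>\<times> G)"
    then have f: "fst \<in> D \<rightarrow> carrier H" "snd \<in> D \<rightarrow> carrier G" using subgroup.subset[OF D] by auto
    show "linear_ext (\<lambda>B. of_nat (mark D fst snd B)) (z - z') = 0"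
      using eq[OF D] class_mark_eq[OF p G H Z(1) z(1) f] class_mark_eq[OF p G H Z(2) z(2) f]
      by (simp add: linear_ext_diff)
  qed
  then show ?thesis
    unfolding r(2) r'(2) using r(1) r'(1)
    by (intro equiv_class_eq[OF equiv_biset_cong[OF p]]) (simp add: biset_cong_def)
qed

section \<open>Fixed points of p-groups\<close>

text \<open>An orbit that is not a fixed point has a size divisible by \<open>p\<close>.\<close>

lemma p_group_fixed_points:
  assumes "prime p" "p_group p L" "group_action L E \<phi>" "finite E"
  shows "int p dvd int (card E) - int (card {x \<in> E. \<forall>u\<in>carrier L. \<phi> u x = x})"
proof -
  interpret A: group_action L E \<phi> by fact
  interpret L: group L using assms(2) by (simp add: p_group_def)
  obtain n where n: "order L = p ^ n" using assms(2) by (auto simp: p_group_def)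
  let ?F = "{x \<in> E. \<forall>u\<in>carrier L. \<phi> u x = x}"
  let ?f = "\<lambda>x. if \<forall>u\<in>carrier L. \<phi> u x = x then 0 else 1 :: int"
  have "int (card E) - int (card ?F) = (\<Sum>x\<in>E. 1 - of_bool (\<forall>u\<in>carrier L. \<phi> u x = x))"
    using assms(4) by (simp add: sum_subtractf Int_def)
  also have "\<dots> = (\<Sum>x\<in>E. ?f x)" by (intro sum.cong) auto
  also have "\<dots> = (\<Sum>orb\<in>orbits L E \<phi>. \<Sum>x\<in>orb. ?f x)"
    by (rule A.disjoint_sum[OF assms(4), symmetric])
  also have "int p dvd \<dots>"
  proof (rule dvd_sum)
    fix orb assume "orb \<in> orbits L E \<phi>"
    then obtain x where x: "x \<in> E" "orb = orbit L \<phi> x" by (auto simp: orbits_def)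
    have self: "x \<in> orbit L \<phi> x" using A.orbit_refl[OF x(1)] .
    have fixed: "orbit L \<phi> y = {y}" if "\<forall>u\<in>carrier L. \<phi> u y = y" for y
      using that L.one_closed unfolding orbit_def by (auto intro!: exI[of _ "\<one>\<^bsub>L\<^esub>"])
    show "int p dvd (\<Sum>x\<in>orb. ?f x)"
    proof (cases "\<forall>u\<in>carrier L. \<phi> u x = x")
      case True
      then show ?thesis using fixed[OF True] x(2) by simp
    next
      case False
      have "?f y = 1" if y: "y \<in> orb" for y
      proof -
        have yE: "y \<in> E" using y x A.element_image by (auto simp: orbit_def)
        have "x \<in> orbit L \<phi> y" using A.orbit_sym[OF x(1) yE] y x(2) by simp
        then have "\<not> (\<forall>u\<in>carrier L. \<phi> u y = y)" using fixed[of y] False by (metis singletonD)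
        then show ?thesis by simp
      qed
      then have "(\<Sum>x\<in>orb. ?f x) = int (card orb)" by simp
      moreover have "card orb dvd p ^ n"
        using A.orbit_stabilizer_theorem[OF x(1)] n x(2) by (metis dvd_triv_left)
      then obtain k where k: "card orb = p ^ k" using divides_primepow_nat[OF assms(1)] by blast
      have "k \<noteq> 0"
      proof
        assume "k = 0"
        then have "orb = {x}" using k self x(2) by (metis card_1_singletonE power_0 singletonD)
        then show False using False x(2) by (auto simp: orbit_def)
      qed
      then have "p dvd card orb" using k by (simp add: dvd_power)
      ultimately show ?thesis by simp
    qed
  qed
  finally show ?thesis .
qed

text \<open>The sum of the marks along all pairs \<open>(c, b)\<close> counts, up to the factor \<open>|H|\<close>, the left orbits of
\<open>X\<close> that are fixed by \<open>L\<close>. For a p-group \<open>L\<close> this number is congruent to the number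
\<open>|X| / |H|\<close> of all left orbits.\<close>

lemma left_orbits_congruence:
  fixes G :: "('g, 'm) monoid_scheme" and H :: "('h, 'n) monoid_scheme" and L :: "('l, 'q) monoid_scheme"
  assumes p: "prime p" and G: "group G" and H: "group H" "finite (carrier H)"
    and XB: "biset G H X" and lf: "left_free G H X" and L: "p_group p L" and b: "b \<in> hom L G"
  shows "\<exists>N N0. (\<Sum>c\<in>homs L H. mark (carrier L) c b X) = card (carrier H) * N \<and>
    card (points X) = card (carrier H) * N0 \<and> int p dvd int N0 - int N"
proof -
  \<comment> \<open>The orbits of \<open>H\<close> on \<open>X\<close> are the points of the composite of \<open>X\<close> with the one-point biset.\<close>
  define K :: "unit monoid" where "K = \<lparr>carrier = {()}, monoid.mult = (\<lambda>_ _. ()), one = ()\<rparr>"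
  define Y :: "(unit, 'h, unit) biset" where "Y = \<lparr>points = {()}, action = (\<lambda>_. \<lambda>_\<in>{()}. ())\<rparr>"
  have K: "group K" by (rule groupI) (simp_all add: K_def)
  interpret L: group L using L by (simp add: p_group_def)
  have fL: "finite (carrier L)" using L by (simp add: p_group_def)
  have YB: "biset H K Y" unfolding biset_iff[OF H(1) K] by (auto simp: Y_def K_def)
  interpret biset_pair G H K Y X
    using G H(1) K YB XB by (intro biset_pair.intro biset_pair_axioms.intro)
  let ?T = "biset_tensor G H K Y X"
  note T = biset_action[OF G.is_group K.is_group biset_tensor]
  have Ymark: "mark M a c Y = 1" for M :: "'z set" and a c by (simp add: mark_def fixed_points_def Y_def)
  have a: "(\<lambda>_. ()) \<in> hom L K" by (simp add: hom_def K_def)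
  have N: "(\<Sum>c\<in>homs L H. mark (carrier L) c b X) = card (carrier H) * mark (carrier L) (\<lambda>_. ()) b ?T"
    using mark_tensor[OF L.is_group fL H(2) a b lf] by (simp add: Ymark)
  have fK: "finite (carrier K)" by (simp add: K_def)
  \<comment> \<open>The number of all orbits is the mark along the trivial group, for which \<open>K\<close> itself is used.\<close>
  have e: "(\<lambda>_. ()) \<in> hom K K" "(\<lambda>_. \<one>\<^bsub>G\<^esub>) \<in> hom K G" by (simp_all add: hom_def K_def)
  have "homs K H = {\<lambda>_. \<one>\<^bsub>H\<^esub>}"
  proof -
    have "c = (\<lambda>_. \<one>\<^bsub>H\<^esub>)" if "c \<in> homs K H" for c
      using hom_one[OF homsD[OF that] K H(1)] by (intro ext) (simp add: K_def)
    moreover have "(\<lambda>_. \<one>\<^bsub>H\<^esub>) \<in> homs K H"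
      by (auto simp: homs_def hom_def K_def extensional_def)
    ultimately show ?thesis by blast
  qed
  then have "card (carrier H) * mark (carrier K) (\<lambda>_. ()) (\<lambda>_. \<one>\<^bsub>G\<^esub>) ?T =
      mark (carrier K) (\<lambda>_. \<one>\<^bsub>H\<^esub>) (\<lambda>_. \<one>\<^bsub>G\<^esub>) X"
    using mark_tensor[OF K fK H(2) e lf] by (simp add: Ymark)
  moreover have "mark (carrier K) (\<lambda>_. \<one>\<^bsub>H\<^esub>) (\<lambda>_. \<one>\<^bsub>G\<^esub>) X = card (points X)"
    unfolding mark_def fixed_points_def using Xone by (intro arg_cong[where f = card]) auto
  moreover have "mark (carrier K) (\<lambda>_. ()) (\<lambda>_. \<one>\<^bsub>G\<^esub>) ?T = card (points ?T)"
    unfolding mark_def fixed_points_def using T(2) by (intro arg_cong[where f = card]) (auto simp: K_def)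
  ultimately have N0: "card (points X) = card (carrier H) * card (points ?T)" by simp
  have "group_action L (points ?T) (\<lambda>u. action ?T ((), b u))"
    unfolding group_action_iff[OF L.is_group]
  proof (intro conjI ballI)
    have bK: "((), b u) \<in> carrier (K \<times>\<times> G)" if "u \<in> carrier L" for u
      using that b by (simp add: K_def hom_in_carrier)
    show "action ?T ((), b u) \<in> extensional (points ?T)" if "u \<in> carrier L" for u
      using T(4) bK[OF that] by blast
    show "action ?T ((), b u) x \<in> points ?T" if "u \<in> carrier L" "x \<in> points ?T" for u x
      using T(1) bK[OF that(1)] that(2) by blast
    show "action ?T ((), b \<one>\<^bsub>L\<^esub>) x = x" if "x \<in> points ?T" for x
      using T(2)[OF that] hom_one[OF b L.is_group G] by (simp add: K_def)
    show "action ?T ((), b (u \<otimes>\<^bsub>L\<^esub> v)) x = action ?T ((), b u) (action ?T ((), b v) x)"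
      if "u \<in> carrier L" "v \<in> carrier L" "x \<in> points ?T" for u v x
      using T(3)[OF bK[OF that(1)] bK[OF that(2)] that(3)] b that by (simp add: K_def hom_mult)
  qed
  from p_group_fixed_points[OF p L this T(5)]
  have "int p dvd int (card (points ?T)) - int (mark (carrier L) (\<lambda>_. ()) b ?T)"
    by (simp add: mark_def fixed_points_def)
  with N N0 show ?thesis by blast
qed

lemma prime_inverse_not_Z_loc:
  assumes "prime p" "w \<in> Z_loc p"
  shows "of_nat p * w \<noteq> 1"
proof
  assume pw: "of_nat p * w = 1"
  obtain a b where ab: "w = of_int a / of_int b" "\<not> int p dvd b"
    using assms(2) by (auto simp: Z_loc_def)
  have "b \<noteq> 0" using ab(2) by auto
  then have "rat_of_int (int p * a) = of_int b" using pw ab(1) by (simp add: field_simps)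
  then have "int p * a = b" by (simp only: of_int_eq_iff)
  then show False using ab(2) by auto
qed

text \<open>By \<open>left_orbits_congruence\<close>, the sum divided by \<open>|S|\<close> is congruent modulo \<open>p\<close> to the augmentation
of \<open>X\<close>, which is a unit.\<close>

lemma left_orbits_nonzero:
  fixes S :: "('a, 'b) monoid_scheme" and L :: "('l, 'q) monoid_scheme"
  assumes p: "prime p" and S: "group S" "finite (carrier S)"
    and X: "X \<in> biset_module p S S" "left_free_class S S X"
    and unit: "v \<in> Z_loc p" "augmentation S X * v = 1"
    and L: "p_group p L" and b: "b \<in> hom L S"
  shows "(\<Sum>c\<in>homs L S. class_mark (carrier L) c b X) \<noteq> 0"
proof
  assume zero: "(\<Sum>c\<in>homs L S. class_mark (carrier L) c b X) = 0"
  obtain x where x: "x \<in> X" "\<And>B. B \<in> Poly_Mapping.keys x \<Longrightarrow> left_free S S B"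
    using X(2) by (auto simp: left_free_class_def)
  have S0: "rat_of_nat (card (carrier S)) \<noteq> 0" using S group.is_monoid[OF S(1)] monoid.one_closed by fastforce
  have xc: "\<And>B. B \<in> Poly_Mapping.keys x \<Longrightarrow> biset S S B" "\<And>B. Poly_Mapping.lookup x B \<in> Z_loc p"
    using biset_module_rep(1)[OF p X(1) x(1)] by (auto simp: biset_combs_def)
  have "\<exists>N N0. (\<Sum>c\<in>homs L S. mark (carrier L) c b B) = card (carrier S) * N \<and>
      card (points B) = card (carrier S) * N0 \<and> int p dvd int N0 - int N"
    if "B \<in> Poly_Mapping.keys x" for B
    by (rule left_orbits_congruence[OF p S(1) S xc(1)[OF that] x(2)[OF that] L b])
  then obtain N N0 where N: "\<And>B. B \<in> Poly_Mapping.keys x \<Longrightarrow>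
      (\<Sum>c\<in>homs L S. mark (carrier L) c b B) = card (carrier S) * N B"
    "\<And>B. B \<in> Poly_Mapping.keys x \<Longrightarrow> card (points B) = card (carrier S) * N0 B"
    "\<And>B. B \<in> Poly_Mapping.keys x \<Longrightarrow> int p dvd int (N0 B) - int (N B)"
    by metis
  define q where "q B = (int (N0 B) - int (N B)) div int p" for B
  have q: "rat_of_nat (N0 B) - of_nat (N B) = of_nat p * of_int (q B)" if "B \<in> Poly_Mapping.keys x" for B
  proof -
    have "int (N0 B) - int (N B) = int p * q B" using N(3)[OF that] by (simp add: q_def)
    then have "rat_of_int (int (N0 B) - int (N B)) = of_int (int p * q B)" by simp
    then show ?thesis by simp
  qed
  have "0 = (\<Sum>c\<in>homs L S. linear_ext (\<lambda>B. of_nat (mark (carrier L) c b B)) x)"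
    unfolding zero[symmetric]
    by (intro sum.cong refl class_mark_eq[OF p S(1) S(1) X(1) x(1)] hom_funcset homsD b)
  also have "\<dots> = (\<Sum>B\<in>Poly_Mapping.keys x. Poly_Mapping.lookup x B *
      of_nat (\<Sum>c\<in>homs L S. mark (carrier L) c b B))"
    unfolding linear_ext_def by (subst sum.swap) (simp add: sum_distrib_left)
  also have "\<dots> = (\<Sum>B\<in>Poly_Mapping.keys x. Poly_Mapping.lookup x B * (of_nat (card (carrier S)) * of_nat (N B)))"
    using N(1) by (intro sum.cong refl) simp
  also have "\<dots> = of_nat (card (carrier S)) * (\<Sum>B\<in>Poly_Mapping.keys x. Poly_Mapping.lookup x B * of_nat (N B))"
    by (simp add: sum_distrib_left mult_ac)
  finally have N_zero: "(\<Sum>B\<in>Poly_Mapping.keys x. Poly_Mapping.lookup x B * of_nat (N B)) = 0" using S0 by simp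
  have "augmentation S X = comb_augmentation S x"
    by (rule augmentation_rep[OF p S(1) X(1) x])
  also have "\<dots> = (\<Sum>B\<in>Poly_Mapping.keys x. Poly_Mapping.lookup x B * of_nat (N0 B))"
    unfolding comb_augmentation_def using N(2) S0 by (intro sum.cong refl) (simp add: order_def)
  also have "\<dots> = (\<Sum>B\<in>Poly_Mapping.keys x. Poly_Mapping.lookup x B * (of_nat (N0 B) - of_nat (N B)))"
    using N_zero by (simp add: right_diff_distrib sum_subtractf)
  also have "\<dots> = of_nat p * (\<Sum>B\<in>Poly_Mapping.keys x. Poly_Mapping.lookup x B * of_int (q B))"
    using q by (simp add: sum_distrib_left mult_ac)
  finally have aug: "augmentation S X = of_nat p * (\<Sum>B\<in>Poly_Mapping.keys x. Poly_Mapping.lookup x B * of_int (q B))" .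
  have "(\<Sum>B\<in>Poly_Mapping.keys x. Poly_Mapping.lookup x B * of_int (q B)) * v \<in> Z_loc p"
    by (intro Z_loc_mult Z_loc_sum Z_loc_of_int p xc(2) unit(1))
  from prime_inverse_not_Z_loc[OF p this] show False using unit(2) aug by (simp add: mult_ac)
qed

section \<open>Fusion systems\<close>

locale finite_fusion_system = group S for S :: "('a, 'b) monoid_scheme" (structure) +
  fixes F :: "'a homs"
  assumes finite_carrier: "finite (carrier S)" and fusion: "fusion_system S F"
begin

lemmas fusion_axiom =
  fusion[unfolded fusion_system_def, THEN conjunct1, rule_format]
  fusion[unfolded fusion_system_def, THEN conjunct2, THEN conjunct1, rule_format]
  fusion[unfolded fusion_system_def, THEN conjunct2, THEN conjunct2, THEN conjunct1, rule_format]
  fusion[unfolded fusion_system_def, THEN conjunct2, THEN conjunct2, THEN conjunct2, rule_format]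

lemma fusion_hom:
  assumes "subgroup P S" "subgroup Q S" "\<phi> \<in> F P Q"
  shows "\<phi> \<in> hom (S\<lparr>carrier := P\<rparr>) (S\<lparr>carrier := Q\<rparr>)" "inj_on \<phi> P" "\<phi> \<in> extensional P" "\<phi> ` P \<subseteq> Q"
    and "subgroup (\<phi> ` P) S"
proof -
  show h: "\<phi> \<in> hom (S\<lparr>carrier := P\<rparr>) (S\<lparr>carrier := Q\<rparr>)" and "inj_on \<phi> P" "\<phi> \<in> extensional P"
    using subsetD[OF fusion_axiom(1)[OF assms(1,2)] assms(3)] by simp_all
  then show "\<phi> ` P \<subseteq> Q" by (auto simp: hom_def)
  interpret GP: group "S\<lparr>carrier := P\<rparr>" by (rule subgroup.subgroup_is_group[OF assms(1) is_group])
  interpret GQ: group "S\<lparr>carrier := Q\<rparr>" by (rule subgroup.subgroup_is_group[OF assms(2) is_group])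
  interpret \<phi>: group_hom "S\<lparr>carrier := P\<rparr>" "S\<lparr>carrier := Q\<rparr>" \<phi>
    by unfold_locales (rule h)
  have "subgroup (\<phi> ` P) (S\<lparr>carrier := Q\<rparr>)" using \<phi>.img_is_subgroup by simp
  then show "subgroup (\<phi> ` P) S" by (rule incl_subgroup[OF assms(2)])
qed

lemma fusion_hom_carrier:
  assumes "subgroup P S" "\<phi> \<in> F P (carrier S)"
  shows "\<phi> \<in> hom (S\<lparr>carrier := P\<rparr>) S"
  using fusion_hom(1)[OF assms(1) subgroup_self assms(2)] by simp

lemma fusion_compose:
  assumes "subgroup P S" "subgroup Q S" "subgroup W S" "\<phi> \<in> F P Q" "\<psi> \<in> F Q W"
  shows "compose P \<psi> \<phi> \<in> F P W"
  using assms by (rule fusion_axiom(2))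

lemma fusion_conj:
  assumes "subgroup P S" "subgroup Q S" "x \<in> carrier S" "conj_map S x P ` P \<subseteq> Q"
  shows "conj_map S x P \<in> F P Q"
  using assms by (rule fusion_axiom(3))

lemma fusion_inclusion:
  assumes "subgroup P S" "subgroup Q S" "P \<subseteq> Q"
  shows "(\<lambda>u\<in>P. u) \<in> F P Q"
proof -
  have "conj_map S \<one> P = (\<lambda>u\<in>P. u)"
    unfolding conj_map_def using subgroup.mem_carrier[OF assms(1)] by (intro restrict_ext) simp
  then show ?thesis using fusion_conj[OF assms(1,2) one_closed] assms(3) by auto
qed

lemma fusion_image:
  assumes "subgroup P S" "subgroup Q S" "\<phi> \<in> F P Q"
  shows "\<phi> \<in> F P (\<phi> ` P)" "(\<lambda>y\<in>\<phi> ` P. inv_into P \<phi> y) \<in> F (\<phi> ` P) P"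
  using fusion_axiom(4)[OF assms] by blast+

lemma compose_inclusion:
  "\<phi> \<in> extensional P \<Longrightarrow> \<phi> ` P \<subseteq> Q \<Longrightarrow> compose P (\<lambda>u\<in>Q. u) \<phi> = \<phi>"
  by (rule extensionalityI[of _ P]) (auto simp: compose_def)

lemma fusion_codomain:
  assumes "subgroup P S" "subgroup Q S" "\<phi> \<in> F P Q" "subgroup W S" "\<phi> ` P \<subseteq> W"
  shows "\<phi> \<in> F P W"
proof -
  note im = fusion_hom(5)[OF assms(1-3)]
  have "compose P (\<lambda>u\<in>\<phi> ` P. u) \<phi> \<in> F P W"
    by (rule fusion_compose[OF assms(1) im assms(4) fusion_image(1)[OF assms(1-3)]
      fusion_inclusion[OF im assms(4,5)]])
  then show ?thesis using compose_inclusion[OF fusion_hom(3)[OF assms(1-3)], of "\<phi> ` P"] by simp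
qed

lemma fusion_restrict:
  assumes "subgroup P S" "subgroup Q S" "subgroup W S" "P \<subseteq> Q" "\<phi> \<in> F Q W"
  shows "restrict \<phi> P \<in> F P W"
proof -
  have "compose P \<phi> (\<lambda>u\<in>P. u) = restrict \<phi> P" by (auto simp: compose_def)
  then show ?thesis
    using fusion_compose[OF assms(1,2,3) fusion_inclusion[OF assms(1,2,4)] assms(5)] by simp
qed

lemma finite_subgroup: "subgroup P S \<Longrightarrow> finite P"
  using finite_carrier subgroup.subset finite_subset by blast

lemma finite_fusion:
  assumes "subgroup P S" "subgroup Q S"
  shows "finite (F P Q)"
proof (rule finite_subset)
  show "F P Q \<subseteq> homs (S\<lparr>carrier := P\<rparr>) (S\<lparr>carrier := Q\<rparr>)"
    using fusion_hom(1,3)[OF assms] by (auto simp: homs_def)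
  show "finite (homs (S\<lparr>carrier := P\<rparr>) (S\<lparr>carrier := Q\<rparr>))"
    using finite_subgroup assms by (intro finite_homs) auto
qed

lemma card_fusion_pos:
  assumes "subgroup P S"
  shows "card (F P (carrier S)) > 0"
  using fusion_inclusion[OF assms subgroup_self subgroup.subset[OF assms]]
    finite_fusion[OF assms subgroup_self] by (auto simp: card_gt_0_iff)

lemma fusion_inverse_carrier:
  assumes "subgroup P S" "\<alpha> \<in> F P (carrier S)"
  shows "(\<lambda>y\<in>\<alpha> ` P. inv_into P \<alpha> y) \<in> F (\<alpha> ` P) (carrier S)"
proof (rule fusion_codomain)
  show "(\<lambda>y\<in>\<alpha> ` P. inv_into P \<alpha> y) \<in> F (\<alpha> ` P) P" by (rule fusion_image(2)[OF assms(1) subgroup_self assms(2)])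
  show "subgroup (\<alpha> ` P) S" by (rule fusion_hom(5)[OF assms(1) subgroup_self assms(2)])
  show "(\<lambda>y\<in>\<alpha> ` P. inv_into P \<alpha> y) ` \<alpha> ` P \<subseteq> carrier S"
    using subgroup.subset[OF assms(1)] fusion_hom(2)[OF assms(1) subgroup_self assms(2)] by auto
qed (use assms subgroup_self in auto)

lemma card_fusion_image:
  assumes "subgroup P S" "\<alpha> \<in> F P (carrier S)"
  shows "card (F (\<alpha> ` P) (carrier S)) = card (F P (carrier S))"
proof (rule bij_betw_same_card[of "\<lambda>\<beta>. compose P \<beta> \<alpha>"],
    rule bij_betw_byWitness[where f' = "\<lambda>\<gamma>. compose (\<alpha> ` P) \<gamma> (\<lambda>y\<in>\<alpha> ` P. inv_into P \<alpha> y)"])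
  note \<alpha> = fusion_hom[OF assms(1) subgroup_self assms(2)]
  note im = fusion_image[OF assms(1) subgroup_self assms(2)]
  show "\<forall>\<beta>\<in>F (\<alpha> ` P) (carrier S). compose (\<alpha> ` P) (compose P \<beta> \<alpha>) (\<lambda>y\<in>\<alpha> ` P. inv_into P \<alpha> y) = \<beta>"
  proof
    fix \<beta> assume "\<beta> \<in> F (\<alpha> ` P) (carrier S)"
    then have "\<beta> \<in> extensional (\<alpha> ` P)" by (rule fusion_hom(3)[OF \<alpha>(5) subgroup_self])
    then show "compose (\<alpha> ` P) (compose P \<beta> \<alpha>) (\<lambda>y\<in>\<alpha> ` P. inv_into P \<alpha> y) = \<beta>"
      using \<alpha>(2) by (intro extensionalityI[of _ "\<alpha> ` P"]) (auto simp: compose_def)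
  qed
  show "\<forall>\<gamma>\<in>F P (carrier S). compose P (compose (\<alpha> ` P) \<gamma> (\<lambda>y\<in>\<alpha> ` P. inv_into P \<alpha> y)) \<alpha> = \<gamma>"
  proof
    fix \<gamma> assume "\<gamma> \<in> F P (carrier S)"
    then have "\<gamma> \<in> extensional P" by (rule fusion_hom(3)[OF assms(1) subgroup_self])
    then show "compose P (compose (\<alpha> ` P) \<gamma> (\<lambda>y\<in>\<alpha> ` P. inv_into P \<alpha> y)) \<alpha> = \<gamma>"
      using \<alpha>(2) by (intro extensionalityI[of _ "P"]) (auto simp: compose_def)
  qed
  show "(\<lambda>\<beta>. compose P \<beta> \<alpha>) ` F (\<alpha> ` P) (carrier S) \<subseteq> F P (carrier S)"
    using fusion_compose[OF assms(1) \<alpha>(5) subgroup_self im(1)] by blast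
  show "(\<lambda>\<gamma>. compose (\<alpha> ` P) \<gamma> (\<lambda>y\<in>\<alpha> ` P. inv_into P \<alpha> y)) ` F P (carrier S) \<subseteq> F (\<alpha> ` P) (carrier S)"
    using fusion_compose[OF \<alpha>(5) assms(1) subgroup_self im(2)] by blast
qed

text \<open>This is the condition that \<open>a \<circ> b\<inverse>\<close> belongs to the fusion system, in a form that makes sense
  for maps \<open>b\<close> that are not injective.\<close>

definition linked :: "'l set \<Rightarrow> ('l \<Rightarrow> 'a) \<Rightarrow> ('l \<Rightarrow> 'a) \<Rightarrow> bool" where
  "linked L a b \<longleftrightarrow> (\<exists>\<alpha>\<in>F (b ` L) (carrier S). \<forall>u\<in>L. a u = \<alpha> (b u))"

lemma hom_image_subgroup:
  assumes "group L" "b \<in> hom L S"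
  shows "subgroup (b ` carrier L) S"
proof -
  interpret L: group L by fact
  interpret b: group_hom L S b by unfold_locales fact
  show ?thesis by (rule b.img_is_subgroup)
qed

text \<open>The link is \<open>b u \<mapsto> g\<inverse> (b u) g \<mapsto> \<phi> (g\<inverse> (b u) g) \<mapsto> a u\<close>, a composite of morphisms of the
fusion system.\<close>

lemma linked_conj:
  assumes L: "group L" "b \<in> hom L S" and P: "subgroup P S" "\<phi> \<in> F P (carrier S)"
    and c: "\<And>u. u \<in> carrier L \<Longrightarrow> c u \<in> P" and h: "h \<in> carrier S" and g: "g \<in> carrier S"
    and a': "\<And>u. u \<in> carrier L \<Longrightarrow> a u = h \<otimes> \<phi> (c u) \<otimes> inv h"
    and b': "\<And>u. u \<in> carrier L \<Longrightarrow> b u = g \<otimes> c u \<otimes> inv g"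
  shows "linked (carrier L) a b"
proof -
  let ?D = "b ` carrier L"
  have D: "subgroup ?D S" by (rule hom_image_subgroup[OF L])
  have bS: "b u \<in> carrier S" if "u \<in> carrier L" for u using L(2) that by (rule hom_in_carrier)
  have cb: "conj_map S (inv g) ?D (b u) = c u" if u: "u \<in> carrier L" for u
  proof -
    have "c u = inv g \<otimes> b u \<otimes> g"
      using conj_swap[OF g bS[OF u], of "c u"] b'[OF u] subgroup.mem_carrier[OF P(1) c[OF u]] by blast
    then show ?thesis using u g by (simp add: conj_map_def)
  qed
  have 1: "conj_map S (inv g) ?D \<in> F ?D P"
    using cb c g by (intro fusion_conj D P(1)) auto
  have 2: "compose ?D \<phi> (conj_map S (inv g) ?D) \<in> F ?D (carrier S)"
    by (rule fusion_compose[OF D P(1) subgroup_self 1 P(2)])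
  have 3: "conj_map S h (carrier S) \<in> F (carrier S) (carrier S)"
    using h by (intro fusion_conj subgroup_self) (auto simp: conj_map_def)
  have 4: "compose ?D (conj_map S h (carrier S)) (compose ?D \<phi> (conj_map S (inv g) ?D)) \<in> F ?D (carrier S)"
    by (rule fusion_compose[OF D subgroup_self subgroup_self 2 3])
  have "\<phi> (c u) \<in> carrier S" if "u \<in> carrier L" for u
    using fusion_hom(4)[OF P(1) subgroup_self P(2)] c[OF that] by blast
  then show ?thesis unfolding linked_def
    using a' cb by (intro bexI[OF _ 4]) (simp add: compose_def conj_map_def)
qed

lemma linkedE:
  assumes "group L" "b \<in> hom L S" "linked (carrier L) a b"
  obtains \<alpha> where "\<alpha> \<in> F (b ` carrier L) (carrier S)" "\<And>u. u \<in> carrier L \<Longrightarrow> a u = \<alpha> (b u)"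
    "subgroup (b ` carrier L) S" "\<alpha> ` b ` carrier L = a ` carrier L"
  using assms(3) hom_image_subgroup[OF assms(1,2)] unfolding linked_def by (auto simp: image_image)

lemma linked_card:
  assumes "group L" "b \<in> hom L S" "linked (carrier L) a b"
  shows "card (F (a ` carrier L) (carrier S)) = card (F (b ` carrier L) (carrier S))"
proof -
  obtain \<alpha> where \<alpha>: "\<alpha> \<in> F (b ` carrier L) (carrier S)" "\<And>u. u \<in> carrier L \<Longrightarrow> a u = \<alpha> (b u)"
    "subgroup (b ` carrier L) S" "\<alpha> ` b ` carrier L = a ` carrier L"
    by (rule linkedE[OF assms]) (rule that)
  show ?thesis using card_fusion_image[OF \<alpha>(3,1)] \<alpha>(4) by simp
qed

lemma linked_sym:
  assumes "group L" "b \<in> hom L S" "linked (carrier L) a b"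
  shows "linked (carrier L) b a"
proof -
  obtain \<alpha> where \<alpha>: "\<alpha> \<in> F (b ` carrier L) (carrier S)" "\<And>u. u \<in> carrier L \<Longrightarrow> a u = \<alpha> (b u)"
    "subgroup (b ` carrier L) S" "\<alpha> ` b ` carrier L = a ` carrier L"
    by (rule linkedE[OF assms]) (rule that)
  note inj = fusion_hom(2)[OF \<alpha>(3) subgroup_self \<alpha>(1)]
  show ?thesis
    unfolding linked_def using fusion_inverse_carrier[OF \<alpha>(3,1)] \<alpha>(2,4) inj
    by (intro bexI[of _ "\<lambda>y\<in>\<alpha> ` b ` carrier L. inv_into (b ` carrier L) \<alpha> y"]) auto
qed

lemma linked_trans:
  assumes "group L" "c \<in> hom L S" "linked (carrier L) a b" "linked (carrier L) b c"
  shows "linked (carrier L) a c"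
proof -
  obtain \<alpha> where \<alpha>: "\<alpha> \<in> F (b ` carrier L) (carrier S)" "\<And>u. u \<in> carrier L \<Longrightarrow> a u = \<alpha> (b u)"
    using assms(3) unfolding linked_def by blast
  obtain \<beta> where \<beta>: "\<beta> \<in> F (c ` carrier L) (carrier S)" "\<And>u. u \<in> carrier L \<Longrightarrow> b u = \<beta> (c u)"
    "subgroup (c ` carrier L) S" "\<beta> ` c ` carrier L = b ` carrier L"
    by (rule linkedE[OF assms(1,2,4)]) (rule that)
  have "\<beta> \<in> F (c ` carrier L) (b ` carrier L)" "subgroup (b ` carrier L) S"
    using fusion_image(1)[OF \<beta>(3) subgroup_self \<beta>(1)] fusion_hom(5)[OF \<beta>(3) subgroup_self \<beta>(1)] \<beta>(4) by simp_all
  then have "compose (c ` carrier L) \<alpha> \<beta> \<in> F (c ` carrier L) (carrier S)"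
    using \<alpha>(1) \<beta>(3) by (intro fusion_compose[OF _ _ subgroup_self]) auto
  then show ?thesis
    unfolding linked_def using \<alpha>(2) \<beta>(2) by (intro bexI) (auto simp: compose_def)
qed

lemma linked_refl:
  assumes "group L" "b \<in> hom L S"
  shows "linked (carrier L) b b"
  unfolding linked_def using fusion_inclusion[OF hom_image_subgroup[OF assms] subgroup_self]
    hom_in_carrier[OF assms(2)] by (intro bexI[of _ "\<lambda>u\<in>b ` carrier L. u"]) auto

lemma linked_subsystem:
  assumes "finite_fusion_system (S\<lparr>carrier := A\<rparr>) G" and sub: "fusion_subsystem S F A G"
    and "group L" "b \<in> hom L (S\<lparr>carrier := A\<rparr>)"
    and "finite_fusion_system.linked (S\<lparr>carrier := A\<rparr>) G (carrier L) a b"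
  shows "linked (carrier L) a b"
proof -
  interpret G: finite_fusion_system "S\<lparr>carrier := A\<rparr>" G by fact
  have A: "subgroup A S" using sub by (simp add: fusion_subsystem_def)
  obtain \<alpha> where "\<alpha> \<in> G (b ` carrier L) (carrier (S\<lparr>carrier := A\<rparr>))"
      and \<alpha>: "\<And>u. u \<in> carrier L \<Longrightarrow> a u = \<alpha> (b u)"
      "subgroup (b ` carrier L) (S\<lparr>carrier := A\<rparr>)" "\<alpha> ` b ` carrier L = a ` carrier L"
    by (rule G.linkedE[OF assms(3-5)]) (rule that)
  then have \<alpha>G: "\<alpha> \<in> G (b ` carrier L) A" by simp
  have "subgroup A (S\<lparr>carrier := A\<rparr>)" using G.subgroup_self by simp
  then have \<alpha>F: "\<alpha> \<in> F (b ` carrier L) A"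
    using sub \<alpha>(2) \<alpha>G unfolding fusion_subsystem_def by blast
  have bS: "subgroup (b ` carrier L) S" by (rule incl_subgroup[OF A \<alpha>(2)])
  have "\<alpha> \<in> F (b ` carrier L) (carrier S)"
    using fusion_codomain[OF bS A \<alpha>F subgroup_self] fusion_hom(4)[OF bS A \<alpha>F] subgroup.subset[OF A] by blast
  then show ?thesis unfolding linked_def using \<alpha>(1) by blast
qed

lemma fusion_trivial: "F {\<one>} (carrier S) = {\<lambda>u\<in>{\<one>}. u}"
proof
  show "F {\<one>} (carrier S) \<subseteq> {\<lambda>u\<in>{\<one>}. u}"
  proof
    fix \<phi> assume \<phi>: "\<phi> \<in> F {\<one>} (carrier S)"
    have "\<phi> \<one> = \<one>"
      using hom_one[OF fusion_hom_carrier[OF triv_subgroup \<phi>]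
        subgroup.subgroup_is_group[OF triv_subgroup is_group] is_group] by simp
    then have "\<phi> = (\<lambda>u\<in>{\<one>}. u)"
      using fusion_hom(3)[OF triv_subgroup subgroup_self \<phi>]
      by (intro extensionalityI[of _ "{\<one>}"]) auto
    then show "\<phi> \<in> {\<lambda>u\<in>{\<one>}. u}" by simp
  qed
  show "{\<lambda>u\<in>{\<one>}. u} \<subseteq> F {\<one>} (carrier S)"
    using fusion_inclusion[OF triv_subgroup subgroup_self] by auto
qed

end

lemma p_group_subgroup:
  assumes "prime p" "p_group p S" "subgroup P S"
  shows "p_group p (S\<lparr>carrier := P\<rparr>)"
proof -
  interpret group S using assms(2) by (simp add: p_group_def)
  have "card P dvd order S" using lagrange[OF assms(3)] by (metis dvd_triv_right)
  then obtain n where "card P dvd p ^ n" using assms(2) by (auto simp: p_group_def)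
  then obtain k where "card P = p ^ k" using divides_primepow_nat[OF assms(1)] by blast
  moreover have "finite P" using assms(2) subgroup.subset[OF assms(3)] by (auto simp: p_group_def intro: finite_subset)
  ultimately show ?thesis
    using subgroup.subgroup_is_group[OF assms(3) is_group] by (auto simp: p_group_def order_def)
qed

section \<open>Marks of the characteristic idempotent\<close>

locale fusion_idempotent = finite_fusion_system S F
  for S :: "('a, 'b) monoid_scheme" (structure) and F +
  fixes p :: nat and \<omega> :: "('a, 'a) biset_comb set"
  assumes p: "prime p" and pS: "p_group p S" and \<omega>: "characteristic_idempotent p S F \<omega>"
begin

lemma idem_module: "\<omega> \<in> biset_module p S S"
  and idem_generated: "fusion_generated S F \<omega>"
  and idem_right: "right_stable p S F \<omega>"
  and idem_left: "left_stable p S F \<omega>"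
  and idem_idem: "biset_comp p S S S \<omega> \<omega> = \<omega>"
  and idem_unit: "\<exists>v\<in>Z_loc p. augmentation S \<omega> * v = 1"
  using \<omega> unfolding characteristic_idempotent_def fusion_characteristic_def by blast+

lemma idem_rep:
  obtains x where "x \<in> \<omega>" "\<And>B. B \<in> Poly_Mapping.keys x \<Longrightarrow>
    \<exists>P \<phi>. B = nat_copy (coset_biset S S P \<phi>) \<and> subgroup P S \<and> \<phi> \<in> F P (carrier S)"
  using idem_generated unfolding fusion_generated_def by blast

lemma idem_left_free: "left_free_class S S \<omega>"
proof -
  obtain x where x: "x \<in> \<omega>" "\<And>B. B \<in> Poly_Mapping.keys x \<Longrightarrow>
    \<exists>P \<phi>. B = nat_copy (coset_biset S S P \<phi>) \<and> subgroup P S \<and> \<phi> \<in> F P (carrier S)"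
    using idem_rep by blast
  have "left_free S S B" if "B \<in> Poly_Mapping.keys x" for B
  proof -
    obtain P \<phi> where B: "B = nat_copy (coset_biset S S P \<phi>)" "subgroup P S" "\<phi> \<in> F P (carrier S)"
      using x(2)[OF \<open>B \<in> _\<close>] by blast
    note h = fusion_hom_carrier[OF B(2,3)]
    note b = coset_biset_biset[OF is_group is_group finite_carrier finite_carrier B(2) h]
    show ?thesis unfolding B(1)
      by (rule left_free_iso[OF is_group is_group b nat_copy(2)[OF is_group is_group b]
        left_free_coset_biset[OF is_group is_group B(2) h]])
  qed
  then show ?thesis using x(1) unfolding left_free_class_def by blast
qed

text \<open>Only transitive bisets \<open>[P, \<phi>]\<close> with \<open>\<phi>\<close> in the fusion system contribute, and their fixed points along
\<open>(a, b)\<close> provide a link by \<open>linked_conj\<close>.\<close>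

lemma idem_mark_unlinked:
  assumes L: "group L" "finite (carrier L)" and a: "a \<in> hom L S" and b: "b \<in> hom L S"
    and nl: "\<not> linked (carrier L) a b"
  shows "class_mark (carrier L) a b \<omega> = 0"
proof -
  obtain x where x: "x \<in> \<omega>" "\<And>B. B \<in> Poly_Mapping.keys x \<Longrightarrow>
    \<exists>P \<phi>. B = nat_copy (coset_biset S S P \<phi>) \<and> subgroup P S \<and> \<phi> \<in> F P (carrier S)"
    using idem_rep by blast
  have "mark (carrier L) a b B = 0" if "B \<in> Poly_Mapping.keys x" for B
  proof -
    obtain P \<phi> where B: "B = nat_copy (coset_biset S S P \<phi>)" "subgroup P S" "\<phi> \<in> F P (carrier S)"
      using x(2)[OF \<open>B \<in> _\<close>] by blast
    note h = fusion_hom_carrier[OF B(2,3)]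
    note bb = coset_biset_biset[OF is_group is_group finite_carrier finite_carrier B(2) h]
    have "mark (carrier L) a b B = mark (carrier L) a b (coset_biset S S P \<phi>)"
      unfolding B(1) using mark_iso[OF bb nat_copy(2)[OF is_group is_group bb] is_group is_group
        hom_funcset[OF a] hom_funcset[OF b]] by simp
    moreover have "card P * mark (carrier L) a b (coset_biset S S P \<phi>) = 0"
      unfolding mark_coset_biset[OF is_group is_group finite_carrier finite_carrier B(2) h L a b]
    proof (rule sum.neutral, rule ballI)
      fix c assume c: "c \<in> homs L (S\<lparr>carrier := P\<rparr>)"
      then have cP: "\<And>u. u \<in> carrier L \<Longrightarrow> c u \<in> P" by (auto simp: homs_def hom_def)
      have "conjugators S L a (\<lambda>u. \<phi> (c u)) = {} \<or>
         conjugators S L b c = {}"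
      proof (rule ccontr)
        assume "\<not> ?thesis"
        then obtain h g where "h \<in> carrier S" "\<And>u. u \<in> carrier L \<Longrightarrow> a u = h \<otimes> \<phi> (c u) \<otimes> inv h"
          "g \<in> carrier S" "\<And>u. u \<in> carrier L \<Longrightarrow> b u = g \<otimes> c u \<otimes> inv g" by blast
        then have "linked (carrier L) a b" by (intro linked_conj[OF L(1) b B(2,3), of c h g] cP)
        then show False using nl by blast
      qed
      then show "card (conjugators S L a (\<lambda>u. \<phi> (c u))) *
         card (conjugators S L b c) = 0"
        by (elim disjE) (simp_all only: card.empty mult_0 mult_0_right)
    qed
    moreover have "card P \<noteq> 0" using finite_subgroup[OF B(2)] subgroup.one_closed[OF B(2)] by auto
    ultimately show ?thesis by simp
  qed
  then show ?thesis
    unfolding class_mark_eq[OF p is_group is_group idem_module x(1) hom_funcset[OF a] hom_funcset[OF b]]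
    by (simp add: linear_ext_def)
qed

text \<open>The mark at the diagonal subgroup of \<open>P \<times> P\<close>. Stability of the idempotent reduces all its marks
to these: right stability moves the mark at the graph of \<open>\<phi>\<close> to the diagonal of \<open>\<phi> ` P\<close>, left
stability moves it to the diagonal of \<open>P\<close>.\<close>

definition diag_mark :: "'a set \<Rightarrow> rat" where
  "diag_mark P = class_mark P (\<lambda>u. u) (\<lambda>u. u) \<omega>"

lemma subgroup_group: "subgroup P S \<Longrightarrow> group (S\<lparr>carrier := P\<rparr>)"
  by (rule subgroup.subgroup_is_group[OF _ is_group])

lemma inclusion_hom: "subgroup P S \<Longrightarrow> (\<lambda>u. u) \<in> hom (S\<lparr>carrier := P\<rparr>) S"
  using subgroup.subset by (fastforce simp: hom_def)

lemma idem_mark_right_stable: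
  assumes P: "subgroup P S" "\<phi> \<in> F P (carrier S)"
  shows "class_mark P \<phi> (\<lambda>u. u) \<omega> = diag_mark (\<phi> ` P)"
proof -
  interpret P: group "S\<lparr>carrier := P\<rparr>" by (rule subgroup_group[OF P(1)])
  interpret biset_comp_setup "S\<lparr>carrier := P\<rparr>" S S p by unfold_locales (rule p)
  have fP: "finite (carrier (S\<lparr>carrier := P\<rparr>))" using finite_subgroup[OF P(1)] by simp
  have \<phi>: "\<phi> \<in> hom (S\<lparr>carrier := P\<rparr>) S" by (rule fusion_hom_carrier[OF P])
  have i: "(\<lambda>u. u) \<in> hom (S\<lparr>carrier := P\<rparr>) (S\<lparr>carrier := P\<rparr>)" "id \<in> hom (S\<lparr>carrier := P\<rparr>) S"
    using inclusion_hom[OF P(1)] by (auto simp: hom_def id_def)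
  have "biset_comp p (S\<lparr>carrier := P\<rparr>) S S \<omega> (transitive_class p (S\<lparr>carrier := P\<rparr>) S P \<phi>) =
     biset_comp p (S\<lparr>carrier := P\<rparr>) S S \<omega> (transitive_class p (S\<lparr>carrier := P\<rparr>) S P id)"
    using idem_right P unfolding right_stable_def by blast
  then have "class_mark P \<phi> (\<lambda>u. \<phi> u) \<omega> = class_mark P \<phi> (\<lambda>u. id u) \<omega>"
    using class_mark_comp_restriction[OF P.is_group fP fP finite_carrier \<phi> i(1) idem_module \<phi>]
      class_mark_comp_restriction[OF P.is_group fP fP finite_carrier \<phi> i(1) idem_module i(2)]
    by simp
  then show ?thesis
    unfolding diag_mark_def class_mark_image[of P "\<lambda>u. u" \<phi> "\<lambda>u. u", symmetric] by simp
qed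

lemma idem_mark_left_stable:
  assumes P: "subgroup P S" "\<phi> \<in> F P (carrier S)"
  shows "class_mark P \<phi> (\<lambda>u. u) \<omega> = diag_mark P"
proof -
  interpret P: group "S\<lparr>carrier := P\<rparr>" by (rule subgroup_group[OF P(1)])
  interpret biset_comp_setup S S "S\<lparr>carrier := P\<rparr>" p by unfold_locales (rule p)
  have fP: "finite (carrier (S\<lparr>carrier := P\<rparr>))" using finite_subgroup[OF P(1)] by simp
  note \<phi> = fusion_hom[OF P(1) subgroup_self P(2)]
  note im = fusion_image[OF P(1) subgroup_self P(2)]
  have i: "(\<lambda>u. u) \<in> hom (S\<lparr>carrier := P\<rparr>) (S\<lparr>carrier := P\<rparr>)" "id \<in> hom (S\<lparr>carrier := P\<rparr>) (S\<lparr>carrier := P\<rparr>)"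
    by (auto simp: hom_def)
  have \<phi>1: "\<phi> \<in> hom (S\<lparr>carrier := P\<rparr>) (S\<lparr>carrier := \<phi> ` P\<rparr>)"
    by (rule fusion_hom(1)[OF P(1) \<phi>(5) im(1)])
  have \<phi>2: "inv_into P \<phi> \<in> hom (S\<lparr>carrier := \<phi> ` P\<rparr>) (S\<lparr>carrier := P\<rparr>)"
    using fusion_hom(1)[OF \<phi>(5) P(1) im(2)] subgroup.m_closed[OF \<phi>(5)]
    by (simp add: hom_def Pi_def)
  have eq: "biset_comp p S S (S\<lparr>carrier := P\<rparr>)
      (transitive_class p S (S\<lparr>carrier := P\<rparr>) (\<phi> ` P) (inv_into P \<phi>)) \<omega> =
    biset_comp p S S (S\<lparr>carrier := P\<rparr>) (transitive_class p S (S\<lparr>carrier := P\<rparr>) P id) \<omega>"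
    using idem_left P unfolding left_stable_def by blast
  have "class_mark (carrier (S\<lparr>carrier := P\<rparr>)) (\<lambda>u. u) (\<lambda>u. u) (biset_comp p S S (S\<lparr>carrier := P\<rparr>)
      (transitive_class p S (S\<lparr>carrier := P\<rparr>) (\<phi> ` P) (inv_into P \<phi>)) \<omega>) =
    class_mark (carrier (S\<lparr>carrier := P\<rparr>)) (\<lambda>u. \<phi> u) (\<lambda>u. u) \<omega>"
    by (rule class_mark_comp_iso[OF P.is_group fP finite_carrier fP i(1) inclusion_hom[OF P(1)]
      idem_module idem_left_free \<phi>(5) \<phi>2 \<phi>1]) (use \<phi>(2) in \<open>auto simp: f_inv_into_f\<close>)
  moreover have "class_mark (carrier (S\<lparr>carrier := P\<rparr>)) (\<lambda>u. u) (\<lambda>u. u) (biset_comp p S S (S\<lparr>carrier := P\<rparr>)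
      (transitive_class p S (S\<lparr>carrier := P\<rparr>) P id) \<omega>) =
    class_mark (carrier (S\<lparr>carrier := P\<rparr>)) (\<lambda>u. id u) (\<lambda>u. u) \<omega>"
    by (rule class_mark_comp_iso[OF P.is_group fP finite_carrier fP i(1) inclusion_hom[OF P(1)]
      idem_module idem_left_free P(1) i(2) i(2)]) auto
  ultimately show ?thesis unfolding diag_mark_def eq by simp
qed

lemma idem_mark_linked:
  assumes L: "group L" "b \<in> hom L S" and lk: "linked (carrier L) a b"
  shows "class_mark (carrier L) a b \<omega> = diag_mark (b ` carrier L)"
proof -
  obtain \<alpha> where \<alpha>: "\<alpha> \<in> F (b ` carrier L) (carrier S)" "\<And>u. u \<in> carrier L \<Longrightarrow> a u = \<alpha> (b u)"
    using lk unfolding linked_def by blast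
  have "class_mark (carrier L) a b \<omega> = class_mark (carrier L) (\<lambda>u. \<alpha> (b u)) (\<lambda>u. b u) \<omega>"
    using \<alpha>(2) by (intro class_mark_cong) auto
  also have "\<dots> = class_mark (b ` carrier L) \<alpha> (\<lambda>u. u) \<omega>" by (rule class_mark_image)
  also have "\<dots> = diag_mark (b ` carrier L)"
    by (rule idem_mark_left_stable[OF hom_image_subgroup[OF L] \<alpha>(1)])
  finally show ?thesis .
qed

lemma linked_subgroup_iff:
  assumes P: "subgroup P S" and c: "c \<in> homs (S\<lparr>carrier := P\<rparr>) S"
  shows "linked P c (\<lambda>u. u) \<longleftrightarrow> c \<in> F P (carrier S)"
proof
  assume "linked P c (\<lambda>u. u)"
  then obtain \<alpha> where \<alpha>: "\<alpha> \<in> F P (carrier S)" "\<forall>u\<in>P. c u = \<alpha> u" by (auto simp: linked_def)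
  have "c = \<alpha>"
    using c fusion_hom(3)[OF P subgroup_self \<alpha>(1)] \<alpha>(2)
    by (intro extensionalityI[of _ P]) (auto simp: homs_def)
  then show "c \<in> F P (carrier S)" using \<alpha>(1) by simp
next
  assume "c \<in> F P (carrier S)"
  then show "linked P c (\<lambda>u. u)" by (auto simp: linked_def)
qed

lemma fusion_subset_homs:
  assumes "subgroup P S"
  shows "F P (carrier S) \<subseteq> homs (S\<lparr>carrier := P\<rparr>) S"
  using fusion_hom(3)[OF assms subgroup_self] fusion_hom_carrier[OF assms] by (auto simp: homs_def)

text \<open>Among all homomorphisms from \<open>P\<close>, only the morphisms of the fusion system are linked to the
inclusion of \<open>P\<close>.\<close>

lemma sum_idem_marks:
  assumes P: "subgroup P S"
  shows "(\<Sum>c\<in>homs (S\<lparr>carrier := P\<rparr>) S. f c * class_mark P c (\<lambda>u. u) \<omega>) =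
    (\<Sum>c\<in>F P (carrier S). f c * diag_mark P)"
proof -
  have fP: "finite (carrier (S\<lparr>carrier := P\<rparr>))" using finite_subgroup[OF P] by simp
  note u = idem_mark_unlinked[OF subgroup_group[OF P] fP homsD inclusion_hom[OF P]]
  have "(\<Sum>c\<in>homs (S\<lparr>carrier := P\<rparr>) S. f c * class_mark P c (\<lambda>u. u) \<omega>) =
      (\<Sum>c\<in>F P (carrier S). f c * class_mark P c (\<lambda>u. u) \<omega>)"
    using u linked_subgroup_iff[OF P] fusion_subset_homs[OF P] finite_carrier fP
    by (intro sum.mono_neutral_right finite_homs) auto
  also have "\<dots> = (\<Sum>c\<in>F P (carrier S). f c * diag_mark P)"
    using idem_mark_left_stable[OF P] by (intro sum.cong refl) simp
  finally show ?thesis .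
qed

text \<open>Let \<open>m\<close> be the diagonal mark at \<open>P\<close> and \<open>n = |F(P, S)|\<close>. Idempotency and \<open>class_mark_comp\<close> give
\<open>|S| m = n m\<^sup>2\<close>, and \<open>n m\<close> is nonzero by \<open>left_orbits_nonzero\<close>. Hence \<open>m = |S| / n\<close>.\<close>

lemma diag_mark:
  assumes P: "subgroup P S"
  shows "diag_mark P = of_nat (card (carrier S)) / of_nat (card (F P (carrier S)))"
proof -
  interpret P: group "S\<lparr>carrier := P\<rparr>" by (rule subgroup_group[OF P])
  interpret biset_comp_setup S S S p by unfold_locales (rule p)
  have fP: "finite (carrier (S\<lparr>carrier := P\<rparr>))" using finite_subgroup[OF P] by simp
  note i = inclusion_hom[OF P]
  have "of_nat (card (carrier S)) * diag_mark P =
      (\<Sum>c\<in>homs (S\<lparr>carrier := P\<rparr>) S. class_mark P (\<lambda>u. u) c \<omega> * class_mark P c (\<lambda>u. u) \<omega>)"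
    using class_mark_comp[OF P.is_group fP finite_carrier i i idem_module idem_module idem_left_free]
    by (simp add: diag_mark_def idem_idem)
  also have "\<dots> = (\<Sum>c\<in>F P (carrier S). class_mark P (\<lambda>u. u) c \<omega> * diag_mark P)"
    by (rule sum_idem_marks[OF P])
  also have "\<dots> = (\<Sum>c\<in>F P (carrier S). diag_mark P * diag_mark P)"
  proof (intro sum.cong refl arg_cong2[where f = "(*)"])
    fix c assume c: "c \<in> F P (carrier S)"
    have inj: "inj_on c P" by (rule fusion_hom(2)[OF P subgroup_self c])
    have "linked P (\<lambda>u. u) c"
      unfolding linked_def using inj
      by (intro bexI[OF _ fusion_inverse_carrier[OF P c]]) simp
    then have "class_mark P (\<lambda>u. u) c \<omega> = diag_mark (c ` P)"
      using idem_mark_linked[OF P.is_group fusion_hom_carrier[OF P c], of "\<lambda>u. u"] by simp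
    also have "\<dots> = diag_mark P"
      using idem_mark_right_stable[OF P c] idem_mark_left_stable[OF P c] by simp
    finally show "class_mark P (\<lambda>u. u) c \<omega> = diag_mark P" .
  qed
  finally have eq: "of_nat (card (carrier S)) * diag_mark P =
    of_nat (card (F P (carrier S))) * diag_mark P * diag_mark P" by simp
  obtain v where v: "v \<in> Z_loc p" "augmentation S \<omega> * v = 1" using idem_unit by blast
  have "(\<Sum>c\<in>homs (S\<lparr>carrier := P\<rparr>) S. class_mark P c (\<lambda>u. u) \<omega>) \<noteq> 0"
    using left_orbits_nonzero[OF p is_group finite_carrier idem_module idem_left_free v
      p_group_subgroup[OF p pS P] i] by simp
  then have "diag_mark P \<noteq> 0" using sum_idem_marks[OF P, of "\<lambda>_. 1"] by auto
  then have "of_nat (card (carrier S)) = of_nat (card (F P (carrier S))) * diag_mark P" using eq by simp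
  then show ?thesis using card_fusion_pos[OF P] by (simp add: field_simps)
qed

theorem idem_mark:
  assumes L: "group L" "finite (carrier L)" and a: "a \<in> hom L S" and b: "b \<in> hom L S"
  shows "class_mark (carrier L) a b \<omega> = (if linked (carrier L) a b
    then of_nat (card (carrier S)) / of_nat (card (F (b ` carrier L) (carrier S))) else 0)"
  using idem_mark_unlinked[OF assms] idem_mark_linked[OF L(1) b] diag_mark[OF hom_image_subgroup[OF L(1) b]]
  by auto

end

section \<open>Restricted idempotents and composites of idempotents\<close>

text \<open>The fibre of multiplication \<open>R \<times> T \<rightarrow> R T\<close> over \<open>r t\<close> is \<open>{(r u, u\<inverse> t) | u \<in> R \<inter> T}\<close>.\<close>

lemma (in group) card_set_mult_subgroups:
  assumes R: "subgroup R G" "finite R" and T: "subgroup T G" "finite T"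
  shows "card (R <#> T) * card (R \<inter> T) = card R * card T"
proof -
  define fib where "fib x = {(r, t). r \<in> R \<and> t \<in> T \<and> r \<otimes> t = x}" for x
  have RS: "\<And>r. r \<in> R \<Longrightarrow> r \<in> carrier G" and TS: "\<And>t. t \<in> T \<Longrightarrow> t \<in> carrier G"
    using subgroup.mem_carrier R(1) T(1) by metis+
  have fib_sub: "fib x \<subseteq> R \<times> T" for x by (auto simp: fib_def)
  have fib_card: "card (fib x) = card (R \<inter> T)" if "x \<in> R <#> T" for x
  proof -
    obtain r0 t0 where rt: "r0 \<in> R" "t0 \<in> T" "x = r0 \<otimes> t0" using \<open>x \<in> _\<close> by (auto simp: set_mult_def)
    have "bij_betw (\<lambda>u. (r0 \<otimes> u, inv u \<otimes> t0)) (R \<inter> T) (fib x)"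
    proof (rule bij_betw_byWitness[where f' = "\<lambda>(r, t). inv r0 \<otimes> r"])
      show "\<forall>u\<in>R \<inter> T. (case (r0 \<otimes> u, inv u \<otimes> t0) of (r, t) \<Rightarrow> inv r0 \<otimes> r) = u"
        using RS rt by (auto simp: inv_cancel)
      show "(\<lambda>u. (r0 \<otimes> u, inv u \<otimes> t0)) ` (R \<inter> T) \<subseteq> fib x"
        using RS TS rt subgroup.m_closed[OF R(1)] subgroup.m_closed[OF T(1)] subgroup.m_inv_closed[OF T(1)]
        by (auto simp: fib_def m_assoc inv_cancel)
      have key: "inv r0 \<otimes> r = t0 \<otimes> inv t" "inv (inv r0 \<otimes> r) \<otimes> t0 = t"
        if rt': "r \<in> R" "t \<in> T" "r \<otimes> t = x" for r t
      proof -
        note g = RS[OF rt(1)] TS[OF rt(2)] RS[OF rt'(1)] TS[OF rt'(2)]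
        have "r = r0 \<otimes> t0 \<otimes> inv t" using rt' rt(3) g inv_solve_right by (metis m_closed)
        then show e: "inv r0 \<otimes> r = t0 \<otimes> inv t" using g by (simp add: m_assoc inv_cancel)
        show "inv (inv r0 \<otimes> r) \<otimes> t0 = t" unfolding e using g by (simp add: inv_mult_group m_assoc)
      qed
      show "\<forall>z\<in>fib x. (r0 \<otimes> (case z of (r, t) \<Rightarrow> inv r0 \<otimes> r), inv (case z of (r, t) \<Rightarrow> inv r0 \<otimes> r) \<otimes> t0) = z"
        using RS rt key(2) by (auto simp: fib_def inv_cancel)
      show "(\<lambda>(r, t). inv r0 \<otimes> r) ` fib x \<subseteq> R \<inter> T"
      proof
        fix y assume "y \<in> (\<lambda>(r, t). inv r0 \<otimes> r) ` fib x"
        then obtain r t where z: "r \<in> R" "t \<in> T" "r \<otimes> t = x" "y = inv r0 \<otimes> r" by (auto simp: fib_def)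
        have "y \<in> R" unfolding z(4) using rt z R(1) by (simp add: subgroup.m_closed subgroup.m_inv_closed)
        moreover have "y \<in> T" unfolding z(4) key(1)[OF z(1-3)] using rt z T(1)
          by (simp add: subgroup.m_closed subgroup.m_inv_closed)
        ultimately show "y \<in> R \<inter> T" by simp
      qed
    qed
    then show ?thesis by (simp add: bij_betw_same_card)
  qed
  have "R <#> T = (\<lambda>(r, t). r \<otimes> t) ` (R \<times> T)" by (auto simp: set_mult_def)
  then have fin: "finite (R <#> T)" using R(2) T(2) by simp
  have "R \<times> T = (\<Union>x\<in>R <#> T. fib x)" by (auto simp: fib_def set_mult_def)
  then have "card R * card T = card (\<Union>x\<in>R <#> T. fib x)" by (metis card_cartesian_product)
  also have "\<dots> = (\<Sum>x\<in>R <#> T. card (fib x))"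
    using finite_subset[OF fib_sub] R(2) T(2) by (intro card_UN_disjoint fin) (auto simp: fib_def)
  also have "\<dots> = card (R <#> T) * card (R \<inter> T)" using fib_card by simp
  finally show ?thesis by simp
qed

locale fusion_idempotent_pair =
  F: fusion_idempotent S F p \<omega>F +
  H: fusion_idempotent "S\<lparr>carrier := R\<rparr>" H p \<omega>H +
  K: fusion_idempotent "S\<lparr>carrier := T\<rparr>" K p \<omega>K
  for S :: "('a, 'b) monoid_scheme" and F R H T K p \<omega>F \<omega>H \<omega>K +
  assumes HF: "fusion_subsystem S F R H" and KF: "fusion_subsystem S F T K"
begin

abbreviation "SR \<equiv> S\<lparr>carrier := R\<rparr>"
abbreviation "ST \<equiv> S\<lparr>carrier := T\<rparr>"
abbreviation "SU \<equiv> S\<lparr>carrier := R \<inter> T\<rparr>"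

text \<open>\<open>restricted_idem\<close> and \<open>product_idem\<close> are the two sides of the equation to be characterized.\<close>

definition restricted_idem where
  "restricted_idem = biset_comp p ST S SR
    (biset_comp p S S SR (transitive_class p S SR R id) \<omega>F) (transitive_class p ST S T id)"

definition product_idem where
  "product_idem = biset_comp p ST ST SR
    (biset_comp p ST SR SR \<omega>H (transitive_class p ST SR (R \<inter> T) id)) \<omega>K"

lemma R: "subgroup R S" and T: "subgroup T S"
  using HF KF by (auto simp: fusion_subsystem_def)

lemma U: "subgroup (R \<inter> T) S"
  by (rule F.subgroups_Inter_pair[OF R T])

lemma subgroup_restrict_iff:
  assumes "subgroup Q S"
  shows "subgroup P (S\<lparr>carrier := Q\<rparr>) \<longleftrightarrow> subgroup P S \<and> P \<subseteq> Q"
  using F.incl_subgroup[OF assms] F.subgroup_incl[OF _ assms] subgroup.subset[of P "S\<lparr>carrier := Q\<rparr>"] by auto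

lemma hom_carrier_mono:
  "c \<in> hom L (S\<lparr>carrier := A\<rparr>) \<Longrightarrow> A \<subseteq> B \<Longrightarrow> c \<in> hom L (S\<lparr>carrier := B\<rparr>)"
  by (auto simp: hom_def)

lemma hom_R: "c \<in> hom L SR \<Longrightarrow> c \<in> hom L S" and hom_T: "c \<in> hom L ST \<Longrightarrow> c \<in> hom L S"
  using subgroup.subset[OF R] subgroup.subset[OF T] by (auto simp: hom_def)

lemma hom_U: "c \<in> hom L SU \<Longrightarrow> c \<in> hom L SR" "c \<in> hom L SU \<Longrightarrow> c \<in> hom L ST"
  by (auto simp: hom_def)

lemma fin: "finite R" "finite T" "finite (R \<inter> T)"
  using F.finite_subgroup R T U by auto

lemma carrier_pos: "card (carrier S) > 0" "card R > 0" "card T > 0" "card (R \<inter> T) > 0"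
  using F.finite_carrier fin subgroup.one_closed[OF R] subgroup.one_closed[OF T] F.one_closed
  by (auto simp: card_gt_0_iff)

text \<open>Composing with \<open>[R, id]\<close> and \<open>[T, id]\<close> is restriction to \<open>R\<close> on the left and to \<open>T\<close> on the right, so
the marks of the restricted idempotent are marks of the idempotent.\<close>

lemma restricted_idem_module: "restricted_idem \<in> biset_module p ST SR"
  and restricted_idem_mark:
    "\<lbrakk>group L; finite (carrier L); a \<in> hom L SR; b \<in> hom L ST\<rbrakk> \<Longrightarrow>
      class_mark (carrier L) a b restricted_idem = class_mark (carrier L) a b \<omega>F"
proof -
  interpret A: biset_comp_setup S S SR p by unfold_locales (rule F.p)
  interpret B: biset_comp_setup ST S SR p by unfold_locales (rule F.p)
  have iR: "id \<in> hom (S\<lparr>carrier := R\<rparr>) SR" and iT: "id \<in> hom ST S"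
    using subgroup.subset[OF T] by (auto simp: hom_def)
  note tR = transitive_class_left_free(1)[OF F.p F.is_group H.is_group F.finite_carrier H.finite_carrier R iR]
  note inner = A.biset_comp_closed[OF tR F.idem_module]
  have T': "subgroup T ST" using K.subgroup_self by simp
  have iT': "id \<in> hom (ST\<lparr>carrier := T\<rparr>) S" using iT by simp
  show "restricted_idem \<in> biset_module p ST SR"
    unfolding restricted_idem_def
    by (intro B.biset_comp_closed inner transitive_class_left_free(1)[OF F.p K.is_group F.is_group
      K.finite_carrier F.finite_carrier T' iT'])
  assume L: "group L" "finite (carrier L)" and a: "a \<in> hom L SR" and b: "b \<in> hom L ST"
  have "class_mark (carrier L) a b restricted_idem =
      class_mark (carrier L) a (\<lambda>u. id (b u)) (biset_comp p S S SR (transitive_class p S SR R id) \<omega>F)"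
    unfolding restricted_idem_def
    using B.class_mark_comp_restriction[OF L K.finite_carrier F.finite_carrier a b inner iT] by simp
  also have "\<dots> = class_mark (carrier L) (\<lambda>u. id (a u)) b \<omega>F"
    unfolding id_apply[of "b _"]
    using A.class_mark_comp_iso[OF L F.finite_carrier H.finite_carrier a hom_T[OF b] F.idem_module
      F.idem_left_free R iR iR] by simp
  finally show "class_mark (carrier L) a b restricted_idem = class_mark (carrier L) a b \<omega>F" by simp
qed

text \<open>The class \<open>[R \<inter> T, id]\<close> identifies the intermediate homomorphisms into \<open>R\<close> and into \<open>T\<close> up to
conjugation, so the marks of the composite are a matrix product over homomorphisms into \<open>R \<inter> T\<close>.\<close>

lemma product_idem_module: "product_idem \<in> biset_module p ST SR"
  and product_idem_mark:
    "\<lbrakk>group L; finite (carrier L); a \<in> hom L SR; b \<in> hom L ST\<rbrakk> \<Longrightarrow>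
      of_nat (card (R \<inter> T)) * class_mark (carrier L) a b product_idem =
      (\<Sum>c\<in>homs L SU. class_mark (carrier L) a c \<omega>H * class_mark (carrier L) c b \<omega>K)"
proof -
  interpret A: biset_comp_setup ST SR SR p by unfold_locales (rule F.p)
  interpret B: biset_comp_setup ST ST SR p by unfold_locales (rule F.p)
  have UT: "subgroup (R \<inter> T) ST" using subgroup_restrict_iff[OF T] U by simp
  have i: "id \<in> hom (ST\<lparr>carrier := R \<inter> T\<rparr>) SR" by (auto simp: hom_def)
  note t = transitive_class_left_free(1)[OF F.p K.is_group H.is_group K.finite_carrier H.finite_carrier UT i]
  note inner = A.biset_comp_closed[OF H.idem_module t]
  show "product_idem \<in> biset_module p ST SR"
    unfolding product_idem_def by (intro B.biset_comp_closed inner K.idem_module)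
  assume L: "group L" "finite (carrier L)" and a: "a \<in> hom L SR" and b: "b \<in> hom L ST"
  let ?W = "biset_comp p ST SR SR \<omega>H (transitive_class p ST SR (R \<inter> T) id)"
  let ?n = "\<lambda>d c. rat_of_nat (card (conjugators ST L d c))"
  have W: "of_nat (card (R \<inter> T)) * class_mark (carrier L) a d ?W =
      (\<Sum>c\<in>homs L SU. ?n d c * class_mark (carrier L) a c \<omega>H)" if d: "d \<in> homs L ST" for d
    using A.class_mark_comp_coset_right[OF L K.finite_carrier H.finite_carrier a homsD[OF d] H.idem_module UT i]
    by simp
  have "of_nat (card T) * (of_nat (card (R \<inter> T)) * class_mark (carrier L) a b product_idem) =
    (\<Sum>d\<in>homs L ST. (of_nat (card (R \<inter> T)) * class_mark (carrier L) a d ?W) * class_mark (carrier L) d b \<omega>K)"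
    using arg_cong[OF B.class_mark_comp[OF L K.finite_carrier a b inner K.idem_module K.idem_left_free],
        of "(*) (of_nat (card (R \<inter> T)))"]
    by (simp add: product_idem_def sum_distrib_left mult_ac)
  also have "\<dots> = (\<Sum>d\<in>homs L ST. (\<Sum>c\<in>homs L SU. ?n d c * class_mark (carrier L) a c \<omega>H) *
      class_mark (carrier L) d b \<omega>K)"
    by (intro sum.cong refl arg_cong2[where f = "(*)"] W)
  also have "\<dots> = (\<Sum>d\<in>homs L ST. \<Sum>c\<in>homs L SU.
      class_mark (carrier L) a c \<omega>H * (?n d c * class_mark (carrier L) d b \<omega>K))"
    unfolding sum_distrib_right by (intro sum.cong refl) (simp only: mult_ac)
  also have "\<dots> = (\<Sum>c\<in>homs L SU. class_mark (carrier L) a c \<omega>H *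
      (\<Sum>d\<in>homs L ST. ?n d c * class_mark (carrier L) d b \<omega>K))"
    unfolding sum_distrib_left by (rule sum.swap)
  also have "\<dots> = (\<Sum>c\<in>homs L SU. class_mark (carrier L) a c \<omega>H *
      (of_nat (card (carrier ST)) * class_mark (carrier L) c b \<omega>K))"
  proof (intro sum.cong refl arg_cong2[where f = "(*)"])
    fix c assume "c \<in> homs L SU"
    then have c: "c \<in> hom L ST" using hom_U homsD by blast
    show "(\<Sum>d\<in>homs L ST. ?n d c * class_mark (carrier L) d b \<omega>K) =
        of_nat (card (carrier ST)) * class_mark (carrier L) c b \<omega>K"
      by (rule sum_over_conjugates[OF L K.is_group K.finite_carrier c])
        (rule class_mark_conj_left[OF F.p K.is_group K.is_group K.idem_module hom_funcset[OF c] hom_funcset[OF b]])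
  qed
  also have "\<dots> = of_nat (card T) * (\<Sum>c\<in>homs L SU. class_mark (carrier L) a c \<omega>H * class_mark (carrier L) c b \<omega>K)"
    by (simp add: sum_distrib_left mult_ac)
  finally show "of_nat (card (R \<inter> T)) * class_mark (carrier L) a b product_idem =
      (\<Sum>c\<in>homs L SU. class_mark (carrier L) a c \<omega>H * class_mark (carrier L) c b \<omega>K)"
    using carrier_pos(3) by simp
qed

text \<open>For \<open>b\<close> injective these are the ways to write \<open>a \<circ> b\<inverse>\<close> as a morphism of \<open>K\<close> into \<open>R \<inter> T\<close>
followed by a morphism of \<open>H\<close>, recorded by their intermediate homomorphism.\<close>

definition factorizations ::
    "('l, 'q) monoid_scheme \<Rightarrow> ('l \<Rightarrow> 'a) \<Rightarrow> ('l \<Rightarrow> 'a) \<Rightarrow> ('l \<Rightarrow> 'a) set" where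
  "factorizations L a b = {c \<in> homs L SU. H.linked (carrier L) a c \<and> K.linked (carrier L) c b}"

lemma H_linked_F: "\<lbrakk>group L; b \<in> hom L SR; H.linked (carrier L) a b\<rbrakk> \<Longrightarrow> F.linked (carrier L) a b"
  by (rule F.linked_subsystem[OF H.finite_fusion_system_axioms HF])

lemma K_linked_F: "\<lbrakk>group L; b \<in> hom L ST; K.linked (carrier L) a b\<rbrakk> \<Longrightarrow> F.linked (carrier L) a b"
  by (rule F.linked_subsystem[OF K.finite_fusion_system_axioms KF])

lemma factorization_linked:
  assumes "group L" "b \<in> hom L ST" "c \<in> factorizations L a b"
  shows "F.linked (carrier L) c b" "F.linked (carrier L) a b"
proof -
  have c: "c \<in> hom L SU" "H.linked (carrier L) a c" "K.linked (carrier L) c b"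
    using assms(3) homsD by (auto simp: factorizations_def)
  show cb: "F.linked (carrier L) c b" by (rule K_linked_F[OF assms(1,2) c(3)])
  show "F.linked (carrier L) a b"
    by (rule F.linked_trans[OF assms(1) hom_T[OF assms(2)] H_linked_F[OF assms(1) hom_U(1)[OF c(1)] c(2)] cb])
qed

text \<open>Two factorizations differ by an isomorphism between their images that belongs to \<open>H\<close> and to \<open>K\<close>.
So composing a fixed factorization \<open>c0\<close> with the morphisms of \<open>H \<inter> K\<close> from its image gives each
factorization exactly once.\<close>

lemma card_factorizations:
  assumes L: "group L" and a: "a \<in> hom L SR" and b: "b \<in> hom L ST" and c0: "c0 \<in> factorizations L a b"
  shows "card (factorizations L a b) = card (fusion_inter H K (c0 ` carrier L) (R \<inter> T))"
proof -
  define Q where "Q = c0 ` carrier L"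
  have c: "c0 \<in> homs L SU" "H.linked (carrier L) a c0" "K.linked (carrier L) c0 b"
    using c0 by (auto simp: factorizations_def)
  note cU = homsD[OF c(1)]
  have QR: "subgroup Q SR" and QT: "subgroup Q ST"
    unfolding Q_def by (rule H.hom_image_subgroup[OF L hom_U(1)[OF cU]], rule K.hom_image_subgroup[OF L hom_U(2)[OF cU]])
  have UR: "subgroup (R \<inter> T) SR" and UT: "subgroup (R \<inter> T) ST"
    using U subgroup_restrict_iff R T by auto
  have "bij_betw (\<lambda>\<sigma>. \<lambda>u\<in>carrier L. \<sigma> (c0 u)) (fusion_inter H K Q (R \<inter> T)) (factorizations L a b)"
    unfolding bij_betw_def
  proof
    show "inj_on (\<lambda>\<sigma>. \<lambda>u\<in>carrier L. \<sigma> (c0 u)) (fusion_inter H K Q (R \<inter> T))"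
    proof (rule inj_onI)
      fix \<sigma> \<tau> assume st: "\<sigma> \<in> fusion_inter H K Q (R \<inter> T)" "\<tau> \<in> fusion_inter H K Q (R \<inter> T)"
        and eq: "(\<lambda>u\<in>carrier L. \<sigma> (c0 u)) = (\<lambda>u\<in>carrier L. \<tau> (c0 u))"
      have "\<sigma> \<in> extensional Q" "\<tau> \<in> extensional Q"
        using st H.fusion_hom(3)[OF QR UR] by (auto simp: fusion_inter_def)
      moreover have "\<sigma> (c0 u) = \<tau> (c0 u)" if "u \<in> carrier L" for u
        using fun_cong[OF eq, of u] that by simp
      ultimately show "\<sigma> = \<tau>" by (intro extensionalityI[of _ Q]) (auto simp: Q_def)
    qed
    show "(\<lambda>\<sigma>. \<lambda>u\<in>carrier L. \<sigma> (c0 u)) ` fusion_inter H K Q (R \<inter> T) = factorizations L a b"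
    proof (intro equalityI subsetI)
      fix d assume "d \<in> (\<lambda>\<sigma>. \<lambda>u\<in>carrier L. \<sigma> (c0 u)) ` fusion_inter H K Q (R \<inter> T)"
      then obtain \<sigma> where \<sigma>: "\<sigma> \<in> H Q (R \<inter> T)" "\<sigma> \<in> K Q (R \<inter> T)" "d = (\<lambda>u\<in>carrier L. \<sigma> (c0 u))"
        by (auto simp: fusion_inter_def)
      have c0Q: "c0 \<in> hom L (S\<lparr>carrier := Q\<rparr>)" using cU by (auto simp: hom_def Q_def)
      have d: "d \<in> homs L SU"
        unfolding \<sigma>(3) using restrict_homs[OF L hom_compose[OF c0Q, of \<sigma> SU]]
          H.fusion_hom(1)[OF QR UR \<sigma>(1)] by (simp add: comp_def)
      have "\<sigma> \<in> H Q (carrier SR)"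
        using H.fusion_codomain[OF QR UR \<sigma>(1) H.subgroup_self] H.fusion_hom(4)[OF QR UR \<sigma>(1)] by auto
      then have "H.linked (carrier L) d c0"
        unfolding H.linked_def Q_def[symmetric] \<sigma>(3) by (intro bexI[of _ \<sigma>]) auto
      then have 1: "H.linked (carrier L) a d"
        by (intro H.linked_trans[OF L hom_U(1)[OF homsD[OF d]] c(2)] H.linked_sym[OF L hom_U(1)[OF cU]])
      have "\<sigma> \<in> K Q (carrier ST)"
        using K.fusion_codomain[OF QT UT \<sigma>(2) K.subgroup_self] K.fusion_hom(4)[OF QT UT \<sigma>(2)] by auto
      then have "K.linked (carrier L) d c0"
        unfolding K.linked_def Q_def[symmetric] \<sigma>(3) by (intro bexI[of _ \<sigma>]) auto
      then have "K.linked (carrier L) d b"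
        by (rule K.linked_trans[OF L b _ c(3)])
      with 1 d show "d \<in> factorizations L a b" by (simp add: factorizations_def)
    next
      fix d assume "d \<in> factorizations L a b"
      then have d: "d \<in> homs L SU" "H.linked (carrier L) a d" "K.linked (carrier L) d b"
        by (auto simp: factorizations_def)
      note dU = homsD[OF d(1)]
      have "H.linked (carrier L) d c0"
        by (rule H.linked_trans[OF L hom_U(1)[OF cU] H.linked_sym[OF L hom_U(1)[OF dU] d(2)] c(2)])
      then obtain \<sigma> where \<sigma>: "\<sigma> \<in> H Q (carrier SR)" "\<And>u. u \<in> carrier L \<Longrightarrow> d u = \<sigma> (c0 u)"
        unfolding H.linked_def Q_def by blast
      have "K.linked (carrier L) d c0"
        by (rule K.linked_trans[OF L hom_U(2)[OF cU] d(3) K.linked_sym[OF L b c(3)]])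
      then obtain \<tau> where \<tau>: "\<tau> \<in> K Q (carrier ST)" "\<And>u. u \<in> carrier L \<Longrightarrow> d u = \<tau> (c0 u)"
        unfolding K.linked_def Q_def by blast
      have "\<sigma> = \<tau>"
        using H.fusion_hom(3)[OF QR H.subgroup_self \<sigma>(1)] K.fusion_hom(3)[OF QT K.subgroup_self \<tau>(1)] \<sigma>(2) \<tau>(2)
        by (intro extensionalityI[of _ Q]) (auto simp: Q_def)
      moreover have dU': "d u \<in> R \<inter> T" if "u \<in> carrier L" for u using hom_in_carrier[OF dU that] by simp
      then have "\<sigma> ` Q \<subseteq> R \<inter> T" "\<tau> ` Q \<subseteq> R \<inter> T" using \<sigma>(2) \<tau>(2) by (auto simp: Q_def)
      then have "\<sigma> \<in> H Q (R \<inter> T)" "\<tau> \<in> K Q (R \<inter> T)"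
        using H.fusion_codomain[OF QR H.subgroup_self \<sigma>(1) UR] K.fusion_codomain[OF QT K.subgroup_self \<tau>(1) UT] by blast+
      ultimately have "\<sigma> \<in> fusion_inter H K Q (R \<inter> T)" by (simp add: fusion_inter_def)
      moreover have "d = (\<lambda>u\<in>carrier L. \<sigma> (c0 u))"
        using d(1) \<sigma>(2) by (intro extensionalityI[of _ "carrier L"]) (auto simp: homs_def)
      ultimately show "d \<in> (\<lambda>\<sigma>. \<lambda>u\<in>carrier L. \<sigma> (c0 u)) ` fusion_inter H K Q (R \<inter> T)" by blast
    qed
  qed
  then show ?thesis unfolding Q_def by (simp add: bij_betw_same_card)
qed

lemma product_idem_mark_sum:
  assumes L: "group L" "finite (carrier L)" and a: "a \<in> hom L SR" and b: "b \<in> hom L ST"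
  shows "of_nat (card (R \<inter> T)) * class_mark (carrier L) a b product_idem =
    (\<Sum>c\<in>factorizations L a b. of_nat (card R) / of_nat (card (H (c ` carrier L) R)) *
      (of_nat (card T) / of_nat (card (K (b ` carrier L) T))))"
proof -
  have "finite (carrier SU)" using fin by simp
  then have "(\<Sum>c\<in>homs L SU. class_mark (carrier L) a c \<omega>H * class_mark (carrier L) c b \<omega>K) =
    (\<Sum>c\<in>factorizations L a b. class_mark (carrier L) a c \<omega>H * class_mark (carrier L) c b \<omega>K)"
    using H.idem_mark_unlinked[OF L a hom_U(1)[OF homsD]] K.idem_mark_unlinked[OF L hom_U(2)[OF homsD] b]
    by (intro sum.mono_neutral_right finite_homs L) (auto simp: factorizations_def)
  also have "\<dots> = (\<Sum>c\<in>factorizations L a b. of_nat (card R) / of_nat (card (H (c ` carrier L) R)) *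
      (of_nat (card T) / of_nat (card (K (b ` carrier L) T))))"
  proof (rule sum.cong[OF refl])
    fix c assume "c \<in> factorizations L a b"
    then have c: "c \<in> homs L SU" "H.linked (carrier L) a c" "K.linked (carrier L) c b"
      by (auto simp: factorizations_def)
    show "class_mark (carrier L) a c \<omega>H * class_mark (carrier L) c b \<omega>K =
      of_nat (card R) / of_nat (card (H (c ` carrier L) R)) * (of_nat (card T) / of_nat (card (K (b ` carrier L) T)))"
      using H.idem_mark[OF L a hom_U(1)[OF homsD[OF c(1)]]] K.idem_mark[OF L hom_U(2)[OF homsD[OF c(1)]] b] c(2,3)
      by simp
  qed
  finally show ?thesis using product_idem_mark[OF assms] by simp
qed

text \<open>All summands in \<open>product_idem_mark_sum\<close> are equal, because subgroups that are isomorphic in a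
fusion system have equally many morphisms into the whole group.\<close>

lemma product_idem_mark_factorization:
  assumes L: "group L" "finite (carrier L)" and a: "a \<in> hom L SR" and b: "b \<in> hom L ST"
    and c0: "c0 \<in> factorizations L a b"
  defines "Q \<equiv> c0 ` carrier L"
  shows "of_nat (card (R \<inter> T)) * class_mark (carrier L) a b product_idem =
    of_nat (card (fusion_inter H K Q (R \<inter> T))) * (of_nat (card R) * of_nat (card T)) /
      (of_nat (card (H Q R)) * of_nat (card (K Q T)))"
proof -
  have c: "c0 \<in> homs L SU" "H.linked (carrier L) a c0" "K.linked (carrier L) c0 b"
    using c0 by (auto simp: factorizations_def)
  have "card (K (b ` carrier L) T) = card (K Q T)"
    unfolding Q_def using K.linked_card[OF L(1) b c(3)] by simp
  moreover have "card (H (d ` carrier L) R) = card (H Q R)" if "d \<in> factorizations L a b" for d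
  proof -
    have d: "d \<in> homs L SU" "H.linked (carrier L) a d" using that by (auto simp: factorizations_def)
    show ?thesis unfolding Q_def
      using H.linked_card[OF L(1) hom_U(1)[OF homsD[OF c(1)]] c(2)]
        H.linked_card[OF L(1) hom_U(1)[OF homsD[OF d(1)]] d(2)] by simp
  qed
  ultimately show ?thesis
    unfolding product_idem_mark_sum[OF L a b] using card_factorizations[OF L(1) a b c0]
    by (simp add: Q_def)
qed

lemma restricted_idem_mark_value:
  assumes L: "group L" "finite (carrier L)" and a: "a \<in> hom L SR" and b: "b \<in> hom L ST"
  shows "class_mark (carrier L) a b restricted_idem = (if F.linked (carrier L) a b
    then of_nat (card (carrier S)) / of_nat (card (F (b ` carrier L) (carrier S))) else 0)"
  unfolding restricted_idem_mark[OF assms] by (rule F.idem_mark[OF L hom_R[OF a] hom_T[OF b]])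

lemma fusion_card_pos:
  assumes "subgroup Q SU"
  shows "card (F Q (carrier S)) > 0" "card (H Q R) > 0" "card (K Q T) > 0"
    "card (fusion_inter H K Q (R \<inter> T)) > 0"
proof -
  have Q: "subgroup Q S" "Q \<subseteq> R \<inter> T" using assms subgroup_restrict_iff[OF U] by auto
  have QR: "subgroup Q SR" and QT: "subgroup Q ST" and UR: "subgroup (R \<inter> T) SR" and UT: "subgroup (R \<inter> T) ST"
    using Q U subgroup_restrict_iff R T by auto
  show "card (F Q (carrier S)) > 0" by (rule F.card_fusion_pos[OF Q(1)])
  show "card (H Q R) > 0" using H.card_fusion_pos[OF QR] by simp
  show "card (K Q T) > 0" using K.card_fusion_pos[OF QT] by simp
  have "(\<lambda>u\<in>Q. u) \<in> fusion_inter H K Q (R \<inter> T)"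
    using H.fusion_inclusion[OF QR UR Q(2)] K.fusion_inclusion[OF QT UT Q(2)] by (simp add: fusion_inter_def)
  moreover have "finite (fusion_inter H K Q (R \<inter> T))"
    using H.finite_fusion[OF QR UR] by (simp add: fusion_inter_def)
  ultimately show "card (fusion_inter H K Q (R \<inter> T)) > 0" by (auto simp: card_gt_0_iff)
qed

text \<open>The marks at the diagonal of \<open>Q \<le> R \<inter> T\<close> give the numerical condition up to the factor
\<open>|S| |R \<inter> T| / (|R| |T|)\<close>. For \<open>Q = 1\<close>, where each fusion system has one morphism, they say that this
factor is \<open>1\<close>, that is, \<open>S = R T\<close>. The marks at the graph of a morphism into \<open>R\<close> are nonzero, which
yields a factorization.\<close>

lemma product_if_idem_eq:
  assumes eq: "restricted_idem = product_idem"
  shows "composition_product S F R H T K"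
proof -
  have card_eq: "of_nat (card (R \<inter> T)) * (of_nat (card (carrier S)) / of_nat (card (F Q (carrier S)))) =
    of_nat (card (fusion_inter H K Q (R \<inter> T))) * (of_nat (card R) * of_nat (card T)) /
      (rat_of_nat (card (H Q R)) * of_nat (card (K Q T)))" if Q: "subgroup Q SU" for Q
  proof -
    have QS: "subgroup Q S" "Q \<subseteq> R" "Q \<subseteq> T" using Q subgroup_restrict_iff[OF U] by auto
    let ?L = "S\<lparr>carrier := Q\<rparr>"
    have L: "group ?L" "finite (carrier ?L)" using F.subgroup_group[OF QS(1)] F.finite_subgroup[OF QS(1)] by auto
    have i: "(\<lambda>u. u) \<in> hom ?L SR" "(\<lambda>u. u) \<in> hom ?L ST" "(\<lambda>u. u) \<in> hom ?L SU" using QS by (auto simp: hom_def)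
    define c0 where "c0 = (\<lambda>u\<in>Q. u)"
    have c0: "c0 \<in> homs ?L SU" using restrict_homs[OF L(1) i(3)] by (simp add: c0_def)
    have "H.linked Q (\<lambda>u. u) c0" "K.linked Q c0 (\<lambda>u. u)"
      using H.linked_refl[OF L(1) i(1)] K.linked_refl[OF L(1) i(2)]
      by (auto simp: H.linked_def K.linked_def c0_def)
    then have "c0 \<in> factorizations ?L (\<lambda>u. u) (\<lambda>u. u)" using c0 by (simp add: factorizations_def)
    from product_idem_mark_factorization[OF L i(1,2) this] show ?thesis
      using restricted_idem_mark_value[OF L i(1,2)] F.linked_refl[OF L(1) hom_R[OF i(1)]]
      by (simp add: eq[symmetric] c0_def)
  qed
  have one: "subgroup {\<one>\<^bsub>S\<^esub>} SU"
    using F.triv_subgroup subgroup_restrict_iff[OF U] subgroup.one_closed[OF U] by simp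
  have "fusion_inter H K {\<one>\<^bsub>S\<^esub>} (R \<inter> T) = {\<lambda>u\<in>{\<one>\<^bsub>S\<^esub>}. u}"
  proof -
    have t: "subgroup {\<one>\<^bsub>S\<^esub>} SR" "subgroup (R \<inter> T) SR"
      using H.triv_subgroup U subgroup_restrict_iff[OF R] by auto
    have "fusion_inter H K {\<one>\<^bsub>S\<^esub>} (R \<inter> T) \<subseteq> H {\<one>\<^bsub>S\<^esub>} (carrier SR)"
      using H.fusion_codomain[OF t _ H.subgroup_self] H.fusion_hom(4)[OF t] by (auto simp: fusion_inter_def)
    then have "fusion_inter H K {\<one>\<^bsub>S\<^esub>} (R \<inter> T) \<subseteq> {\<lambda>u\<in>{\<one>\<^bsub>S\<^esub>}. u}" using H.fusion_trivial by simp
    then show ?thesis using fusion_card_pos(4)[OF one]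
      by (metis card.empty less_irrefl subset_singletonD)
  qed
  then have "rat_of_nat (card (R \<inter> T)) * of_nat (card (carrier S)) = of_nat (card R) * of_nat (card T)"
    using card_eq[OF one] F.fusion_trivial H.fusion_trivial K.fusion_trivial by simp
  then have orders: "card (carrier S) * card (R \<inter> T) = card R * card T"
    by (metis mult.commute of_nat_eq_iff of_nat_mult)
  have "R <#>\<^bsub>S\<^esub> T \<subseteq> carrier S"
    using subgroup.subset[OF R] subgroup.subset[OF T] by (rule F.set_mult_closed)
  moreover have "card (R <#>\<^bsub>S\<^esub> T) = card (carrier S)"
    using F.card_set_mult_subgroups[OF R fin(1) T fin(2)] orders carrier_pos(4)
    by (metis less_irrefl mult_cancel2)
  ultimately have 1: "carrier S = R <#>\<^bsub>S\<^esub> T" using card_subset_eq[OF F.finite_carrier] by metis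
  have 2: "\<exists>Q. subgroup Q SU \<and> (\<exists>\<rho>\<in>K P Q. \<exists>\<psi>\<in>H Q R. \<phi> = compose P \<psi> \<rho>)"
    if P: "subgroup P ST" and \<phi>: "\<phi> \<in> F P R" for P \<phi>
  proof -
    have PS: "subgroup P S" "P \<subseteq> T" using P subgroup_restrict_iff[OF T] by auto
    note \<phi>' = F.fusion_hom[OF PS(1) R \<phi>]
    let ?L = "S\<lparr>carrier := P\<rparr>"
    have L: "group ?L" "finite (carrier ?L)" using F.subgroup_group[OF PS(1)] F.finite_subgroup[OF PS(1)] by auto
    have i: "(\<lambda>u. u) \<in> hom ?L ST" using PS by (auto simp: hom_def)
    have "\<phi> \<in> F P (carrier S)"
      using F.fusion_codomain[OF PS(1) R \<phi> F.subgroup_self] \<phi>'(4) subgroup.subset[OF R] by blast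
    then have "F.linked (carrier ?L) \<phi> (\<lambda>u. u)" by (auto simp: F.linked_def)
    then have "class_mark (carrier ?L) \<phi> (\<lambda>u. u) product_idem \<noteq> 0"
      using restricted_idem_mark_value[OF L \<phi>'(1) i] carrier_pos(1) F.card_fusion_pos[OF PS(1)] eq by simp
    then have "(\<Sum>c\<in>factorizations ?L \<phi> (\<lambda>u. u). of_nat (card R) / of_nat (card (H (c ` carrier ?L) R)) *
      (of_nat (card T) / rat_of_nat (card (K ((\<lambda>u. u) ` carrier ?L) T)))) \<noteq> 0"
      using product_idem_mark_sum[OF L \<phi>'(1) i] carrier_pos(4) by auto
    then obtain c where "c \<in> factorizations ?L \<phi> (\<lambda>u. u)" by (meson sum.neutral)
    then have c: "c \<in> homs ?L SU" "H.linked P \<phi> c" "K.linked P c (\<lambda>u. u)"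
      by (auto simp: factorizations_def)
    have Q: "subgroup (c ` P) SU"
    proof -
      interpret U: group SU by (rule F.subgroup_group[OF U])
      interpret c: group_hom ?L SU c
        using homsD[OF c(1)] L(1) by (simp add: group_hom_def group_hom_axioms_def U.is_group)
      show ?thesis using c.img_is_subgroup by simp
    qed
    have QT: "subgroup (c ` P) ST" using Q subgroup_restrict_iff U T by auto
    have "c \<in> homs (ST\<lparr>carrier := P\<rparr>) ST" using c(1) hom_U(2) by (auto simp: homs_def)
    then have "c \<in> K P (carrier ST)" using K.linked_subgroup_iff[OF P] c(3) by blast
    then have cK: "c \<in> K P (c ` P)" using K.fusion_image(1)[OF P K.subgroup_self] by blast
    obtain \<psi> where \<psi>: "\<psi> \<in> H (c ` P) R" "\<And>u. u \<in> P \<Longrightarrow> \<phi> u = \<psi> (c u)"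
      using c(2) unfolding H.linked_def by auto
    have "\<phi> = compose P \<psi> c"
      using \<phi>'(3) \<psi>(2) by (intro extensionalityI[of _ P]) (auto simp: compose_def)
    then show ?thesis using Q cK \<psi>(1) by blast
  qed
  have 3: "rat_of_nat (card (F Q (carrier S))) = rat_of_nat (card (H Q R)) * rat_of_nat (card (K Q T)) /
      rat_of_nat (card (fusion_inter H K Q (R \<inter> T)))" if Q: "subgroup Q SU" for Q
  proof -
    have o: "rat_of_nat (card (carrier S)) * of_nat (card (R \<inter> T)) = of_nat (card R) * of_nat (card T)"
      using orders by (metis of_nat_mult)
    have "rat_of_nat (card (carrier S)) * of_nat (card (R \<inter> T)) / of_nat (card (F Q (carrier S))) =
      (rat_of_nat (card (carrier S)) * of_nat (card (R \<inter> T))) * of_nat (card (fusion_inter H K Q (R \<inter> T))) /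
        (of_nat (card (H Q R)) * of_nat (card (K Q T)))"
      using card_eq[OF Q] unfolding o by (simp add: o[symmetric] mult_ac)
    then show ?thesis using fusion_card_pos[OF Q] carrier_pos by (simp add: field_simps)
  qed
  show ?thesis unfolding composition_product_def using 1 2 3 by blast
qed

text \<open>By \<open>class_mark_eqI\<close> it suffices to compare the marks at each subgroup \<open>D\<close> of \<open>R \<times> T\<close>. If the two
projections of \<open>D\<close> are linked in \<open>F\<close>, then the link factorizes and the numerical condition at the
intermediate subgroup makes both marks equal to \<open>|S| / |F(Q, S)|\<close>; otherwise both marks vanish.\<close>

lemma idem_eq_if_product:
  assumes prod: "composition_product S F R H T K"
  shows "restricted_idem = product_idem"
proof (rule class_mark_eqI[OF F.p K.is_group H.is_group restricted_idem_module product_idem_module])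
  fix D assume D: "subgroup D (SR \<times>\<times> ST)"
  have grp: "group (SR \<times>\<times> ST)" by (rule DirProd_group[OF H.is_group K.is_group])
  define L where "L = (SR \<times>\<times> ST)\<lparr>carrier := D\<rparr>"
  have cL: "carrier L = D" by (simp add: L_def)
  have Dsub: "D \<subseteq> R \<times> T" using subgroup.subset[OF D] by simp
  have L: "group L" unfolding L_def by (rule subgroup.subgroup_is_group[OF D grp])
  have fL: "finite (carrier L)" unfolding cL using Dsub fin finite_subset by blast
  have a: "fst \<in> hom L SR" and b: "snd \<in> hom L ST" using Dsub by (auto simp: hom_def L_def)
  have S_eq: "carrier S = R <#>\<^bsub>S\<^esub> T"
    and factor: "\<And>P \<phi>. subgroup P ST \<Longrightarrow> \<phi> \<in> F P R \<Longrightarrow>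
        \<exists>Q. subgroup Q SU \<and> (\<exists>\<rho>\<in>K P Q. \<exists>\<psi>\<in>H Q R. \<phi> = compose P \<psi> \<rho>)"
    and count: "\<And>Q. subgroup Q SU \<Longrightarrow> rat_of_nat (card (F Q (carrier S))) =
        rat_of_nat (card (H Q R)) * rat_of_nat (card (K Q T)) / rat_of_nat (card (fusion_inter H K Q (R \<inter> T)))"
    using prod unfolding composition_product_def by blast+
  have "class_mark (carrier L) fst snd restricted_idem = class_mark (carrier L) fst snd product_idem"
  proof (cases "F.linked (carrier L) fst snd")
    case True
    define P where "P = snd ` carrier L"
    have PT: "subgroup P ST" unfolding P_def by (rule K.hom_image_subgroup[OF L b])
    obtain \<alpha> where \<alpha>: "\<alpha> \<in> F P (carrier S)" "\<And>u. u \<in> carrier L \<Longrightarrow> fst u = \<alpha> (snd u)"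
        "subgroup P S" "\<alpha> ` P = fst ` carrier L"
      by (rule F.linkedE[OF L hom_T[OF b] True, folded P_def]) (rule that)
    have "\<alpha> ` P \<subseteq> R" unfolding \<alpha>(4) using hom_in_carrier[OF a] by auto
    then have "\<alpha> \<in> F P R" by (rule F.fusion_codomain[OF \<alpha>(3) F.subgroup_self \<alpha>(1) R])
    from factor[OF PT this] obtain Q' \<rho> \<psi> where f: "subgroup Q' SU" "\<rho> \<in> K P Q'" "\<psi> \<in> H Q' R"
        "\<alpha> = compose P \<psi> \<rho>" by blast
    have Q': "subgroup Q' SR" "subgroup Q' ST" "Q' \<subseteq> R \<inter> T"
      using f(1) subgroup_restrict_iff U R T by auto
    note \<rho> = K.fusion_hom[OF PT Q'(2) f(2)]
    define c where "c = (\<lambda>u\<in>carrier L. \<rho> (snd u))"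
    have "snd \<in> hom L (ST\<lparr>carrier := P\<rparr>)" using b by (auto simp: hom_def P_def)
    from hom_compose[OF this \<rho>(1)] have "(\<lambda>u. \<rho> (snd u)) \<in> hom L (S\<lparr>carrier := Q'\<rparr>)"
      by (simp add: comp_def)
    then have cU: "c \<in> homs L SU"
      unfolding c_def using hom_carrier_mono[OF _ Q'(3)] by (intro restrict_homs L) blast
    define Q where "Q = c ` carrier L"
    have Q_eq: "Q = \<rho> ` P" by (auto simp: Q_def c_def P_def)
    have QR: "subgroup Q SR" unfolding Q_def by (rule H.hom_image_subgroup[OF L hom_U(1)[OF homsD[OF cU]]])
    have QU: "subgroup Q SU" using QR \<rho>(4) Q'(3) subgroup_restrict_iff U R unfolding Q_eq by auto
    have "restrict \<psi> Q \<in> H Q (carrier SR)"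
      using H.fusion_restrict[OF QR Q'(1) H.subgroup_self, of \<psi>] f(3) \<rho>(4) unfolding Q_eq by simp
    moreover have "fst u = restrict \<psi> Q (c u)" if u: "u \<in> carrier L" for u
      using \<alpha>(2)[OF u] u unfolding f(4) by (simp add: compose_def P_def c_def Q_def)
    ultimately have 1: "H.linked (carrier L) fst c"
      unfolding H.linked_def Q_def[symmetric] by blast
    have "\<rho> \<in> K P (carrier ST)"
      using K.fusion_codomain[OF PT Q'(2) f(2) K.subgroup_self] \<rho>(4) Q'(3) by auto
    then have 2: "K.linked (carrier L) c snd"
      unfolding K.linked_def P_def[symmetric] by (intro bexI[of _ \<rho>]) (auto simp: c_def)
    have cf: "c \<in> factorizations L fst snd" using 1 2 cU by (simp add: factorizations_def)
    have cardF: "card (F (snd ` carrier L) (carrier S)) = card (F Q (carrier S))"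
      unfolding Q_def using F.linked_card[OF L hom_T[OF b] factorization_linked(1)[OF L b cf]] by simp
    have "card (carrier S) * card (R \<inter> T) = card R * card T"
      unfolding S_eq by (rule F.card_set_mult_subgroups[OF R fin(1) T fin(2)])
    then have o: "rat_of_nat (card R) * of_nat (card T) = of_nat (card (R \<inter> T)) * of_nat (card (carrier S))"
      by (metis mult.commute of_nat_mult)
    have "of_nat (card (R \<inter> T)) * class_mark (carrier L) fst snd product_idem =
      of_nat (card (fusion_inter H K Q (R \<inter> T))) * (of_nat (card (R \<inter> T)) * of_nat (card (carrier S))) /
      (of_nat (card (H Q R)) * of_nat (card (K Q T)))"
      using product_idem_mark_factorization[OF L fL a b cf] unfolding Q_def o .
    also have "\<dots> = of_nat (card (R \<inter> T)) * (of_nat (card (carrier S)) / of_nat (card (F Q (carrier S))))"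
      unfolding count[OF QU] using fusion_card_pos[OF QU] by (simp add: field_simps)
    finally have eq: "of_nat (card (R \<inter> T)) * class_mark (carrier L) fst snd product_idem =
        of_nat (card (R \<inter> T)) * (of_nat (card (carrier S)) / of_nat (card (F Q (carrier S))))" .
    have "rat_of_nat (card (R \<inter> T)) \<noteq> 0" using carrier_pos(4) by simp
    from mult_left_cancel[OF this, THEN iffD1, OF eq]
    have "class_mark (carrier L) fst snd product_idem =
        of_nat (card (carrier S)) / of_nat (card (F Q (carrier S)))" .
    then show ?thesis using restricted_idem_mark_value[OF L fL a b] True cardF by simp
  next
    case False
    then have "factorizations L fst snd = {}" using factorization_linked(2)[OF L b] by blast
    then have "of_nat (card (R \<inter> T)) * class_mark (carrier L) fst snd product_idem = 0"
      using product_idem_mark_sum[OF L fL a b] by simp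
    then show ?thesis using restricted_idem_mark_value[OF L fL a b] False carrier_pos(4) by simp
  qed
  then show "class_mark D fst snd restricted_idem = class_mark D fst snd product_idem"
    by (simp only: cL)
qed

end

theorem theoremE:
  fixes p :: nat and S :: "('a, 'b) monoid_scheme"
    and F H K :: "'a homs" and R T :: "'a set"
    and \<omega>F \<omega>H \<omega>K :: "('a, 'a) biset_comb set"
  assumes "prime p" and "p_group p S"
    and "saturated_fusion_system p S F"
    and "fusion_subsystem S F R H" and "saturated_fusion_system p (S\<lparr>carrier := R\<rparr>) H"
    and "fusion_subsystem S F T K" and "saturated_fusion_system p (S\<lparr>carrier := T\<rparr>) K"
    and "characteristic_idempotent p S F \<omega>F"
    and "characteristic_idempotent p (S\<lparr>carrier := R\<rparr>) H \<omega>H"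
    and "characteristic_idempotent p (S\<lparr>carrier := T\<rparr>) K \<omega>K"
  shows "composition_product S F R H T K \<longleftrightarrow>
    biset_comp p (S\<lparr>carrier := T\<rparr>) S (S\<lparr>carrier := R\<rparr>)
      (biset_comp p S S (S\<lparr>carrier := R\<rparr>)
        (transitive_class p S (S\<lparr>carrier := R\<rparr>) R id) \<omega>F)
      (transitive_class p (S\<lparr>carrier := T\<rparr>) S T id) =
    biset_comp p (S\<lparr>carrier := T\<rparr>) (S\<lparr>carrier := T\<rparr>) (S\<lparr>carrier := R\<rparr>)
      (biset_comp p (S\<lparr>carrier := T\<rparr>) (S\<lparr>carrier := R\<rparr>) (S\<lparr>carrier := R\<rparr>)
        \<omega>H (transitive_class p (S\<lparr>carrier := T\<rparr>) (S\<lparr>carrier := R\<rparr>) (R \<inter> T) id))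
      \<omega>K"
proof -
  have R: "subgroup R S" and T: "subgroup T S" using assms(4,6) by (auto simp: fusion_subsystem_def)
  have idem: "fusion_idempotent (S\<lparr>carrier := A\<rparr>) G p \<omega>"
    if "subgroup A S" "saturated_fusion_system p (S\<lparr>carrier := A\<rparr>) G"
      "characteristic_idempotent p (S\<lparr>carrier := A\<rparr>) G \<omega>" for A G \<omega>
    using p_group_subgroup[OF assms(1,2) that(1)] that(2,3) assms(1)
    by (simp add: fusion_idempotent_def fusion_idempotent_axioms_def finite_fusion_system_def
      finite_fusion_system_axioms_def p_group_def saturated_fusion_system_def)
  have "fusion_idempotent S F p \<omega>F"
    using assms(1,2,3,8)
    by (simp add: fusion_idempotent_def fusion_idempotent_axioms_def finite_fusion_system_def
      finite_fusion_system_axioms_def p_group_def saturated_fusion_system_def)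
  then interpret fusion_idempotent_pair S F R H T K p \<omega>F \<omega>H \<omega>K
    using idem[OF R assms(5,9)] idem[OF T assms(7,10)] assms(4,6)
    by (simp add: fusion_idempotent_pair_def fusion_idempotent_pair_axioms_def)
  show ?thesis
    using product_if_idem_eq idem_eq_if_product unfolding restricted_idem_def product_idem_def by blast
qed

end
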